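(* Let $z$ be a nonzero complex number and let $A$ be a weak $V\otimes V$-module. Then $(\tilde{T}'_{P(z)}(A), Y'_{P(z)})$ carries the structure of a weak $V$-module. Furthermore, if $A$ is a $V\otimes V$-module in the category $\mathcal{C}_{V\otimes V}^{o}$, then the linear map $\psi^{*}$, suitably restricted, is a $V$-isomorphism from $(\tilde{T}'_{P(z)}(A), Y'_{P(z)})$ to $(\tilde{T}'_{Q(-z^{-1})}(A^{\theta}), Y'_{Q(-z^{-1})})$, where $\psi$ is the linear automorphism of $A$ defined by $$\psi(a)=(e^{L(0)\log (-z^{2})}e^{zL(1)}\otimes e^{z^{-1}L(1)})a\qquad\text{for } a\in A$$ and $\psi^{*}:A^*\to A^*$ is the dual of $\psi$.
   Context: $V=(V,Y,\mathbf 1,\omega)$ is a fixed vertex operator algebra over $\mathbb C$, $Y(\omega,x)=\sum_n L(n)x^{-n-2}$. A weak $V$-module is a vector space $W$ with a linear map $Y:V\to(\mathrm{End}\,W)[[x,x^{-1}]]$ satisfying $Y(v,x)w\in W((x))$, $Y(\mathbf 1,x)=1$ and the Jacobi identity. A $V$-module is a weak $V$-module that is the direct sum of finite-dimensional $L(0)$-eigenspaces $W_{(h)}$, $h\in\mathbb C$, vanishing when the real part of $h$ is sufficiently negative. The same notions are used for the tensor product vertex operator algebra $V\otimes V$. $\mathcal C^o_{V\otimes V}$ is the category of $V\otimes V$-modules on which $L(0)\otimes 1$ and $1\otimes L(0)$ act semisimply. $\delta(x)=\sum_{n\in\mathbb Z}x^n$; powers of binomials are expanded in nonnegative integral powers of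 the second term; $\mathrm{Res}_{x}$ denotes the coefficient of $x^{-1}$. $G^{o}(v,x)=G(e^{xL(1)}(-x^{-2})^{L(0)}v,x^{-1})$ for a linear map $G$ from $V$ to $(\mathrm{End}\,M)[[x,x^{-1}]]$. $A^*$ is the full algebraic dual of $A$. For a weak $V\otimes V$-module $A$ let $Y_1(v,x)=Y_A(v\otimes\mathbf 1,x)$, $Y_2(v,x)=Y_A(\mathbf 1\otimes v,x)$. In the formula for $\psi$, operators in the first (second) tensor slot are those coming from $Y_1$ ($Y_2$): writing $Y_i(\omega,x)=\sum_nL^i(n)x^{-n-2}$, $\psi=e^{L^1(0)\log(-z^2)}e^{zL^1(1)}e^{z^{-1}L^2(1)}$, with $\log w=\log|w|+i\arg w$, $0\le\arg w<2\pi$. $A^\theta$ is the weak $V\otimes V$-module equal to $A$ as a vector space with $Y_{A^\theta}(u\otimes v,x)=Y_A(v\otimes u,x)$. $\tilde T'_{P(z)}(A)$: define $Y'_{P(z)}(v,x)\lambda\in A^*[[x,x^{-1}]]$ for $v\in V,\lambda\in A^*$ by $$\langle Y_{P(z)}'(v,x)\lambda,a\rangle=\mathrm{Res}_{x_{0}}z^{-1}\delta\left(\tfrac{x^{-1}-x_{0}}{z}\right)\langle\lambda,Y_{1}(e^{xL(1)}(-x^{-2})^{L(0)}v,x_{0})a\rangle+\langle\lambda,Y_{2}^{o}(v,x)a\rangle$$ for $a\in A$. $\tilde T'_{P(z)}(A)$ is the space of $\lambda\in A^*$ such that (a) for all $v\in V$, $Y'_{P(z)}(v,x)\lambda$ involves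 only finitely many negative powers of $x$; (b) for all $v\in V,a\in A$, $$x_{0}^{-1}\delta\left(\tfrac{x_{1}^{-1}-z}{x_{0}}\right)\langle Y_{P(z)}'(v,x_{1})\lambda,a\rangle=z^{-1}\delta\left(\tfrac{x_{1}^{-1}-x_{0}}{z}\right)\langle\lambda,Y_{1}(e^{x_{1}L(1)}(-x_{1}^{-2})^{L(0)}v,x_{0})a\rangle+x_{0}^{-1}\delta\left(\tfrac{z-x_{1}^{-1}}{-x_{0}}\right)\langle\lambda, Y_{2}^{o}(v,x_{1})a\rangle.$$ $\tilde T'_{Q(\zeta)}(B)$, for a nonzero complex number $\zeta$ and a weak $V\otimes V$-module $B$ (with associated $Y_1,Y_2$): on $B^*$ define $$\langle Y_{Q(\zeta)}'(v,x_{0})\lambda, b\rangle=\mathrm{Res}_{x_{1}}x_{0}^{-1}\delta\left(\tfrac{x_{1}-\zeta}{x_{0}}\right)\langle\lambda,Y_{1}^{o}(v,x_{1})b\rangle-\mathrm{Res}_{x_{1}}x_{0}^{-1}\delta\left(\tfrac{\zeta-x_{1}}{-x_{0}}\right)\langle\lambda,Y_{2}(v,x_{1})b\rangle.$$ $\tilde T'_{Q(\zeta)}(B)$ is the space of $\lambda\in B^*$ such that $Y'_{Q(\zeta)}(v,x)\lambda\in B^*((x))$ for all $v\in V$ and, for all $v\in V,b\in B$, $$\zeta^{-1}\delta\left(\tfrac{x_{1}-x_{0}}{\zeta}\right)\langle Y_{Q(\zeta)}'(v,x_{0})\lambda, b\rangle=x_{0}^{-1}\delta\left(\tfrac{x_{1}-\zeta}{x_{0}}\right)\langle\lambda,Y_{1}^{o}(v,x_{1})b\rangle-x_{0}^{-1}\delta\left(\tfrac{\zeta-x_{1}}{-x_{0}}\right)\langle\lambda,Y_{2}(v,x_{1})b\rangle;$$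 it is a weak $V$-module under $Y'_{Q(\zeta)}$.
   Formalization: In the formula for ψ the parameter z is replaced by −z, so ψ(a) = (e^{L(0)log(−z²)}e^{−zL(1)} ⊗ e^{−z^{-1}L(1)})a; with the printed signs ψ* does not commute with the action of ω, e.g. for A = V⊗V with ω ≠ 0. *)

theory Defs
  imports
    "HOL-Analysis.Analysis"
    "HOL-Library.Function_Algebras"
    "HOL-Library.Product_Plus"
    "HOL-Library.Groups_Big_Fun"
    "HOL-Library.Poly_Mapping"
begin

section \<open>Complex vector spaces\<close>

class complex_vector = ab_group_add +
  fixes scaleC :: "complex \<Rightarrow> 'a \<Rightarrow> 'a"  (infixr "*\<^sub>C" 75)
  assumes scaleC_add_right: "a *\<^sub>C (x + y) = a *\<^sub>C x + a *\<^sub>C y"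
    and scaleC_add_left: "(a + b) *\<^sub>C x = a *\<^sub>C x + b *\<^sub>C x"
    and scaleC_scaleC: "a *\<^sub>C b *\<^sub>C x = (a * b) *\<^sub>C x"
    and scaleC_one: "1 *\<^sub>C x = x"

global_interpretation complex_vector:
  vector_space "scaleC :: complex \<Rightarrow> 'a \<Rightarrow> 'a::complex_vector"
  by unfold_locales (simp_all add: scaleC_add_right scaleC_add_left scaleC_scaleC scaleC_one)

abbreviation clinear :: "('a::complex_vector \<Rightarrow> 'b::complex_vector) \<Rightarrow> bool" where
  "clinear \<equiv> Vector_Spaces.linear scaleC scaleC"

instantiation complex :: complex_vector
begin
definition scaleC_complex_def: "c *\<^sub>C (x::complex) = c * x"
instance by standard (simp_all add: scaleC_complex_def algebra_simps)
end

instantiation "fun" :: (type, complex_vector) complex_vector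
begin
definition scaleC_fun_def: "c *\<^sub>C f = (\<lambda>x. c *\<^sub>C f x)"
instance
  by standard (simp_all add: scaleC_fun_def fun_eq_iff scaleC_add_right scaleC_add_left
      scaleC_scaleC scaleC_one)
end

instantiation poly_mapping :: (type, complex_vector) complex_vector
begin
definition scaleC_poly_mapping_def: "c *\<^sub>C p = Poly_Mapping.map (\<lambda>x. c *\<^sub>C x) p"

lemma lookup_scaleC:
  "Poly_Mapping.lookup (c *\<^sub>C p) k = c *\<^sub>C Poly_Mapping.lookup (p :: 'a \<Rightarrow>\<^sub>0 'b::complex_vector) k"
  unfolding scaleC_poly_mapping_def by transfer (auto simp: when_def)

instance
  by standard (simp_all add: poly_mapping_eq_iff fun_eq_iff lookup_scaleC lookup_add
      scaleC_add_right scaleC_add_left scaleC_scaleC scaleC_one)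
end

definition clinear_on :: "'a::complex_vector set \<Rightarrow> ('a \<Rightarrow> 'b::complex_vector) \<Rightarrow> bool" where
  "clinear_on W f \<longleftrightarrow>
     (\<forall>x\<in>W. \<forall>y\<in>W. f (x + y) = f x + f y) \<and> (\<forall>c. \<forall>x\<in>W. f (c *\<^sub>C x) = c *\<^sub>C f x)"

definition finite_dimensional :: "'a::complex_vector set \<Rightarrow> bool" where
  "finite_dimensional S \<longleftrightarrow> (\<exists>B. finite B \<and> S \<subseteq> complex_vector.span B)"

text \<open>The full algebraic dual.\<close>

definition dual :: "('a::complex_vector \<Rightarrow> complex) set" where
  "dual = {\<phi>. clinear \<phi>}"

definition is_decomposition ::
    "('i \<Rightarrow> 'a::complex_vector set) \<Rightarrow> 'a \<Rightarrow> ('i \<Rightarrow> 'a) \<Rightarrow> bool" where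
  "is_decomposition U w f \<longleftrightarrow> (\<forall>i. f i \<in> U i) \<and> finite {i. f i \<noteq> 0} \<and> w = Sum_any f"

definition direct_sum :: "'a::complex_vector set \<Rightarrow> ('i \<Rightarrow> 'a set) \<Rightarrow> bool" where
  "direct_sum W U \<longleftrightarrow>
     (\<forall>i. complex_vector.subspace (U i) \<and> U i \<subseteq> W) \<and> (\<forall>w\<in>W. \<exists>!f. is_decomposition U w f)"

definition component :: "('i \<Rightarrow> 'a::complex_vector set) \<Rightarrow> 'i \<Rightarrow> 'a \<Rightarrow> 'a" where
  "component U i w = (THE f. is_decomposition U w f) i"

definition eigenspace :: "'a::complex_vector set \<Rightarrow> ('a \<Rightarrow> 'a) \<Rightarrow> complex \<Rightarrow> 'a set" where
  "eigenspace W T h = {w\<in>W. T w = h *\<^sub>C w}"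

definition acts_semisimply :: "'a::complex_vector set \<Rightarrow> ('a \<Rightarrow> 'a) \<Rightarrow> bool" where
  "acts_semisimply W T \<longleftrightarrow> direct_sum W (eigenspace W T)"

text \<open>\<open>exp_locnil c T\<close> is \<open>e\<^bsup>c T\<^esup>\<close> for a locally nilpotent operator \<open>T\<close>, and
  \<open>exp_semisimple c T\<close> is \<open>e\<^bsup>c T\<^esup>\<close> for an operator \<open>T\<close> acting semisimply.\<close>

definition exp_locnil :: "complex \<Rightarrow> ('a::complex_vector \<Rightarrow> 'a) \<Rightarrow> 'a \<Rightarrow> 'a" where
  "exp_locnil c T w = Sum_any (\<lambda>k. (c ^ k / fact k) *\<^sub>C (T ^^ k) w)"

definition exp_semisimple :: "complex \<Rightarrow> ('a::complex_vector \<Rightarrow> 'a) \<Rightarrow> 'a \<Rightarrow> 'a" where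
  "exp_semisimple c T w = Sum_any (\<lambda>h. exp (c * h) *\<^sub>C component (eigenspace UNIV T) h w)"


section \<open>Tensor products of complex vector spaces\<close>

text \<open>The free vector space on \<open>'a \<times> 'b\<close> modulo the bilinearity relations.\<close>

definition tensor_relators :: "('a::complex_vector \<times> 'b::complex_vector \<Rightarrow>\<^sub>0 complex) set" where
  "tensor_relators =
     {Poly_Mapping.single (a + a', b) 1 - Poly_Mapping.single (a, b) 1
        - Poly_Mapping.single (a', b) 1 | a a' b. True} \<union>
     {Poly_Mapping.single (a, b + b') 1 - Poly_Mapping.single (a, b) 1
        - Poly_Mapping.single (a, b') 1 | a b b'. True} \<union>
     {Poly_Mapping.single (c *\<^sub>C a, b) 1 - c *\<^sub>C Poly_Mapping.single (a, b) 1 | c a b. True} \<union>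
     {Poly_Mapping.single (a, c *\<^sub>C b) 1 - c *\<^sub>C Poly_Mapping.single (a, b) 1 | c a b. True}"

definition tensor_rel ::
    "('a::complex_vector \<times> 'b::complex_vector \<Rightarrow>\<^sub>0 complex) \<Rightarrow> ('a \<times> 'b \<Rightarrow>\<^sub>0 complex) \<Rightarrow> bool" where
  "tensor_rel p q \<longleftrightarrow> p - q \<in> complex_vector.span tensor_relators"

lemma equivp_tensor_rel:
  "equivp (tensor_rel :: ('a::complex_vector \<times> 'b::complex_vector \<Rightarrow>\<^sub>0 complex) \<Rightarrow> _)"
proof (rule equivpI)
  let ?R = "tensor_rel :: ('a \<times> 'b \<Rightarrow>\<^sub>0 complex) \<Rightarrow> _"
  show "reflp ?R"
    by (auto simp: reflp_def tensor_rel_def complex_vector.span_zero)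
  show "symp ?R"
  proof (rule sympI)
    fix p q :: "'a \<times> 'b \<Rightarrow>\<^sub>0 complex"
    assume "tensor_rel p q"
    then have "- (p - q) \<in> complex_vector.span tensor_relators"
      unfolding tensor_rel_def by (rule complex_vector.span_neg)
    then show "tensor_rel q p" by (simp add: tensor_rel_def)
  qed
  show "transp ?R"
  proof (rule transpI)
    fix p q r :: "'a \<times> 'b \<Rightarrow>\<^sub>0 complex"
    assume "tensor_rel p q" "tensor_rel q r"
    then have "(p - q) + (q - r) \<in> complex_vector.span tensor_relators"
      unfolding tensor_rel_def by (rule complex_vector.span_add)
    then show "tensor_rel p r" by (simp add: tensor_rel_def)
  qed
qed

quotient_type (overloaded) ('a, 'b) tensor =
  "('a::complex_vector \<times> 'b::complex_vector) \<Rightarrow>\<^sub>0 complex" / tensor_rel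
  by (rule equivp_tensor_rel)

instantiation tensor :: (complex_vector, complex_vector) complex_vector
begin

lift_definition zero_tensor :: "('a, 'b) tensor" is 0 .

lift_definition plus_tensor :: "('a, 'b) tensor \<Rightarrow> ('a, 'b) tensor \<Rightarrow> ('a, 'b) tensor" is "(+)"
proof -
  fix p p' q q' :: "('a \<times> 'b) \<Rightarrow>\<^sub>0 complex"
  assume "tensor_rel p p'" "tensor_rel q q'"
  then have "(p - p') + (q - q') \<in> complex_vector.span tensor_relators"
    unfolding tensor_rel_def by (rule complex_vector.span_add)
  then show "tensor_rel (p + q) (p' + q')" by (simp add: tensor_rel_def algebra_simps)
qed

lift_definition minus_tensor :: "('a, 'b) tensor \<Rightarrow> ('a, 'b) tensor \<Rightarrow> ('a, 'b) tensor" is "(-)"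
proof -
  fix p p' q q' :: "('a \<times> 'b) \<Rightarrow>\<^sub>0 complex"
  assume "tensor_rel p p'" "tensor_rel q q'"
  then have "(p - p') - (q - q') \<in> complex_vector.span tensor_relators"
    unfolding tensor_rel_def by (rule complex_vector.span_diff)
  then show "tensor_rel (p - q) (p' - q')" by (simp add: tensor_rel_def algebra_simps)
qed

lift_definition uminus_tensor :: "('a, 'b) tensor \<Rightarrow> ('a, 'b) tensor" is uminus
proof -
  fix p p' :: "('a \<times> 'b) \<Rightarrow>\<^sub>0 complex"
  assume "tensor_rel p p'"
  then have "- (p - p') \<in> complex_vector.span tensor_relators"
    unfolding tensor_rel_def by (rule complex_vector.span_neg)
  then show "tensor_rel (- p) (- p')" by (simp add: tensor_rel_def algebra_simps)
qed

lift_definition scaleC_tensor :: "complex \<Rightarrow> ('a, 'b) tensor \<Rightarrow> ('a, 'b) tensor" is scaleC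
proof -
  fix c :: complex and p p' :: "('a \<times> 'b) \<Rightarrow>\<^sub>0 complex"
  assume "tensor_rel p p'"
  then have "c *\<^sub>C (p - p') \<in> complex_vector.span tensor_relators"
    unfolding tensor_rel_def by (rule complex_vector.span_scale)
  then show "tensor_rel (c *\<^sub>C p) (c *\<^sub>C p')"
    by (simp add: tensor_rel_def complex_vector.scale_right_diff_distrib)
qed

instance
proof
  fix x y z :: "('a, 'b) tensor" and a b :: complex
  show "x + y + z = x + (y + z)"
    by transfer (simp add: add.assoc equivp_reflp[OF equivp_tensor_rel])
  show "x + y = y + x"
    by transfer (simp add: add.commute equivp_reflp[OF equivp_tensor_rel])
  show "0 + x = x"
    by transfer (simp add: equivp_reflp[OF equivp_tensor_rel])
  show "- x + x = 0"
    by transfer (simp add: equivp_reflp[OF equivp_tensor_rel])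
  show "x - y = x + - y"
    by transfer (simp add: equivp_reflp[OF equivp_tensor_rel])
  show "a *\<^sub>C (x + y) = a *\<^sub>C x + a *\<^sub>C y"
    by transfer (simp add: scaleC_add_right equivp_reflp[OF equivp_tensor_rel])
  show "(a + b) *\<^sub>C x = a *\<^sub>C x + b *\<^sub>C x"
    by transfer (simp add: scaleC_add_left equivp_reflp[OF equivp_tensor_rel])
  show "a *\<^sub>C b *\<^sub>C x = (a * b) *\<^sub>C x"
    by transfer (simp add: scaleC_scaleC equivp_reflp[OF equivp_tensor_rel])
  show "1 *\<^sub>C x = x"
    by transfer (simp add: scaleC_one equivp_reflp[OF equivp_tensor_rel])
qed

end

lift_definition tprod :: "'a::complex_vector \<Rightarrow> 'b::complex_vector \<Rightarrow> ('a, 'b) tensor"  (infixl "\<otimes>" 70)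
  is "\<lambda>a b. Poly_Mapping.single (a, b) 1" .

text \<open>For bilinear \<open>f\<close>, the linear map induced on the tensor product; see \<open>tensor_lift_tprod\<close>.\<close>

definition free_lift :: "('a \<Rightarrow> 'b \<Rightarrow> 'c::complex_vector) \<Rightarrow> ('a \<times> 'b \<Rightarrow>\<^sub>0 complex) \<Rightarrow> 'c" where
  "free_lift f p = (\<Sum>(a, b)\<in>Poly_Mapping.keys p. Poly_Mapping.lookup p (a, b) *\<^sub>C f a b)"

definition tensor_lift ::
    "('a::complex_vector \<Rightarrow> 'b::complex_vector \<Rightarrow> 'c::complex_vector) \<Rightarrow> ('a, 'b) tensor \<Rightarrow> 'c" where
  "tensor_lift f t = free_lift f (rep_tensor t)"

lemma free_lift_superset:
  assumes "finite A" "Poly_Mapping.keys p \<subseteq> A"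
  shows "free_lift f p = (\<Sum>(a, b)\<in>A. Poly_Mapping.lookup p (a, b) *\<^sub>C f a b)"
  unfolding free_lift_def
  by (rule sum.mono_neutral_left) (use assms in \<open>auto simp: in_keys_iff\<close>)

lemma free_lift_add: "free_lift f (p + q) = free_lift f p + free_lift f q"
proof -
  let ?A = "Poly_Mapping.keys p \<union> Poly_Mapping.keys q"
  have "free_lift f (p + q) = (\<Sum>(a, b)\<in>?A. Poly_Mapping.lookup (p + q) (a, b) *\<^sub>C f a b)"
    by (rule free_lift_superset) (simp_all add: Poly_Mapping.keys_add)
  also have "\<dots> = (\<Sum>(a, b)\<in>?A. Poly_Mapping.lookup p (a, b) *\<^sub>C f a b) + (\<Sum>(a, b)\<in>?A. Poly_Mapping.lookup q (a, b) *\<^sub>C f a b)"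
    by (simp add: lookup_add scaleC_add_left sum.distrib case_prod_unfold)
  also have "\<dots> = free_lift f p + free_lift f q"
    by (simp add: free_lift_superset[symmetric, of ?A])
  finally show ?thesis .
qed

lemma free_lift_scaleC: "free_lift f (c *\<^sub>C p) = c *\<^sub>C free_lift f p"
proof -
  have "free_lift f (c *\<^sub>C p) = (\<Sum>(a, b)\<in>Poly_Mapping.keys p. Poly_Mapping.lookup (c *\<^sub>C p) (a, b) *\<^sub>C f a b)"
    by (rule free_lift_superset) (auto simp: in_keys_iff lookup_scaleC)
  then show ?thesis
    by (simp add: free_lift_def lookup_scaleC scaleC_complex_def complex_vector.scale_sum_right case_prod_unfold)
qed

lemma clinear_free_lift: "clinear (free_lift f)"
  by (simp add: Vector_Spaces.linear_iff complex_vector.vector_space_axioms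
      free_lift_add free_lift_scaleC)

lemma free_lift_diff: "free_lift f (p - q) = free_lift f p - free_lift f q"
  using free_lift_add[of f "p - q" q] by simp

lemma free_lift_single: "free_lift f (Poly_Mapping.single (a, b) 1) = f a b"
  by (simp add: free_lift_def scaleC_one)

lemma tensor_lift_tprod:
  assumes "\<And>b. clinear (\<lambda>a. f a b)" and "\<And>a. clinear (f a)"
  shows "tensor_lift f (a \<otimes> b) = f a b"
proof -
  have add1: "f (a + a') b = f a b + f a' b" and scale1: "f (c *\<^sub>C a) b = c *\<^sub>C f a b" for a a' b c
    using assms(1)[of b] by (simp_all add: Vector_Spaces.linear_iff)
  have add2: "f a (b + b') = f a b + f a b'" and scale2: "f a (c *\<^sub>C b) = c *\<^sub>C f a b" for a b b' c
    using assms(2)[of a] by (simp_all add: Vector_Spaces.linear_iff)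
  have null: "free_lift f p = 0" if "p \<in> complex_vector.span tensor_relators" for p
    using that
  proof (induction rule: complex_vector.span_induct_alt)
    case base
    then show ?case by (simp add: free_lift_def)
  next
    case (step c x y)
    have "free_lift f x = 0"
      using step(1) unfolding tensor_relators_def
      by (auto simp: free_lift_diff free_lift_scaleC free_lift_single add1 add2 scale1 scale2)
    then show ?case using step by (simp add: free_lift_add free_lift_scaleC)
  qed
  have "tensor_rel (rep_tensor (a \<otimes> b)) (Poly_Mapping.single (a, b) 1)"
    unfolding tprod.abs_eq
    by (rule rep_abs_rsp_left[OF Quotient3_tensor equivp_reflp[OF equivp_tensor_rel]])
  then have "free_lift f (rep_tensor (a \<otimes> b) - Poly_Mapping.single (a, b) 1) = 0"
    by (simp add: tensor_rel_def null)
  then show ?thesis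
    by (simp add: tensor_lift_def free_lift_diff free_lift_single)
qed


section \<open>Formal calculus\<close>

text \<open>Formal series, infinite in both directions, in three commuting variables \<open>x\<^sub>0, x\<^sub>1, x\<^sub>2\<close>;
  \<open>F (i, j, k)\<close> is the coefficient of \<open>x\<^sub>0\<^sup>i x\<^sub>1\<^sup>j x\<^sub>2\<^sup>k\<close>. A series not involving
  some variable is supported at exponent 0 of that variable. A series in one variable
  is a function \<open>int \<Rightarrow> 'a\<close>, \<open>f n\<close> being the coefficient of \<open>x\<^sup>n\<close>.\<close>

type_synonym expo = "int \<times> int \<times> int"

type_synonym 'a series = "expo \<Rightarrow> 'a"

text \<open>The pair \<open>(c, i, j, k)\<close> stands for the monomial \<open>c x\<^sub>0\<^sup>i x\<^sub>1\<^sup>j x\<^sub>2\<^sup>k\<close>.\<close>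

type_synonym monom = "complex \<times> expo"

definition X0 :: monom where "X0 = (1, 1, 0, 0)"
definition X1 :: monom where "X1 = (1, 0, 1, 0)"
definition X2 :: monom where "X2 = (1, 0, 0, 1)"
definition Const :: "complex \<Rightarrow> monom" where "Const c = (c, 0, 0, 0)"

fun mmult :: "monom \<Rightarrow> monom \<Rightarrow> monom" where
  "mmult (c, e) (d, f) = (c * d, e + f)"

fun mneg :: "monom \<Rightarrow> monom" where
  "mneg (c, e) = (- c, e)"

fun mpow :: "monom \<Rightarrow> int \<Rightarrow> monom" where
  "mpow (c, i, j, k) n = (c powi n, n * i, n * j, n * k)"

abbreviation minv :: "monom \<Rightarrow> monom" where
  "minv m \<equiv> mpow m (- 1)"

fun monom_coeff :: "monom \<Rightarrow> expo \<Rightarrow> complex" where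
  "monom_coeff (c, e) d = (if d = e then c else 0)"

fun mscale :: "monom \<Rightarrow> complex series \<Rightarrow> complex series" where
  "mscale (c, e) F = (\<lambda>d. c * F (d - e))"

text \<open>\<open>fdelta p q r\<close> is
  \<open>\<delta>((p + q) / r) = \<Sum>\<^sub>n (p + q)\<^sup>n r\<^sup>-\<^sup>n = \<Sum>\<^sub>n \<Sum>\<^sub>k\<^sub>\<ge>\<^sub>0 (n choose k) p\<^sup>n\<^sup>-\<^sup>k q\<^sup>k r\<^sup>-\<^sup>n\<close>,
  the binomial being expanded in nonnegative powers of \<open>q\<close>. In every use below, a given
  exponent is attained by at most one pair \<open>(n, k)\<close>.\<close>

definition fdelta :: "monom \<Rightarrow> monom \<Rightarrow> monom \<Rightarrow> complex series" where
  "fdelta p q r = (\<lambda>d. Sum_any (\<lambda>(n, k).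
     (of_int n gchoose k) *
     monom_coeff (mmult (mpow p (n - int k)) (mmult (mpow q (int k)) (mpow r (- n)))) d))"

text \<open>Product of formal series (meaningful when each coefficient is a finite sum).\<close>

definition fmult :: "complex series \<Rightarrow> 'a::complex_vector series \<Rightarrow> 'a series"  (infixr "\<odot>" 75) where
  "F \<odot> G = (\<lambda>d. Sum_any (\<lambda>e. F e *\<^sub>C G (d - e)))"

definition in_X0 :: "(int \<Rightarrow> 'a::zero) \<Rightarrow> 'a series" where
  "in_X0 f = (\<lambda>(i, j, k). if j = 0 \<and> k = 0 then f i else 0)"

definition in_X1 :: "(int \<Rightarrow> 'a::zero) \<Rightarrow> 'a series" where
  "in_X1 f = (\<lambda>(i, j, k). if i = 0 \<and> k = 0 then f j else 0)"

definition in_X0_X1 :: "(int \<Rightarrow> int \<Rightarrow> 'a::zero) \<Rightarrow> 'a series" where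
  "in_X0_X1 f = (\<lambda>(i, j, k). if k = 0 then f i j else 0)"

definition in_X0_X2 :: "(int \<Rightarrow> int \<Rightarrow> 'a::zero) \<Rightarrow> 'a series" where
  "in_X0_X2 f = (\<lambda>(i, j, k). if j = 0 then f i k else 0)"

definition in_X1_X2 :: "(int \<Rightarrow> int \<Rightarrow> 'a::zero) \<Rightarrow> 'a series" where
  "in_X1_X2 f = (\<lambda>(i, j, k). if i = 0 then f j k else 0)"

definition Res_X0 :: "'a::zero series \<Rightarrow> 'a series" where
  "Res_X0 F = (\<lambda>(i, j, k). if i = 0 then F (- 1, j, k) else 0)"

definition Res_X1 :: "'a::zero series \<Rightarrow> 'a series" where
  "Res_X1 F = (\<lambda>(i, j, k). if j = 0 then F (i, - 1, k) else 0)"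


section \<open>Vertex operator algebras and modules\<close>

text \<open>\<open>('v, 'w) vertex_map\<close> models linear maps \<open>V \<rightarrow> (End W)[[x, x\<^sup>-\<^sup>1]]\<close>:
  \<open>Y v n\<close> is the coefficient of \<open>x\<^sup>n\<close> in \<open>Y(v, x)\<close>. (Thus \<open>Y v n\<close> is what
  is often written \<open>v\<^sub>-\<^sub>n\<^sub>-\<^sub>1\<close>.)\<close>

type_synonym ('v, 'w) vertex_map = "'v \<Rightarrow> int \<Rightarrow> 'w \<Rightarrow> 'w"

record 'v voa_data =
  vop :: "('v, 'v) vertex_map"
  vac :: 'v
  conf :: 'v

definition jacobi_identity ::
    "'v voa_data \<Rightarrow> ('v, 'w::complex_vector) vertex_map \<Rightarrow> 'v \<Rightarrow> 'v \<Rightarrow> 'w \<Rightarrow> bool" where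
  "jacobi_identity V Y u v w \<longleftrightarrow>
     mscale (minv X0) (fdelta X1 (mneg X2) X0) \<odot> in_X1_X2 (\<lambda>i j. Y u i (Y v j w))
   - mscale (minv X0) (fdelta X2 (mneg X1) (mneg X0)) \<odot> in_X1_X2 (\<lambda>i j. Y v j (Y u i w))
   = mscale (minv X2) (fdelta X1 (mneg X0) X2) \<odot> in_X0_X2 (\<lambda>i j. Y (vop V u i v) j w)"

text \<open>Modules live on a subspace \<open>W\<close> of the ambient type; the values of \<open>Y v n\<close> outside
  \<open>W\<close> are irrelevant.\<close>

definition weak_module ::
    "'v::complex_vector voa_data \<Rightarrow> 'w::complex_vector set \<Rightarrow> ('v, 'w) vertex_map \<Rightarrow> bool" where
  "weak_module V W Y \<longleftrightarrow>
     complex_vector.subspace W \<and>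
     (\<forall>v n. \<forall>w\<in>W. Y v n w \<in> W) \<and>
     (\<forall>v n. clinear_on W (Y v n)) \<and>
     (\<forall>n. \<forall>w\<in>W. clinear (\<lambda>v. Y v n w)) \<and>
     (\<forall>v. \<forall>w\<in>W. \<exists>N. \<forall>n<N. Y v n w = 0) \<and>
     (\<forall>n. \<forall>w\<in>W. Y (vac V) n w = (if n = 0 then w else 0)) \<and>
     (\<forall>u v. \<forall>w\<in>W. jacobi_identity V Y u v w)"

text \<open>\<open>Y(\<omega>, x) = \<Sum>\<^sub>n L(n) x\<^sup>-\<^sup>n\<^sup>-\<^sup>2\<close>\<close>

definition Lop :: "'v voa_data \<Rightarrow> ('v, 'w) vertex_map \<Rightarrow> int \<Rightarrow> 'w \<Rightarrow> 'w" where
  "Lop V Y n = Y (conf V) (- n - 2)"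

definition weight_space :: "'v::complex_vector voa_data \<Rightarrow> int \<Rightarrow> 'v set" where
  "weight_space V n = eigenspace UNIV (Lop V (vop V) 0) (of_int n)"

definition vertex_operator_algebra :: "'v::complex_vector voa_data \<Rightarrow> bool" where
  "vertex_operator_algebra V \<longleftrightarrow>
     weak_module V UNIV (vop V) \<and>
     (\<forall>v. (\<forall>n<0. vop V v n (vac V) = 0) \<and> vop V v 0 (vac V) = v) \<and>
     (\<exists>c. \<forall>m n v.
        Lop V (vop V) m (Lop V (vop V) n v) - Lop V (vop V) n (Lop V (vop V) m v) =
        of_int (m - n) *\<^sub>C Lop V (vop V) (m + n) v +
        (if m + n = 0 then (of_int (m ^ 3 - m) / 12 * c) *\<^sub>C v else 0)) \<and>
     (\<forall>v n w. vop V (Lop V (vop V) (- 1) v) n w = of_int (n + 1) *\<^sub>C vop V v (n + 1) w) \<and>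
     direct_sum UNIV (weight_space V) \<and>
     (\<forall>n. finite_dimensional (weight_space V n)) \<and>
     (\<exists>N. \<forall>n<N. weight_space V n = {0})"

definition voa_module ::
    "'v::complex_vector voa_data \<Rightarrow> 'w::complex_vector set \<Rightarrow> ('v, 'w) vertex_map \<Rightarrow> bool" where
  "voa_module V W Y \<longleftrightarrow>
     weak_module V W Y \<and>
     direct_sum W (eigenspace W (Lop V Y 0)) \<and>
     (\<forall>h. finite_dimensional (eigenspace W (Lop V Y 0) h)) \<and>
     (\<exists>N::real. \<forall>h. Re h < N \<longrightarrow> eigenspace W (Lop V Y 0) h = {0})"

definition weak_module_isomorphism ::
    "'v::complex_vector voa_data \<Rightarrow> 'w::complex_vector set \<Rightarrow> ('v, 'w) vertex_map \<Rightarrow>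
     'u::complex_vector set \<Rightarrow> ('v, 'u) vertex_map \<Rightarrow> ('w \<Rightarrow> 'u) \<Rightarrow> bool" where
  "weak_module_isomorphism V W Y W' Y' f \<longleftrightarrow>
     weak_module V W Y \<and> weak_module V W' Y' \<and>
     clinear_on W f \<and> bij_betw f W W' \<and>
     (\<forall>v n. \<forall>w\<in>W. f (Y v n w) = Y' v n (f w))"

text \<open>\<open>Y(u \<otimes> v, x) = Y(u, x) \<otimes> Y(v, x)\<close>, extended bilinearly; \<open>\<omega> \<otimes> \<one> + \<one> \<otimes> \<omega>\<close> is the
  conformal vector.\<close>

definition tensor_voa :: "'v::complex_vector voa_data \<Rightarrow> ('v, 'v) tensor voa_data" where
  "tensor_voa V =
     \<lparr>vop = (\<lambda>s n t. tensor_lift (\<lambda>u v. tensor_lift (\<lambda>u' v'.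
               Sum_any (\<lambda>i. vop V u i u' \<otimes> vop V v (n - i) v')) t) s),
      vac = vac V \<otimes> vac V,
      conf = conf V \<otimes> vac V + vac V \<otimes> conf V\<rparr>"

definition slot1 :: "'v::complex_vector voa_data \<Rightarrow> (('v, 'v) tensor, 'w) vertex_map \<Rightarrow> ('v, 'w) vertex_map" where
  "slot1 V Y v = Y (v \<otimes> vac V)"

definition slot2 :: "'v::complex_vector voa_data \<Rightarrow> (('v, 'v) tensor, 'w) vertex_map \<Rightarrow> ('v, 'w) vertex_map" where
  "slot2 V Y v = Y (vac V \<otimes> v)"

definition category_Co ::
    "'v::complex_vector voa_data \<Rightarrow> 'w::complex_vector set \<Rightarrow> (('v, 'v) tensor, 'w) vertex_map \<Rightarrow> bool" where
  "category_Co V W Y \<longleftrightarrow>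
     voa_module (tensor_voa V) W Y \<and>
     acts_semisimply W (Lop V (slot1 V Y) 0) \<and>
     acts_semisimply W (Lop V (slot2 V Y) 0)"

text \<open>The vertex operator map of \<open>A\<^sup>\<theta>\<close>.\<close>

definition theta :: "(('v::complex_vector, 'v) tensor, 'w) vertex_map \<Rightarrow> (('v, 'v) tensor, 'w) vertex_map" where
  "theta Y t = Y (tensor_lift (\<lambda>u v. v \<otimes> u) t)"


section \<open>The weak modules \<open>T'\<^sub>P\<^sub>(\<^sub>z\<^sub>)\<close> and \<open>T'\<^sub>Q\<^sub>(\<^sub>\<zeta>\<^sub>)\<close>\<close>

text \<open>\<open>conj_vec V v m\<close> is the coefficient of \<open>x\<^sup>m\<close> in the Laurent polynomial
  \<open>e\<^bsup>x L(1)\<^esup> (-x\<^sup>-\<^sup>2)\<^bsup>L(0)\<^esup> v\<close>; a vector \<open>u\<close> of weight \<open>n\<close> contributes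
  \<open>(-1)\<^sup>n x\<^sup>k\<^sup>-\<^sup>2\<^sup>n L(1)\<^sup>k u / k!\<close> for every \<open>k\<close>.\<close>

definition conj_vec :: "'v::complex_vector voa_data \<Rightarrow> 'v \<Rightarrow> int \<Rightarrow> 'v" where
  "conj_vec V v m = Sum_any (\<lambda>(n, k). if m = int k - 2 * n
     then ((- 1) powi n / fact k) *\<^sub>C (Lop V (vop V) 1 ^^ k) (component (weight_space V) n v)
     else 0)"

text \<open>\<open>G\<^sup>o(v, x) = G(e\<^bsup>x L(1)\<^esup> (-x\<^sup>-\<^sup>2)\<^bsup>L(0)\<^esup> v, x\<^sup>-\<^sup>1)\<close>\<close>

definition opposite ::
    "'v::complex_vector voa_data \<Rightarrow> ('v, 'w::complex_vector) vertex_map \<Rightarrow> ('v, 'w) vertex_map" where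
  "opposite V G v n w = Sum_any (\<lambda>m. G (conj_vec V v m) (m - n) w)"

text \<open>In the definitions below, \<open>Y\<close> is the vertex operator map of a weak \<open>V \<otimes> V\<close>-module.\<close>

text \<open>\<open>z\<^sup>-\<^sup>1 \<delta>((x\<^sub>1\<^sup>-\<^sup>1 - x\<^sub>0) / z) \<langle>\<phi>, Y\<^sub>1(e\<^bsup>x\<^sub>1 L(1)\<^esup> (-x\<^sub>1\<^sup>-\<^sup>2)\<^bsup>L(0)\<^esup> v, x\<^sub>0) a\<rangle>\<close>\<close>

definition P_term ::
    "'v::complex_vector voa_data \<Rightarrow> complex \<Rightarrow> (('v, 'v) tensor, 'a) vertex_map \<Rightarrow>
     'v \<Rightarrow> ('a \<Rightarrow> complex) \<Rightarrow> 'a \<Rightarrow> complex series" where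
  "P_term V z Y v \<phi> a =
     mscale (Const (inverse z)) (fdelta (minv X1) (mneg X0) (Const z))
       \<odot> in_X0_X1 (\<lambda>i j. \<phi> (slot1 V Y (conj_vec V v j) i a))"

text \<open>Here the variable \<open>x\<close> of \<open>Y'\<^sub>P\<^sub>(\<^sub>z\<^sub>)(v, x)\<close> is \<open>x\<^sub>1\<close>.\<close>

definition YP ::
    "'v::complex_vector voa_data \<Rightarrow> complex \<Rightarrow> (('v, 'v) tensor, 'a::complex_vector) vertex_map \<Rightarrow>
     ('v, 'a \<Rightarrow> complex) vertex_map" where
  "YP V z Y v n \<phi> = (\<lambda>a.
     (Res_X0 (P_term V z Y v \<phi> a) + in_X1 (\<lambda>j. \<phi> (opposite V (slot2 V Y) v j a))) (0, n, 0))"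

definition TP ::
    "'v::complex_vector voa_data \<Rightarrow> complex \<Rightarrow> (('v, 'v) tensor, 'a::complex_vector) vertex_map \<Rightarrow>
     ('a \<Rightarrow> complex) set" where
  "TP V z Y = {\<phi>\<in>dual.
     (\<forall>v. \<exists>N. \<forall>n<N. YP V z Y v n \<phi> = 0) \<and>
     (\<forall>v a.
        mscale (minv X0) (fdelta (minv X1) (mneg (Const z)) X0) \<odot> in_X1 (\<lambda>n. YP V z Y v n \<phi> a)
      = P_term V z Y v \<phi> a
      + mscale (minv X0) (fdelta (Const z) (mneg (minv X1)) (mneg X0))
          \<odot> in_X1 (\<lambda>n. \<phi> (opposite V (slot2 V Y) v n a)))}"

text \<open>\<open>x\<^sub>0\<^sup>-\<^sup>1 \<delta>((x\<^sub>1 - \<zeta>) / x\<^sub>0) \<langle>\<phi>, Y\<^sub>1\<^sup>o(v, x\<^sub>1) b\<rangle>\<close> and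
  \<open>x\<^sub>0\<^sup>-\<^sup>1 \<delta>((\<zeta> - x\<^sub>1) / (-x\<^sub>0)) \<langle>\<phi>, Y\<^sub>2(v, x\<^sub>1) b\<rangle>\<close>\<close>

definition Q_term1 ::
    "'v::complex_vector voa_data \<Rightarrow> complex \<Rightarrow> (('v, 'v) tensor, 'a::complex_vector) vertex_map \<Rightarrow>
     'v \<Rightarrow> ('a \<Rightarrow> complex) \<Rightarrow> 'a \<Rightarrow> complex series" where
  "Q_term1 V \<zeta> Y v \<phi> b =
     mscale (minv X0) (fdelta X1 (mneg (Const \<zeta>)) X0)
       \<odot> in_X1 (\<lambda>n. \<phi> (opposite V (slot1 V Y) v n b))"

definition Q_term2 ::
    "'v::complex_vector voa_data \<Rightarrow> complex \<Rightarrow> (('v, 'v) tensor, 'a) vertex_map \<Rightarrow>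
     'v \<Rightarrow> ('a \<Rightarrow> complex) \<Rightarrow> 'a \<Rightarrow> complex series" where
  "Q_term2 V \<zeta> Y v \<phi> b =
     mscale (minv X0) (fdelta (Const \<zeta>) (mneg X1) (mneg X0))
       \<odot> in_X1 (\<lambda>n. \<phi> (slot2 V Y v n b))"

definition YQ ::
    "'v::complex_vector voa_data \<Rightarrow> complex \<Rightarrow> (('v, 'v) tensor, 'a::complex_vector) vertex_map \<Rightarrow>
     ('v, 'a \<Rightarrow> complex) vertex_map" where
  "YQ V \<zeta> Y v n \<phi> = (\<lambda>b.
     (Res_X1 (Q_term1 V \<zeta> Y v \<phi> b) - Res_X1 (Q_term2 V \<zeta> Y v \<phi> b)) (n, 0, 0))"

definition TQ ::
    "'v::complex_vector voa_data \<Rightarrow> complex \<Rightarrow> (('v, 'v) tensor, 'a::complex_vector) vertex_map \<Rightarrow>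
     ('a \<Rightarrow> complex) set" where
  "TQ V \<zeta> Y = {\<phi>\<in>dual.
     (\<forall>v. (\<forall>n. YQ V \<zeta> Y v n \<phi> \<in> dual) \<and> (\<exists>N. \<forall>n<N. YQ V \<zeta> Y v n \<phi> = 0)) \<and>
     (\<forall>v b.
        mscale (Const (inverse \<zeta>)) (fdelta X1 (mneg X0) (Const \<zeta>)) \<odot> in_X0 (\<lambda>n. YQ V \<zeta> Y v n \<phi> b)
      = Q_term1 V \<zeta> Y v \<phi> b - Q_term2 V \<zeta> Y v \<phi> b)}"

text \<open>The branch of the logarithm with argument in \<open>[0, 2\<pi>)\<close>.\<close>

definition log2pi :: "complex \<Rightarrow> complex" where
  "log2pi w = of_real (ln (cmod w)) + \<i> * of_real (Arg2pi w)"

text \<open>\<open>psi V s Y = e\<^bsup>L(0) log(-s\<^sup>2)\<^esup> e\<^bsup>s L(1)\<^esup> \<otimes> e\<^bsup>s\<^sup>-\<^sup>1 L(1)\<^esup>\<close>.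

  Sign convention: passing from \<open>P(z)\<close> to \<open>Q(-z\<^sup>-\<^sup>1)\<close> requires \<open>s = -z\<close>, although the source
  prints \<open>s = z\<close>. In the second slot one needs
  \<open>Y\<^sub>2\<^sup>o(v, x) \<psi> = \<psi> Y\<^sub>2\<^sup>o(v, x - z\<^sup>-\<^sup>1)\<close>, while \<open>[L(1), L(n)] = (1 - n) L(n + 1)\<close> gives
  \<open>Y\<^sup>o(v, x) e\<^bsup>c L(1)\<^esup> = e\<^bsup>c L(1)\<^esup> Y\<^sup>o(v, x + c)\<close>, so \<open>c = -z\<^sup>-\<^sup>1\<close>; the first slot
  similarly forces \<open>e\<^bsup>-z L(1)\<^esup>\<close>. With \<open>s = z\<close> the map \<open>\<psi>\<^sup>*\<close> does not commute with the action of
  \<open>\<omega>\<close>, already for \<open>A = V \<otimes> V\<close> with \<open>\<omega> \<noteq> 0\<close>.\<close>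

definition psi ::
    "'v::complex_vector voa_data \<Rightarrow> complex \<Rightarrow> (('v, 'v) tensor, 'a::complex_vector) vertex_map \<Rightarrow>
     'a \<Rightarrow> 'a" where
  "psi V s Y a =
     exp_semisimple (log2pi (- (s ^ 2))) (Lop V (slot1 V Y) 0)
       (exp_locnil s (Lop V (slot1 V Y) 1)
         (exp_locnil (inverse s) (Lop V (slot2 V Y) 1) a))"

definition dual_map :: "('a \<Rightarrow> 'a) \<Rightarrow> ('a \<Rightarrow> complex) \<Rightarrow> ('a \<Rightarrow> complex)" where
  "dual_map f \<phi> = \<phi> \<circ> f"

end

theory Submission
  imports Defs
begin

text \<open>Put \<open>y = x\<^sup>-\<^sup>1\<close>. The defining identity of \<open>T'\<^sub>P\<^sub>(\<^sub>z\<^sub>)\<close> says that \<open>\<langle>\<lambda>, Y\<^sub>2(v, y) a\<rangle>\<close>,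
  \<open>\<langle>\<lambda>, Y\<^sub>1(v, y - z) a\<rangle>\<close> and the matrix coefficient of the opposite of \<open>Y'\<^sub>P\<^sub>(\<^sub>z\<^sub>)(v, x)\<close> are the
  expansions of one rational function of \<open>y\<close> at \<open>0\<close>, \<open>z\<close> and \<open>\<infinity>\<close>. Pairing with the test functions
  \<open>y\<^sup>m (y - z)\<^sup>p\<close> turns this into a vanishing condition: \<open>\<lambda>\<close> annihilates the action of
  \<open>v \<otimes> y\<^sup>m (y - z)\<^sup>p\<close> on \<open>A\<close> (with \<open>Y\<^sub>2\<close> at \<open>0\<close> and \<open>Y\<^sub>1\<close> at \<open>z\<close>) as soon as the test function vanishes
  at \<open>\<infinity>\<close> to an order depending on \<open>v\<close> only. The commutator formula makes the space of these
  functionals stable. For its Jacobi identity one evaluates both sides on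
  \<open>y\<^sub>1\<^sup>m (y\<^sub>1 - z)\<^sup>p y\<^sub>2\<^sup>k (y\<^sub>2 - z)\<^sup>q (y\<^sub>1 - y\<^sub>2)\<^sup>n\<close> and descends in \<open>n\<close>, reducing to the Jacobi identities
  of \<open>Y\<^sub>1\<close> and \<open>Y\<^sub>2\<close>. Passing back to the variable \<open>x\<close> rests on the conjugation formula for
  \<open>e\<^bsup>c L(1)\<^esup> Y(u, x) e\<^bsup>-c L(1)\<^esup>\<close>.

  The condition defining \<open>T'\<^sub>Q\<^sub>(\<^sub>-\<^sub>1\<^sub>/\<^sub>z\<^sub>)(A\<^sup>\<theta>)\<close> is the same one in the coordinate \<open>t = x - z\<^sup>-\<^sup>1\<close>, and \<open>\<psi>\<close>
  implements this change of coordinate on \<open>A\<close>.\<close>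

section \<open>Finite sums over function bodies\<close>

text \<open>Nothing converges here, so "expansions of one function" has to become algebra. A power
  (y1 - y2)^n turns into a sum that ends for one of three reasons: truncation of Y_2 at 0,
  truncation of Y_1 at z, or decay of the functional at infinity. Splitting an operator into its
  parts at 0 and z can destroy finiteness, and then a part calls for another expansion of the same
  power. Two expansions are identified by uniqueness: both solve the recursions coming from the
  linear relations among y1, y2, y1 - z, y2 - z, y1 - y2, agree at n = 0, and vanish in a common
  region (\<open>rec5_unique\<close>). The constants of psi come from 1/y = x = t + 1/z. Hence y - z
  = -z^2 t / (1 + z t): the Moebius map t / (1 + z t), realized by e^(-z L(1)), followed by scaling
  with -z^2, realized by L(0), in the slot at y = z. In the slot at y = 0, that is x = infinity,
  only the translation by 1/z is left, and on the opposite operator it is realized by e^(-L(1)/z).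
  The same relation, as y - z = -z t / x, is the source of the scalar (-1/z)^M in
  \<open>PO_ps\<close>.\<close>

lemma Sum_any_single: "(\<And>x. x \<noteq> x0 \<Longrightarrow> g x = 0) \<Longrightarrow> Sum_any g = g x0"
  using Sum_any.expand_superset[of "{x0}" g] by auto

lemma Sum_any_reindex:
  assumes "inj h" "\<And>e. e \<notin> range h \<Longrightarrow> g e = 0"
  shows "Sum_any g = Sum_any (\<lambda>l. g (h l))"
proof -
  have eq: "{e. g e \<noteq> 0} = h ` {l. g (h l) \<noteq> 0}"
    using assms(2) by (auto simp: image_iff) (metis assms(2) rangeE)
  show ?thesis
    unfolding Sum_any.expand_set eq
    using sum.reindex[of h "{l. g (h l) \<noteq> 0}" g] assms(1) by (simp add: inj_on_subset)
qed

section \<open>Linear maps and their compatibility with finite sums\<close>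

lemma clinear_add: "clinear f \<Longrightarrow> f (x + y) = f x + f y"
  and clinear_scale: "clinear f \<Longrightarrow> f (c *\<^sub>C x) = c *\<^sub>C f x"
  by (simp_all add: Vector_Spaces.linear_iff)

lemma clinearI:
  "(\<And>x y. f (x + y) = f x + f y) \<Longrightarrow> (\<And>c x. f (c *\<^sub>C x) = c *\<^sub>C f x) \<Longrightarrow> clinear f"
  by (simp add: Vector_Spaces.linear_iff complex_vector.vector_space_axioms)

lemma clinear_zero: "clinear f \<Longrightarrow> f 0 = 0"
  by (metis clinear_add add_cancel_right_right)

lemma clinear_uminus: "clinear f \<Longrightarrow> f (- x) = - f x"
  by (metis clinear_add clinear_zero add.right_inverse add_eq_0_iff)

lemma clinear_diff: "clinear f \<Longrightarrow> f (x - y) = f x - f y"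
  by (metis clinear_add clinear_uminus diff_conv_add_uminus)

lemma clinear_sum: "clinear f \<Longrightarrow> f (sum g S) = (\<Sum>i\<in>S. f (g i))"
  by (induction S rule: infinite_finite_induct) (simp_all add: clinear_zero clinear_add)

lemma clinear_compose: "clinear f \<Longrightarrow> clinear g \<Longrightarrow> clinear (\<lambda>x. f (g x))"
  by (rule clinearI) (simp_all add: clinear_add clinear_scale)

lemma clinear_Sum_any:
  assumes "clinear f" "finite {i. g i \<noteq> 0}"
  shows "f (Sum_any g) = Sum_any (\<lambda>i. f (g i))"
proof -
  have "{i. f (g i) \<noteq> 0} \<subseteq> {i. g i \<noteq> 0}"
    using clinear_zero[OF assms(1)] by auto
  then show ?thesis
    by (simp add: Sum_any.expand_superset[OF assms(2)] Sum_any.expand_superset[OF assms(2) subset_refl]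
        clinear_sum[OF assms(1)])
qed

lemmas scale_simps = scaleC_add_right scaleC_add_left scaleC_scaleC scaleC_one
  complex_vector.scale_right_diff_distrib complex_vector.scale_left_diff_distrib

lemma scaleC_zero [simp]: "c *\<^sub>C (0::'a::complex_vector) = 0" "0 *\<^sub>C (x::'a::complex_vector) = 0"
  by simp_all

lemma minus1_scaleC: "(- 1) *\<^sub>C x = - (x::'a::complex_vector)"
  by (metis complex_vector.scale_minus_left scaleC_one)

lemma clinear_scaleC: "clinear (\<lambda>x. c *\<^sub>C (x::'a::complex_vector))"
  by (rule clinearI) (simp_all add: scaleC_add_right scaleC_scaleC mult.commute)

text \<open>Finite support of a sequence, kept as a tail bound: truncation axioms provide it in this
  form, it is stable under shifts, and \<open>ev0_finite\<close> converts it when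
  \<open>Sum_any\<close> is involved.\<close>

definition ev0 :: "(nat \<Rightarrow> 'a::zero) \<Rightarrow> bool" where
  "ev0 g \<longleftrightarrow> (\<exists>N. \<forall>i\<ge>N. g i = 0)"

lemma ev0_finite: "ev0 g \<longleftrightarrow> finite {i. g i \<noteq> 0}"
proof
  assume "ev0 g"
  then obtain N where "\<forall>i\<ge>N. g i = 0" unfolding ev0_def by blast
  then have "{i. g i \<noteq> 0} \<subseteq> {..<N}"
    by (metis (mono_tags, lifting) lessThan_iff mem_Collect_eq not_le subsetI)
  then show "finite {i. g i \<noteq> 0}" using finite_subset by blast
next
  assume "finite {i. g i \<noteq> 0}"
  then obtain N where "\<forall>i\<in>{i. g i \<noteq> 0}. i < N" using finite_nat_set_iff_bounded by auto
  then show "ev0 g" unfolding ev0_def by (metis mem_Collect_eq not_le)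
qed

lemma ev0_mono: "ev0 g \<Longrightarrow> (\<And>i. g i = 0 \<Longrightarrow> h i = 0) \<Longrightarrow> ev0 h"
  unfolding ev0_def by blast

lemma ev0_shift: "ev0 g \<Longrightarrow> ev0 (\<lambda>i. g (i + k))"
  unfolding ev0_def by (metis trans_le_add1)

lemma ev0_Suc: "ev0 g \<Longrightarrow> ev0 (\<lambda>i. g (Suc i))"
  using ev0_shift[of g 1] by simp

lemma ev0_add: "ev0 g \<Longrightarrow> ev0 h \<Longrightarrow> ev0 (\<lambda>i. g i + (h i::'a::monoid_add))"
  unfolding ev0_def by (metis add.left_neutral le_trans nle_le)

lemma ev0_scale: "ev0 g \<Longrightarrow> ev0 (\<lambda>i. c i *\<^sub>C (g i::'a::complex_vector))"
  by (erule ev0_mono) simp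

lemma ev0_linear: "ev0 g \<Longrightarrow> clinear f \<Longrightarrow> ev0 (\<lambda>i. f (g i))"
  by (erule ev0_mono) (simp add: clinear_zero)

lemma ev0_int: "(\<And>j. j \<ge> N \<Longrightarrow> f j = 0) \<Longrightarrow> ev0 (\<lambda>i. f (a + int i))"
  unfolding ev0_def by (rule exI[of _ "nat (N - a)"]) force

lemma ev0_int_down: "(\<And>j. j < N \<Longrightarrow> f j = 0) \<Longrightarrow> ev0 (\<lambda>i. f (a - int i))"
  unfolding ev0_def by (rule exI[of _ "nat (a - N + 1)"]) force

lemma ev0_Sum_any: "\<forall>i\<ge>N. g i = 0 \<Longrightarrow> Sum_any g = (\<Sum>i<N. g (i::nat))"
  by (rule Sum_any.expand_superset) (auto simp: not_le[symmetric])


section \<open>Binomial sums\<close>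

text \<open>If \<open>g i\<close> is the value of a linear form on t^i, this is its value on (1 +
  t)^n, expanded in nonnegative powers of t. \<open>bsum_pascal\<close> is then multiplication by 1
  + t, the source of the recursions in the exponents.\<close>

definition bsum :: "int \<Rightarrow> (nat \<Rightarrow> 'a::complex_vector) \<Rightarrow> 'a" where
  "bsum n g = Sum_any (\<lambda>i. (of_int n gchoose i) *\<^sub>C g i)"

lemma bsum_finite: "\<forall>i\<ge>N. g i = 0 \<Longrightarrow> bsum n g = (\<Sum>i<N. (of_int n gchoose i) *\<^sub>C g i)"
  unfolding bsum_def by (rule ev0_Sum_any) simp

lemma bsum_cong: "(\<And>i. g i = h i) \<Longrightarrow> bsum n g = bsum n h"
  by (simp add: bsum_def)

lemma bsum_zero: "(\<And>i. g i = 0) \<Longrightarrow> bsum n g = 0"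
  by (simp add: bsum_def)

lemma bsum_0: "bsum 0 g = g 0"
  unfolding bsum_def by (subst Sum_any_single[of 0]) (auto simp: gbinomial_0_left scaleC_one)

lemma ev0_common: "ev0 g \<Longrightarrow> ev0 h \<Longrightarrow> \<exists>N. (\<forall>i\<ge>N. g i = 0) \<and> (\<forall>i\<ge>N. h i = 0)"
  unfolding ev0_def by (metis le_trans nle_le)

lemma bsum_add: "ev0 g \<Longrightarrow> ev0 h \<Longrightarrow> bsum n (\<lambda>i. g i + h i) = bsum n g + bsum n h"
proof -
  assume "ev0 g" "ev0 h"
  then obtain N where "\<forall>i\<ge>N. g i = 0" "\<forall>i\<ge>N. h i = 0" using ev0_common by blast
  then show ?thesis by (simp add: bsum_finite[of N] scaleC_add_right sum.distrib)
qed

lemma bsum_linear: "clinear f \<Longrightarrow> ev0 g \<Longrightarrow> f (bsum n g) = bsum n (\<lambda>i. f (g i))"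
proof -
  assume f: "clinear f" and "ev0 g"
  then obtain N where "\<forall>i\<ge>N. g i = 0" unfolding ev0_def by blast
  then show ?thesis
    by (simp add: bsum_finite[of N] clinear_zero[OF f] clinear_sum[OF f] clinear_scale[OF f])
qed

lemma bsum_scale: "ev0 g \<Longrightarrow> bsum n (\<lambda>i. c *\<^sub>C g i) = c *\<^sub>C bsum n g"
  using bsum_linear[OF clinear_scaleC] by metis

lemma bsum_uminus: "bsum n (\<lambda>i. - g i) = - bsum n g"
proof (cases "ev0 (\<lambda>i. (of_int n gchoose i) *\<^sub>C g i)")
  case True
  then show ?thesis
    unfolding bsum_def ev0_finite
    using clinear_Sum_any[OF clinear_scaleC[of "-1"] True[unfolded ev0_finite]]
    by (simp add: minus1_scaleC)
next
  \<comment> \<open>With infinite support both sides are the default value 0 of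
    \<open>Sum_any\<close>.\<close>
  case False
  then show ?thesis unfolding bsum_def ev0_finite by simp
qed

lemma bsum_pascal:
  assumes "ev0 g"
  shows "bsum (n + 1) g = bsum n g + bsum n (\<lambda>i. g (Suc i))"
proof -
  obtain N where N: "\<forall>i\<ge>N. g i = 0" using assms unfolding ev0_def by blast
  then have N1: "\<forall>i\<ge>Suc N. g i = 0" "\<forall>i\<ge>N. g (Suc i) = 0" by auto
  have "bsum (n + 1) g = (\<Sum>i<Suc N. (of_int (n + 1) gchoose i) *\<^sub>C g i)"
    by (rule bsum_finite[OF N1(1)])
  also have "\<dots> = g 0 + (\<Sum>i<N. (of_int (n + 1) gchoose Suc i) *\<^sub>C g (Suc i))"
    by (subst sum.lessThan_Suc_shift) (simp add: scaleC_one)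
  also have "(\<Sum>i<N. (of_int (n + 1) gchoose Suc i) *\<^sub>C g (Suc i)) =
      (\<Sum>i<N. (of_int n gchoose i) *\<^sub>C g (Suc i)) + (\<Sum>i<N. (of_int n gchoose Suc i) *\<^sub>C g (Suc i))"
    by (simp add: gbinomial_Suc_Suc scaleC_add_left sum.distrib)
  also have "(\<Sum>i<N. (of_int n gchoose i) *\<^sub>C g (Suc i)) = bsum n (\<lambda>i. g (Suc i))"
    by (rule bsum_finite[OF N1(2), symmetric])
  also have "g 0 + (bsum n (\<lambda>i. g (Suc i)) + (\<Sum>i<N. (of_int n gchoose Suc i) *\<^sub>C g (Suc i)))
     = bsum n (\<lambda>i. g (Suc i)) + (\<Sum>i<Suc N. (of_int n gchoose i) *\<^sub>C g i)"
    by (subst sum.lessThan_Suc_shift) (simp add: scaleC_one)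
  also have "(\<Sum>i<Suc N. (of_int n gchoose i) *\<^sub>C g i) = bsum n g"
    by (rule bsum_finite[OF N1(1), symmetric])
  finally show ?thesis by simp
qed

lemma bsum_swap:
  assumes "\<And>i j. i + j \<ge> N \<Longrightarrow> g i j = 0"
  shows "bsum m (\<lambda>i. bsum n (\<lambda>j. g i j)) = bsum n (\<lambda>j. bsum m (\<lambda>i. g i j))"
proof -
  have a: "bsum n (\<lambda>j. g i j) = (\<Sum>j<N. (of_int n gchoose j) *\<^sub>C g i j)" for i
    by (rule bsum_finite) (simp add: assms)
  have b: "bsum m (\<lambda>i. g i j) = (\<Sum>i<N. (of_int m gchoose i) *\<^sub>C g i j)" for j
    by (rule bsum_finite) (simp add: assms)
  have "bsum m (\<lambda>i. bsum n (\<lambda>j. g i j)) = (\<Sum>i<N. (of_int m gchoose i) *\<^sub>C bsum n (\<lambda>j. g i j))"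
    by (rule bsum_finite) (auto intro!: bsum_zero assms)
  moreover have "bsum n (\<lambda>j. bsum m (\<lambda>i. g i j)) = (\<Sum>j<N. (of_int n gchoose j) *\<^sub>C bsum m (\<lambda>i. g i j))"
    by (rule bsum_finite) (auto intro!: bsum_zero assms)
  ultimately show ?thesis
    unfolding a b
    by (simp add: complex_vector.scale_sum_right scaleC_scaleC)
      (subst sum.swap, simp add: mult.commute)
qed

text \<open>With \<open>g M K\<close> the value on \<open>y\<^sub>1\<^sup>M y\<^sub>2\<^sup>K\<close>, these are the values on \<open>y\<^sub>1\<^sup>m y\<^sub>2\<^sup>k (y\<^sub>1 - y\<^sub>2)\<^sup>n\<close>,
  expanded in nonnegative powers of \<open>y\<^sub>2\<close> and of \<open>y\<^sub>1\<close> respectively.\<close>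

definition E1 :: "(int \<Rightarrow> int \<Rightarrow> 'a::complex_vector) \<Rightarrow> int \<Rightarrow> int \<Rightarrow> int \<Rightarrow> 'a" where
  "E1 g m n k = bsum n (\<lambda>i. (- 1) ^ i *\<^sub>C g (m + n - int i) (k + int i))"

definition E2 :: "(int \<Rightarrow> int \<Rightarrow> 'a::complex_vector) \<Rightarrow> int \<Rightarrow> int \<Rightarrow> int \<Rightarrow> 'a" where
  "E2 g m n k = (- 1) powi n *\<^sub>C bsum n (\<lambda>i. (- 1) ^ i *\<^sub>C g (m + int i) (n + k - int i))"

text \<open>Finiteness only along the antidiagonals that \<open>E1\<close> sums. It can come from
  truncation of an operator in \<open>K\<close> or from decay of a functional in \<open>M\<close>,
  and both cases occur.\<close>

definition fin1 :: "(int \<Rightarrow> int \<Rightarrow> 'a::zero) \<Rightarrow> bool" where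
  "fin1 g \<longleftrightarrow> (\<forall>M K. ev0 (\<lambda>i. g (M - int i) (K + int i)))"

definition fin2 :: "(int \<Rightarrow> int \<Rightarrow> 'a::zero) \<Rightarrow> bool" where
  "fin2 g \<longleftrightarrow> (\<forall>M K. ev0 (\<lambda>i. g (M + int i) (K - int i)))"

lemma fin1D: "fin1 g \<Longrightarrow> ev0 (\<lambda>i. g (M - int i) (K + int i))"
  and fin2D: "fin2 g \<Longrightarrow> ev0 (\<lambda>i. g (M + int i) (K - int i))"
  by (simp_all add: fin1_def fin2_def)

lemma E1_0: "E1 g m 0 k = g m k"
  by (simp add: E1_def bsum_0 scaleC_one)

lemma E2_0: "E2 g m 0 k = g m k"
  by (simp add: E2_def bsum_0 scaleC_one)

text \<open>(y1 - y2)^n = (-1)^n (y2 - y1)^n: interchanging the variables carries facts about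
  \<open>E1\<close> over to \<open>E2\<close>.\<close>

lemma E2_E1: "E2 g m n k = (- 1) powi n *\<^sub>C E1 (\<lambda>K M. g M K) k n m"
  by (simp add: E1_def E2_def add.commute)

lemma E1_rec:
  assumes "fin1 g"
  shows "E1 g m (n + 1) k = E1 g (m + 1) n k - E1 g m n (k + 1)"
proof -
  have e: "ev0 (\<lambda>i. (- 1) ^ i *\<^sub>C g (m + (n + 1) - int i) (k + int i))"
    by (rule ev0_scale) (rule fin1D[OF assms])
  show ?thesis
    unfolding E1_def bsum_pascal[OF e]
    by (simp add: bsum_uminus algebra_simps)
qed

lemma powi_m1_Suc: "(- 1 :: complex) powi (n + 1) = - ((- 1) powi n)"
  by (simp add: power_int_add)

lemma E1_linear: "clinear f \<Longrightarrow> fin1 g \<Longrightarrow> f (E1 g m n k) = E1 (\<lambda>M K. f (g M K)) m n k"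
  unfolding E1_def by (subst bsum_linear) (auto intro!: ev0_scale fin1D simp: clinear_scale)

lemma E2_linear: "clinear f \<Longrightarrow> fin2 g \<Longrightarrow> f (E2 g m n k) = E2 (\<lambda>M K. f (g M K)) m n k"
  unfolding E2_def clinear_scale by (subst bsum_linear) (auto intro!: ev0_scale fin2D simp: clinear_scale)

lemma E1_add: "fin1 g \<Longrightarrow> fin1 h \<Longrightarrow> E1 (\<lambda>M K. g M K + h M K) m n k = E1 g m n k + E1 h m n k"
  unfolding E1_def scaleC_add_right by (rule bsum_add) (auto intro!: ev0_scale fin1D)

lemma E2_add: "fin2 g \<Longrightarrow> fin2 h \<Longrightarrow> E2 (\<lambda>M K. g M K + h M K) m n k = E2 g m n k + E2 h m n k"
  unfolding E2_def scaleC_add_right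
  by (subst bsum_add) (auto intro!: ev0_scale fin2D simp: scaleC_add_right)

lemma E1_scale: "fin1 g \<Longrightarrow> E1 (\<lambda>M K. c *\<^sub>C g M K) m n k = c *\<^sub>C E1 g m n k"
  using E1_linear[OF clinear_scaleC] by metis

lemma E2_scale: "fin2 g \<Longrightarrow> E2 (\<lambda>M K. c *\<^sub>C g M K) m n k = c *\<^sub>C E2 g m n k"
  using E2_linear[OF clinear_scaleC] by metis

lemma fin1_add: "fin1 g \<Longrightarrow> fin1 h \<Longrightarrow> fin1 (\<lambda>M K. g M K + (h M K :: 'a::monoid_add))"
  and fin2_add: "fin2 g \<Longrightarrow> fin2 h \<Longrightarrow> fin2 (\<lambda>M K. g M K + (h M K :: 'a::monoid_add))"
  by (simp_all add: fin1_def fin2_def ev0_add)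

lemma fin1_linear: "fin1 g \<Longrightarrow> clinear f \<Longrightarrow> fin1 (\<lambda>M K. f (g M K))"
  unfolding fin1_def using ev0_linear[where f = f] by blast

lemma E1_shift1: "E1 (\<lambda>M K. g (M + 1) K) m n k = E1 g (m + 1) n k"
  and E1_shift2: "E1 (\<lambda>M K. g M (K + 1)) m n k = E1 g m n (k + 1)"
  by (simp_all add: E1_def algebra_simps)

lemma fin1_shift:
  assumes "fin1 g"
  shows "fin1 (\<lambda>M K. g (M + i) (K + j))"
proof -
  have "ev0 (\<lambda>l. g ((M + i) - int l) ((K + j) + int l))" for M K by (rule fin1D[OF assms])
  then show ?thesis unfolding fin1_def by (simp add: algebra_simps)
qed

text \<open>With \<open>h = g\<close>, the effect of a further factor y1 + c of the test function;
  \<open>E1_step2\<close> is the same for y2 + c.\<close>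

lemma E1_step1:
  assumes "fin1 g" "fin1 h" "\<And>M K. f M K = g (M + 1) K + c *\<^sub>C h M K"
  shows "E1 f m n k = E1 g (m + 1) n k + c *\<^sub>C E1 h m n k"
proof -
  have "f = (\<lambda>M K. g (M + 1) K + c *\<^sub>C h M K)" using assms(3) by blast
  then show ?thesis
    using E1_add[OF fin1_shift[OF assms(1), of 1 0, simplified] fin1_linear[OF assms(2) clinear_scaleC]]
    by (simp add: E1_shift1 E1_scale[OF assms(2)])
qed

lemma E1_step2:
  assumes "fin1 g" "fin1 h" "\<And>M K. f M K = g M (K + 1) + c *\<^sub>C h M K"
  shows "E1 f m n k = E1 g m n (k + 1) + c *\<^sub>C E1 h m n k"
proof -
  have "f = (\<lambda>M K. g M (K + 1) + c *\<^sub>C h M K)" using assms(3) by blast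
  then show ?thesis
    using E1_add[OF fin1_shift[OF assms(1), of 0 1, simplified] fin1_linear[OF assms(2) clinear_scaleC]]
    by (simp add: E1_shift2 E1_scale[OF assms(2)])
qed

lemma E1_step0:
  assumes "fin1 g" "fin1 h" "\<And>M K. f M K = g M K + c *\<^sub>C h M K"
  shows "E1 f m n k = E1 g m n k + c *\<^sub>C E1 h m n k"
proof -
  have "f = (\<lambda>M K. g M K + c *\<^sub>C h M K)" using assms(3) by blast
  then show ?thesis
    using E1_add[OF assms(1) fin1_linear[OF assms(2) clinear_scaleC]] by (simp add: E1_scale[OF assms(2)])
qed

lemma fin2_fin1: "fin2 g \<longleftrightarrow> fin1 (\<lambda>K M. g M K)"
  unfolding fin1_def fin2_def by blast

lemma E2_step1:
  assumes "fin2 g" "\<And>M K. f M K = g (M + 1) K + c *\<^sub>C g M K"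
  shows "E2 f m n k = E2 g (m + 1) n k + c *\<^sub>C E2 g m n k"
  using E1_step2[of "\<lambda>K M. g M K" "\<lambda>K M. g M K" "\<lambda>K M. f M K" c k n m] assms
  by (simp add: E2_E1 fin2_fin1 scaleC_add_right scaleC_scaleC mult.commute)

lemma E2_step2:
  assumes "fin2 g" "\<And>M K. f M K = g M (K + 1) + c *\<^sub>C g M K"
  shows "E2 f m n k = E2 g m n (k + 1) + c *\<^sub>C E2 g m n k"
  using E1_step1[of "\<lambda>K M. g M K" "\<lambda>K M. g M K" "\<lambda>K M. f M K" c k n m] assms
  by (simp add: E2_E1 fin2_fin1 scaleC_add_right scaleC_scaleC mult.commute)

lemma E1_zero: "(\<And>i. g (m + n - int i) (k + int i) = 0) \<Longrightarrow> E1 g m n k = 0"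
  and E2_zero: "(\<And>i. g (m + int i) (n + k - int i) = 0) \<Longrightarrow> E2 g m n k = 0"
  unfolding E1_def E2_def by (simp_all add: bsum_zero)

text \<open>Coefficient of t^I in (1 + t)^X (1 - t/(1 + t))^m = (1 + t)^(X - m). Negating the upper
  index of the second binomial turns the sum into Vandermonde's.\<close>

lemma binomial_convolution:
  "(\<Sum>i\<le>I. (- 1) ^ i * (m gchoose i) * ((X - of_nat i) gchoose (I - i))) = (X - m :: complex) gchoose I"
proof -
  have *: "(- 1) ^ i * (m gchoose i) * ((X - of_nat i) gchoose (I - i)) =
      (- 1) ^ I * ((m gchoose i) * ((of_nat I - X - 1) gchoose (I - i)))" if "i \<le> I" for i
  proof -
    have "((X - of_nat i) gchoose (I - i)) = (- 1) ^ (I - i) * ((of_nat (I - i) - (X - of_nat i) - 1) gchoose (I - i))"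
      by (rule gbinomial_negated_upper)
    also have "of_nat (I - i) - (X - of_nat i) - 1 = of_nat I - X - 1"
      using that by (simp add: of_nat_diff)
    finally show ?thesis
      using that by (simp add: power_add[symmetric] mult.assoc mult.left_commute)
  qed
  have "(\<Sum>i\<le>I. (- 1) ^ i * (m gchoose i) * ((X - of_nat i) gchoose (I - i))) =
      (- 1) ^ I * (\<Sum>i = 0..I. (m gchoose i) * ((of_nat I - X - 1) gchoose (I - i)))"
    unfolding sum_distrib_left by (rule sum.cong) (auto simp: *)
  also have "\<dots> = (- 1) ^ I * ((of_nat I - (X - m) - 1) gchoose I)"
    unfolding gbinomial_Vandermonde by (simp add: algebra_simps)
  also have "\<dots> = (X - m) gchoose I"
    by (rule gbinomial_negated_upper[symmetric])
  finally show ?thesis .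
qed

section \<open>Coefficients of formal delta functions\<close>

lemmas monom_simps = X0_def X1_def X2_def Const_def plus_prod_def minus_prod_def

text \<open>Here and in the lemmas that follow, the exponents of a monomial determine the summation
  pair (n, k), so at most one term is nonzero; the pair handed to \<open>Sum_any_single\<close> is
  that solution.\<close>

lemma fdelta_10:
  "fdelta X1 (mneg X2) X0 (i, j, k) =
     (if 0 \<le> k \<and> i + j + k = 0 then (of_int (- i) gchoose nat k) * (- 1) ^ nat k else 0)"
  unfolding fdelta_def
  by (subst Sum_any_single[of "(- i, nat k)"]) (auto simp: monom_simps split: if_splits)

lemma fdelta_21:
  "fdelta X2 (mneg X1) (mneg X0) (i, j, k) =
     (if 0 \<le> j \<and> i + j + k = 0 then (of_int (- i) gchoose nat j) * (- 1) ^ nat j * (- 1) powi i else 0)"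
  unfolding fdelta_def
  by (subst Sum_any_single[of "(- i, nat j)"]) (auto simp: monom_simps split: if_splits)

lemma fdelta_102:
  "fdelta X1 (mneg X0) X2 (i, j, k) =
     (if 0 \<le> i \<and> i + j + k = 0 then (of_int (- k) gchoose nat i) * (- 1) ^ nat i else 0)"
  unfolding fdelta_def
  by (subst Sum_any_single[of "(- k, nat i)"]) (auto simp: monom_simps split: if_splits)

lemma fdelta_P1:
  "fdelta (minv X1) (mneg X0) (Const z) (i, j, k) =
     (if 0 \<le> i \<and> k = 0 then (of_int (i - j) gchoose nat i) * (- 1) ^ nat i * z powi (j - i) else 0)"
  unfolding fdelta_def
  by (subst Sum_any_single[of "(i - j, nat i)"]) (auto simp: monom_simps split: if_splits)

lemma fdelta_P2:
  "fdelta (minv X1) (mneg (Const z)) X0 (i, j, k) =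
     (if 0 \<le> j - i \<and> k = 0 then (of_int (- i) gchoose nat (j - i)) * (- z) ^ nat (j - i) else 0)"
  unfolding fdelta_def
  by (subst Sum_any_single[of "(- i, nat (j - i))"]) (auto simp: monom_simps split: if_splits)

lemma fdelta_P3:
  "fdelta (Const z) (mneg (minv X1)) (mneg X0) (i, j, k) =
     (if j \<le> 0 \<and> k = 0 then (of_int (- i) gchoose nat (- j)) * (z powi (j - i) * (- 1) ^ nat (- j) * (- 1) powi i) else 0)"
  unfolding fdelta_def
  by (subst Sum_any_single[of "(- i, nat (- j))"]) (auto simp: monom_simps split: if_splits)

lemma fdelta_Q1:
  "fdelta X1 (mneg (Const z)) X0 (i, j, k) =
     (if i + j \<le> 0 \<and> k = 0 then (of_int (- i) gchoose nat (- i - j)) * (- z) ^ nat (- i - j) else 0)"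
  unfolding fdelta_def
  by (subst Sum_any_single[of "(- i, nat (- i - j))"]) (auto simp: monom_simps split: if_splits)

lemma fdelta_Q2:
  "fdelta (Const z) (mneg X1) (mneg X0) (i, j, k) =
     (if 0 \<le> j \<and> k = 0 then (of_int (- i) gchoose nat j) * (z powi (- i - j) * (- 1) ^ nat j * (- 1) powi i) else 0)"
  unfolding fdelta_def
  by (subst Sum_any_single[of "(- i, nat j)"]) (auto simp: monom_simps split: if_splits)

lemma fdelta_Q3:
  "fdelta X1 (mneg X0) (Const z) (i, j, k) =
     (if 0 \<le> i \<and> k = 0 then (of_int (i + j) gchoose nat i) * (- 1) ^ nat i * z powi (- i - j) else 0)"
  unfolding fdelta_def
  by (subst Sum_any_single[of "(i + j, nat i)"]) (auto simp: monom_simps split: if_splits)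

lemma gbinomial_negate_int:
  "(of_int (int i + j) gchoose i) * (- 1) ^ i = ((of_int (- j - 1) :: complex) gchoose i)"
  by (subst (2) gbinomial_negated_upper) (simp add: algebra_simps)

lemma powi_m1_minus: "(- 1 :: complex) powi (- n) = (- 1) powi n"
  by (cases "even n") (simp_all add: power_int_minus power_int_minus_left)

lemma mscale_minv_X0: "mscale (minv X0) F (i, j, k) = F (i + 1, j, k)"
  and mscale_minv_X2: "mscale (minv X2) F (i, j, k) = F (i, j, k + 1)"
  and mscale_Const: "mscale (Const c) F (i, j, k) = c * F (i, j, k)"
  by (simp_all add: monom_simps)

lemma diff_triple: "(i, j, k) - (i', j', k') = (i - i', j - j', k - (k'::int))"
  for i j i' j' :: int
  by (simp add: minus_prod_def)

lemmas mscale_simps = mscale_minv_X0 mscale_minv_X2 mscale_Const diff_triple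

subsection \<open>The Jacobi identity in components\<close>

text \<open>\<open>md Y v n\<close> is the mode \<open>v\<^sub>n\<close>, the coefficient of \<open>x\<^sup>-\<^sup>n\<^sup>-\<^sup>1\<close> in \<open>Y(v, x)\<close>.\<close>

definition md :: "('v, 'w) vertex_map \<Rightarrow> 'v \<Rightarrow> int \<Rightarrow> 'w \<Rightarrow> 'w" where
  "md Y v n = Y v (- n - 1)"

text \<open>A delta function is supported on a set parametrized by \<open>h\<close>, so a product
  with it is a sum over the parameter; \<open>t\<close> recovers the parameter from a point of the
  support.\<close>

lemma fmult_line:
  assumes "inj h" "\<And>i j k. F (i, j, k) *\<^sub>C G (d - (i, j, k)) \<noteq> 0 \<Longrightarrow> h (t i j k) = (i, j, k)"
  shows "(F \<odot> G) d = Sum_any (\<lambda>l. F (h l) *\<^sub>C G (d - h l))"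
  unfolding fmult_def
  by (rule Sum_any_reindex[OF assms(1)]) (metis assms(2) prod_cases3 rangeI)

text \<open>The coefficient at x^q is the mode -q - 1. Hence the coefficient at (p, q, r) is the
  value on x1^(-q-1) x2^(-r-1) (x1 - x2)^(-p-1), expanded as the delta function prescribes.\<close>

lemma jacobi_coeff1:
  "(mscale (minv X0) (fdelta X1 (mneg X2) X0) \<odot> in_X1_X2 G) (p, q, r) =
     E1 (\<lambda>M K. G (- M - 1) (- K - 1)) (- q - 1) (- p - 1) (- r - 1)" (is "(?F \<odot> ?G) ?d = _")
proof -
  have "(?F \<odot> ?G) ?d = Sum_any (\<lambda>l. ?F (p, - p - 1 - int l, int l) *\<^sub>C ?G (?d - (p, - p - 1 - int l, int l)))"
    by (rule fmult_line[where t = "\<lambda>i j k. nat k"])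
      (auto simp: inj_def mscale_simps fdelta_10 in_X1_X2_def split: if_splits)
  also have "\<dots> = E1 (\<lambda>M K. G (- M - 1) (- K - 1)) (- q - 1) (- p - 1) (- r - 1)"
    unfolding E1_def bsum_def
    by (intro Sum_any.cong)
      (simp add: mscale_simps fdelta_10 in_X1_X2_def scaleC_scaleC algebra_simps, metis minus_diff_commute)
  finally show ?thesis .
qed

lemma Sum_any_scaleC: "c \<noteq> 0 \<Longrightarrow> Sum_any (\<lambda>l. c *\<^sub>C f l) = c *\<^sub>C Sum_any f"
  using clinear_Sum_any[OF clinear_scaleC, of f c]
  by (cases "finite {l. f l \<noteq> 0}") (simp_all add: Sum_any.infinite)

lemma jacobi_coeff2:
  "(mscale (minv X0) (fdelta X2 (mneg X1) (mneg X0)) \<odot> in_X1_X2 G) (p, q, r) =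
     E2 (\<lambda>M K. G (- M - 1) (- K - 1)) (- q - 1) (- p - 1) (- r - 1)" (is "(?F \<odot> ?G) ?d = _")
proof -
  have "(?F \<odot> ?G) ?d = Sum_any (\<lambda>l. ?F (p, int l, - p - 1 - int l) *\<^sub>C ?G (?d - (p, int l, - p - 1 - int l)))"
    by (rule fmult_line[where t = "\<lambda>i j k. nat j"])
      (auto simp: inj_def mscale_simps fdelta_21 in_X1_X2_def split: if_splits)
  also have "\<dots> = Sum_any (\<lambda>l. (- 1) powi (- p - 1) *\<^sub>C ((of_int (- p - 1) gchoose l) * (- 1) ^ l) *\<^sub>C G (q - int l) (r + p + 1 + int l))"
    using powi_m1_minus[of "p + 1"] minus_diff_commute[of "1::complex" "of_int p"] minus_diff_commute[of 1 p]
    by (intro Sum_any.cong)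
      (simp add: mscale_simps fdelta_21 in_X1_X2_def scaleC_scaleC algebra_simps, metis minus_diff_commute)
  also have "\<dots> = E2 (\<lambda>M K. G (- M - 1) (- K - 1)) (- q - 1) (- p - 1) (- r - 1)"
    unfolding E2_def bsum_def by (subst Sum_any_scaleC) (simp_all add: scaleC_scaleC algebra_simps)
  finally show ?thesis .
qed

lemma jacobi_coeff3:
  "(mscale (minv X2) (fdelta X1 (mneg X0) X2) \<odot> in_X0_X2 G) (p, q, r) =
     bsum (- q - 1) (\<lambda>i. G (p - int i) (r + 1 + q + int i))" (is "(?F \<odot> ?G) ?d = _")
proof -
  have "(?F \<odot> ?G) ?d = Sum_any (\<lambda>l. ?F (int l, q, - 1 - int l - q) *\<^sub>C ?G (?d - (int l, q, - 1 - int l - q)))"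
    by (rule fmult_line[where t = "\<lambda>i j k. nat i"])
      (auto simp: inj_def mscale_simps fdelta_102 in_X0_X2_def split: if_splits)
  also have "\<dots> = bsum (- q - 1) (\<lambda>i. G (p - int i) (r + 1 + q + int i))"
    unfolding bsum_def
  proof (rule Sum_any.cong)
    fix l
    show "?F (int l, q, - 1 - int l - q) *\<^sub>C ?G (?d - (int l, q, - 1 - int l - q)) =
        (of_int (- q - 1) gchoose l) *\<^sub>C G (p - int l) (r + 1 + q + int l)"
      using gbinomial_negate_int[of l q]
      by (simp add: mscale_simps fdelta_102 in_X0_X2_def algebra_simps)
  qed
  finally show ?thesis .
qed

text \<open>The Jacobi identity paired with y1^m y2^k (y1 - y2)^n. On the iterate side y1^m is
  expanded as (y2 + (y1 - y2))^m, whence the single binomial sum.\<close>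

definition borcherds :: "'v voa_data \<Rightarrow> ('v, 'w::complex_vector) vertex_map \<Rightarrow> 'v \<Rightarrow> 'v \<Rightarrow> 'w \<Rightarrow> bool" where
  "borcherds V Y u v w \<longleftrightarrow> (\<forall>m n k.
     E1 (\<lambda>M K. md Y u M (md Y v K w)) m n k - E2 (\<lambda>M K. md Y v K (md Y u M w)) m n k =
     bsum m (\<lambda>i. md Y (md (vop V) u (n + int i) v) (m + k - int i) w))"

lemma jacobi_iff_borcherds: "jacobi_identity V Y u v w \<longleftrightarrow> borcherds V Y u v w"
proof -
  have c2: "(mscale (minv X0) (fdelta X2 (mneg X1) (mneg X0)) \<odot> in_X1_X2 (\<lambda>i j. Y v j (Y u i w))) (p, q, r) =
      E2 (\<lambda>M K. md Y v K (md Y u M w)) (- q - 1) (- p - 1) (- r - 1)" for p q r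
    unfolding jacobi_coeff2 md_def ..
  have c1: "(mscale (minv X0) (fdelta X1 (mneg X2) X0) \<odot> in_X1_X2 (\<lambda>i j. Y u i (Y v j w))) (p, q, r) =
      E1 (\<lambda>M K. md Y u M (md Y v K w)) (- q - 1) (- p - 1) (- r - 1)" for p q r
    unfolding jacobi_coeff1 md_def ..
  have c3: "(mscale (minv X2) (fdelta X1 (mneg X0) X2) \<odot> in_X0_X2 (\<lambda>i j. Y (vop V u i v) j w)) (p, q, r) =
      bsum (- q - 1) (\<lambda>i. md Y (md (vop V) u ((- p - 1) + int i) v) ((- q - 1) + (- r - 1) - int i) w)" for p q r
    unfolding jacobi_coeff3 md_def by (simp add: algebra_simps)
  have "jacobi_identity V Y u v w \<longleftrightarrow> (\<forall>p q r.
     E1 (\<lambda>M K. md Y u M (md Y v K w)) (- q - 1) (- p - 1) (- r - 1) - E2 (\<lambda>M K. md Y v K (md Y u M w)) (- q - 1) (- p - 1) (- r - 1) =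
     bsum (- q - 1) (\<lambda>i. md Y (md (vop V) u ((- p - 1) + int i) v) ((- q - 1) + (- r - 1) - int i) w))"
    unfolding jacobi_identity_def fun_eq_iff by (simp only: split_paired_All fun_diff_def c1 c2 c3)
  also have "\<dots> \<longleftrightarrow> borcherds V Y u v w"
    unfolding borcherds_def
  proof (intro iffI allI)
    fix m n k
    assume "\<forall>p q r. E1 (\<lambda>M K. md Y u M (md Y v K w)) (- q - 1) (- p - 1) (- r - 1) - E2 (\<lambda>M K. md Y v K (md Y u M w)) (- q - 1) (- p - 1) (- r - 1) =
     bsum (- q - 1) (\<lambda>i. md Y (md (vop V) u ((- p - 1) + int i) v) ((- q - 1) + (- r - 1) - int i) w)"
    from this[rule_format, of "- m - 1" "- n - 1" "- k - 1"]
    show "E1 (\<lambda>M K. md Y u M (md Y v K w)) m n k - E2 (\<lambda>M K. md Y v K (md Y u M w)) m n k =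
     bsum m (\<lambda>i. md Y (md (vop V) u (n + int i) v) (m + k - int i) w)" by simp
  qed blast
  finally show ?thesis .
qed

section \<open>Weak modules in components\<close>

text \<open>For \<open>X r a b\<close> the value of \<open>u\<^sub>r v\<close> on \<open>t\<^sup>a (t + c)\<^sup>b\<close>, the value of
  \<open>Y(Y(u, y\<^sub>1 - y\<^sub>2) v, y\<^sub>2)\<close> on \<open>(y\<^sub>1 - y\<^sub>2)\<^sup>n y\<^sub>1\<^sup>m (y\<^sub>1 + c)\<^sup>p y\<^sub>2\<^sup>k (y\<^sub>2 + c)\<^sup>q\<close>.\<close>

definition T3 :: "(int \<Rightarrow> int \<Rightarrow> int \<Rightarrow> 'x::complex_vector) \<Rightarrow> int \<Rightarrow> int \<Rightarrow> int \<Rightarrow> int \<Rightarrow> int \<Rightarrow> 'x" where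
  "T3 X n m p k q = bsum m (\<lambda>i. bsum p (\<lambda>j. X (n + int i + int j) (m + k - int i) (p + q - int j)))"

lemma T3_ev0_inner:
  assumes "\<And>r a b. r \<ge> R \<Longrightarrow> X r a b = 0"
  shows "ev0 (\<lambda>j. X (n + int i + int j) a (b - int j))"
  unfolding ev0_def by (rule exI[of _ "nat (R - n - int i)"]) (auto intro!: assms)

lemma T3_ev0_outer:
  assumes "\<And>r a b. r \<ge> R \<Longrightarrow> X r a b = 0"
  shows "ev0 (\<lambda>i. bsum p (\<lambda>j. X (n + int i + int j) (a - int i) (b - int j)))"
  unfolding ev0_def by (rule exI[of _ "nat (R - n)"]) (auto intro!: assms bsum_zero)

lemma T3_rec_q:
  assumes "\<And>r a b. r \<ge> R \<Longrightarrow> X r a b = 0"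
    and "\<And>r a b. X r a (b + 1) = X r (a + 1) b + c *\<^sub>C X r a b"
  shows "T3 X n m p k (q + 1) = T3 X n m p (k + 1) q + c *\<^sub>C T3 X n m p k q"
proof -
  have e: "ev0 (\<lambda>j. X (n + int i + int j) a (b - int j))" for i a b
    by (rule T3_ev0_inner[OF assms(1)])
  have e': "ev0 (\<lambda>i. bsum p (\<lambda>j. X (n + int i + int j) (a - int i) (b - int j)))" for a b
    by (rule T3_ev0_outer[OF assms(1)])
  have s: "X r a (p + (q + 1) - int j) = X r (a + 1) (p + q - int j) + c *\<^sub>C X r a (p + q - int j)" for r a j
    using assms(2)[of r a "p + q - int j"] by (simp add: algebra_simps)
  have t: "m + k - int i + 1 = m + (k + 1) - int i" for i by simp
  show ?thesis
    unfolding T3_def s bsum_add[OF e ev0_scale[OF e]] bsum_scale[OF e] t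
    by (simp only: bsum_add[OF e' ev0_scale[OF e']] bsum_scale[OF e'])
qed

text \<open>On the left Pascal in \<open>p\<close> splits y1 + c into (y1 - y2) + (y2 + c); on the
  right Pascal in \<open>m\<close> splits y1 into (y1 - y2) + y2. The parts with y1 - y2 coincide,
  and the recursion of \<open>X\<close> links the others.\<close>

lemma T3_rec_p:
  assumes "\<And>r a b. r \<ge> R \<Longrightarrow> X r a b = 0"
    and "\<And>r a b. X r a (b + 1) = X r (a + 1) b + c *\<^sub>C X r a b"
  shows "T3 X n m (p + 1) k q = T3 X n (m + 1) p k q + c *\<^sub>C T3 X n m p k q"
proof -
  have e: "ev0 (\<lambda>j. X (n + int i + int j) a (b - int j))" for i a b
    by (rule T3_ev0_inner[OF assms(1)])
  have e1: "ev0 (\<lambda>j. X (n + int i + int (Suc j)) a (b - int (Suc j)))" for i a b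
    using ev0_Suc[OF e[of i a b]] by simp
  have o: "ev0 (\<lambda>i. bsum p (\<lambda>j. X (n + int i + int j) (a - int i) (b - int j)))" for a b
    by (rule T3_ev0_outer[OF assms(1)])
  have o1: "ev0 (\<lambda>i. bsum p (\<lambda>j. X (n + int i + int (Suc j)) (a - int i) (b - int (Suc j))))" for a b
    using T3_ev0_outer[of R X p "n + 1" a "b - 1", OF assms(1)] by (simp add: algebra_simps)
  have s: "X r a (p + 1 + q - int j) = X r (a + 1) (p + q - int j) + c *\<^sub>C X r a (p + q - int j)" for r a j
    using assms(2)[of r a "p + q - int j"] by (simp add: algebra_simps)
  have t: "m + k - int i + 1 = m + 1 + k - int i" for i by simp
  have "T3 X n m (p + 1) k q =
      bsum m (\<lambda>i. bsum p (\<lambda>j. X (n + int i + int j) (m + k - int i) (p + 1 + q - int j))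
        + bsum p (\<lambda>j. X (n + int i + int (Suc j)) (m + k - int i) (p + 1 + q - int (Suc j))))"
    unfolding T3_def by (rule bsum_cong) (rule bsum_pascal[OF e])
  also have "\<dots> = bsum m (\<lambda>i. bsum p (\<lambda>j. X (n + int i + int j) (m + k - int i) (p + 1 + q - int j)))
      + bsum m (\<lambda>i. bsum p (\<lambda>j. X (n + int i + int (Suc j)) (m + k - int i) (p + 1 + q - int (Suc j))))"
    by (rule bsum_add[OF o o1])
  also have "bsum m (\<lambda>i. bsum p (\<lambda>j. X (n + int i + int j) (m + k - int i) (p + 1 + q - int j))) =
      bsum m (\<lambda>i. bsum p (\<lambda>j. X (n + int i + int j) (m + 1 + k - int i) (p + q - int j))) + c *\<^sub>C T3 X n m p k q"
    unfolding T3_def s bsum_add[OF e ev0_scale[OF e]] bsum_scale[OF e] t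
    by (simp only: bsum_add[OF o ev0_scale[OF o]] bsum_scale[OF o])
  also have "bsum m (\<lambda>i. bsum p (\<lambda>j. X (n + int i + int (Suc j)) (m + k - int i) (p + 1 + q - int (Suc j)))) =
      bsum m (\<lambda>i. bsum p (\<lambda>j. X (n + int (Suc i) + int j) (m + 1 + k - int (Suc i)) (p + q - int j)))"
    by (simp add: algebra_simps)
  also have "T3 X n (m + 1) p k q = 
      bsum m (\<lambda>i. bsum p (\<lambda>j. X (n + int i + int j) (m + 1 + k - int i) (p + q - int j)))
    + bsum m (\<lambda>i. bsum p (\<lambda>j. X (n + int (Suc i) + int j) (m + 1 + k - int (Suc i)) (p + q - int j)))"
    unfolding T3_def by (rule bsum_pascal) (rule T3_ev0_outer[OF assms(1)])
  ultimately show ?thesis by (simp add: algebra_simps)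
qed

text \<open>Truncation bounds depend on the vector; this merges those of finitely many
  vectors.\<close>

lemma uniform_bound_nat:
  assumes "\<And>i::nat. \<exists>N::int. \<forall>a\<ge>N. P i a"
  shows "\<exists>N. \<forall>i<I. \<forall>a\<ge>N. P i a"
proof (induction I)
  case (Suc I)
  then obtain N where N: "\<forall>i<I. \<forall>a\<ge>N. P i a" by blast
  obtain N' where N': "\<forall>a\<ge>N'. P I a" using assms by blast
  have "\<forall>i<Suc I. \<forall>a\<ge>max N N'. P i a" using N N' by (auto simp: less_Suc_eq)
  then show ?case by blast
qed auto

text \<open>Here \<open>f m p\<close> stands for a defect evaluated on \<open>t\<^sup>m (t + c)\<^sup>p\<close>; for negative \<open>p\<close> the recursion
  is solved downwards from the region where \<open>f\<close> vanishes.\<close>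

lemma rec1_zero:
  fixes f :: "int \<Rightarrow> int \<Rightarrow> 'x::complex_vector"
  assumes c: "c \<noteq> 0"
    and rec: "\<And>m p. f m (p + 1) = f (m + 1) p + c *\<^sub>C f m p"
    and base: "\<And>m. f m 0 = 0"
    and van: "\<And>p. \<exists>N. \<forall>m\<ge>N. f m p = 0"
  shows "f m p = 0"
proof -
  have "\<forall>m. f m p = 0"
  proof (induction p rule: int_induct[where k = 0])
    case base
    then show ?case using assms(3) ..
  next
    case (step1 i)
    then show ?case by (simp add: rec)
  next
    case (step2 i)
    have fi: "f m i = 0" for m using step2(2) ..
    have r: "f (m + 1) (i - 1) = - (c *\<^sub>C f m (i - 1))" for m
    proof -
      have "f m i = f (m + 1) (i - 1) + c *\<^sub>C f m (i - 1)" using rec[of m "i - 1"] by simp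
      then have "f (m + 1) (i - 1) + c *\<^sub>C f m (i - 1) = 0" unfolding fi by (rule sym)
      then show ?thesis by (rule eq_neg_iff_add_eq_0[THEN iffD2])
    qed
    from van[of "i - 1"] obtain N where N: "\<forall>m\<ge>N. f m (i - 1) = 0" ..
    have z: "f m (i - 1) = 0" if "f (m + 1) (i - 1) = 0" for m
    proof -
      have "c *\<^sub>C f m (i - 1) = 0" using r[of m] unfolding that by simp
      then show ?thesis using c by simp
    qed
    have "f m (i - 1) = 0" for m
    proof (cases "m \<ge> N")
      case False
      then have "m \<le> N" by simp
      then show ?thesis
      proof (induction rule: int_le_induct)
        case base
        then show ?case using N by simp
      next
        case (step j)
        then show ?case using z[of "j - 1"] by simp
      qed
    qed (simp add: N)
    then show ?case ..
  qed
  then show ?thesis ..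
qed

section \<open>A single weak module, tested on functions with poles at 0 and -c\<close>

locale weak_mod =
  fixes V :: "'v::complex_vector voa_data" and Y :: "('v, 'w::complex_vector) vertex_map"
  assumes weak: "weak_module V UNIV Y" and weak_V: "weak_module V UNIV (vop V)"
begin

lemma clinear_md: "clinear (md Y v n)"
proof -
  have "clinear_on UNIV (Y v (- n - 1))" using weak unfolding weak_module_def by blast
  then show ?thesis by (intro clinearI) (simp_all add: clinear_on_def md_def)
qed

lemma clinear_md_vec: "clinear (\<lambda>v. md Y v n w)"
proof -
  have "clinear (\<lambda>v. Y v (- n - 1) w)" using weak unfolding weak_module_def by blast
  then show ?thesis by (simp add: md_def)
qed

lemma md_trunc: "\<exists>N. \<forall>n\<ge>N. md Y v n w = 0"
proof -
  obtain N where "\<forall>n<N. Y v n w = 0" using weak unfolding weak_module_def by blast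
  then have "\<forall>n\<ge>- N. md Y v n w = 0" unfolding md_def by simp
  then show ?thesis by blast
qed

lemma md_trunc_V: "\<exists>N. \<forall>n\<ge>N. md (vop V) u n v = 0"
proof -
  obtain N where "\<forall>n<N. vop V u n v = 0" using weak_V unfolding weak_module_def by blast
  then have "\<forall>n\<ge>- N. md (vop V) u n v = 0" unfolding md_def by simp
  then show ?thesis by blast
qed

lemma md_vac: "md Y (vac V) n w = (if n = -1 then w else 0)"
proof -
  have "\<forall>n. Y (vac V) n w = (if n = 0 then w else 0)" using weak unfolding weak_module_def by blast
  then show ?thesis by (simp add: md_def)
qed

lemma bor: "E1 (\<lambda>M K. md Y u M (md Y v K w)) m n k - E2 (\<lambda>M K. md Y v K (md Y u M w)) m n k =
     bsum m (\<lambda>i. md Y (md (vop V) u (n + int i) v) (m + k - int i) w)"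
proof -
  have "borcherds V Y u v w" using weak unfolding weak_module_def jacobi_iff_borcherds by blast
  then show ?thesis unfolding borcherds_def by blast
qed

lemma ev0_md: "ev0 (\<lambda>i. md Y v (a + int i) w)"
proof -
  obtain N where "\<forall>n\<ge>N. md Y v n w = 0" using md_trunc by blast
  then show ?thesis by (intro ev0_int[where f = "\<lambda>n. md Y v n w"]) auto
qed

text \<open>\<open>xp c v a b\<close> is the value of \<open>Y(v, t)\<close> on \<open>t\<^sup>a (t + c)\<^sup>b\<close>.\<close>

definition xp :: "complex \<Rightarrow> 'v \<Rightarrow> int \<Rightarrow> int \<Rightarrow> 'w \<Rightarrow> 'w" where
  "xp c v a b w = bsum b (\<lambda>i. c powi (b - int i) *\<^sub>C md Y v (a + int i) w)"

lemma clinear_xp: "clinear (xp c v a b)"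
proof (rule clinearI)
  fix x y d
  have e: "ev0 (\<lambda>i. c powi (b - int i) *\<^sub>C md Y v (a + int i) w)" for w
    by (rule ev0_scale) (rule ev0_md)
  show "xp c v a b (x + y) = xp c v a b x + xp c v a b y"
    unfolding xp_def clinear_add[OF clinear_md] scaleC_add_right by (rule bsum_add[OF e e])
  show "xp c v a b (d *\<^sub>C x) = d *\<^sub>C xp c v a b x"
    unfolding xp_def bsum_scale[OF e, symmetric]
    by (simp add: clinear_scale[OF clinear_md] scaleC_scaleC mult.commute)
qed

lemma clinear_xp_vec: "clinear (\<lambda>v. xp c v a b w)"
proof (rule clinearI)
  fix x y d
  have e: "ev0 (\<lambda>i. c powi (b - int i) *\<^sub>C md Y v (a + int i) w)" for v
    by (rule ev0_scale) (rule ev0_md)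
  show "xp c (x + y) a b w = xp c x a b w + xp c y a b w"
    unfolding xp_def clinear_add[OF clinear_md_vec] scaleC_add_right by (rule bsum_add[OF e e])
  show "xp c (d *\<^sub>C x) a b w = d *\<^sub>C xp c x a b w"
    unfolding xp_def bsum_scale[OF e, symmetric]
    by (simp add: clinear_scale[OF clinear_md_vec] scaleC_scaleC mult.commute)
qed

lemma xp_0: "xp c v a 0 w = md Y v a w"
  by (simp add: xp_def bsum_0 scaleC_one)

lemma xp_rec:
  assumes "c \<noteq> 0"
  shows "xp c v a (b + 1) w = xp c v (a + 1) b w + c *\<^sub>C xp c v a b w"
proof -
  have e: "ev0 (\<lambda>i. f i *\<^sub>C md Y v (a + int i) w)" for f a
    by (rule ev0_scale) (rule ev0_md)
  show ?thesis
    unfolding xp_def bsum_pascal[OF e] bsum_scale[OF e, symmetric]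
    using assms by (simp add: scaleC_scaleC algebra_simps power_int_add power_int_diff)
qed

lemma xp_trunc: "\<exists>N. \<forall>a\<ge>N. \<forall>b. xp c v a b w = 0"
proof -
  obtain N where "\<forall>n\<ge>N. md Y v n w = 0" using md_trunc by blast
  then have "\<forall>a\<ge>N. \<forall>b. xp c v a b w = 0"
    unfolding xp_def by (auto intro!: bsum_zero)
  then show ?thesis by blast
qed

lemma xp_zero: "xp c v a b 0 = 0"
  by (rule clinear_zero[OF clinear_xp])

lemma xp_zero_vec: "xp c 0 a b w = 0"
  by (rule clinear_zero[OF clinear_xp_vec])

lemma ev0_xp: "ev0 (\<lambda>i. xp c v (a + int i) b w)"
proof -
  obtain N where "\<forall>a\<ge>N. \<forall>b. xp c v a b w = 0" using xp_trunc by blast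
  then show ?thesis by (intro ev0_int[where f = "\<lambda>n. xp c v n b w"]) auto
qed

lemma fin1_xp: "(\<And>M. clinear (f M)) \<Longrightarrow> fin1 (\<lambda>M K. f M (xp c v K q w))"
  unfolding fin1_def
proof (intro allI)
  fix M K assume f: "\<And>M. clinear (f M)"
  show "ev0 (\<lambda>i. f (M - int i) (xp c v (K + int i) q w))"
    by (rule ev0_mono[OF ev0_xp[of c v K q w]]) (simp add: clinear_zero[OF f])
qed

lemma fin2_xp: "(\<And>M. clinear (f M)) \<Longrightarrow> fin2 (\<lambda>M K. f K (xp c v M q w))"
  using fin1_xp[of "\<lambda>K. f K" c v q w] by (simp add: fin1_def fin2_def)

definition X3 :: "complex \<Rightarrow> 'v \<Rightarrow> 'v \<Rightarrow> 'w \<Rightarrow> int \<Rightarrow> int \<Rightarrow> int \<Rightarrow> 'w" where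
  "X3 c u v w r a b = xp c (md (vop V) u r v) a b w"

lemma X3_trunc: "\<exists>R. \<forall>r\<ge>R. \<forall>a b. X3 c u v w r a b = 0"
proof -
  obtain R where "\<forall>r\<ge>R. md (vop V) u r v = 0" using md_trunc_V by blast
  then show ?thesis unfolding X3_def by (intro exI[of _ R]) (simp add: xp_zero_vec)
qed

lemma X3_rec: "c \<noteq> 0 \<Longrightarrow> X3 c u v w r a (b + 1) = X3 c u v w r (a + 1) b + c *\<^sub>C X3 c u v w r a b"
  unfolding X3_def by (rule xp_rec)

text \<open>Only the finitely many u_r v with n <= r < R contribute. For these i + j is bounded, so
  \<open>m + k - i\<close> exceeds all their truncation bounds once \<open>m + k\<close> is
  large.\<close>

lemma T3_X3_large: "\<exists>N. \<forall>a\<ge>N. \<forall>m p k q. m + k = a \<longrightarrow> T3 (X3 c u v w) n m p k q = 0"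
proof -
  obtain R where R: "\<forall>r\<ge>R. \<forall>a b. X3 c u v w r a b = 0" using X3_trunc by blast
  obtain N where N: "\<forall>i<nat (R - n). \<forall>a\<ge>N. \<forall>b. X3 c u v w (n + int i) a b = 0"
    using uniform_bound_nat[of "\<lambda>i a. \<forall>b. X3 c u v w (n + int i) a b = 0" "nat (R - n)"] xp_trunc
    unfolding X3_def by blast
  have "T3 (X3 c u v w) n m p k q = 0" if "m + k \<ge> N + \<bar>R - n\<bar>" for m p k q
    unfolding T3_def
  proof (intro bsum_zero)
    fix i j
    show "X3 c u v w (n + int i + int j) (m + k - int i) (p + q - int j) = 0"
    proof (cases "n + int i + int j \<ge> R")
      case False
      then have "i + j < nat (R - n)" "m + k - int i \<ge> N" using that by linarith+
      then have "X3 c u v w (n + int (i + j)) (m + k - int i) (p + q - int j) = 0" using N by blast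
      then show ?thesis by (simp add: add.assoc)
    qed (use R in blast)
  qed
  then show ?thesis by blast
qed

text \<open>The truncation bound of \<open>u\<close> depends on the vector it is applied to, but
  only finitely many of the inner vectors are nonzero.\<close>

lemma xp_xp_large:
  "\<exists>N. \<forall>a\<ge>N. \<forall>i. xp c u (a - int i) p (xp c v (k + int i) q w) = 0"
proof -
  obtain N0 where N0: "\<forall>a\<ge>N0. \<forall>b. xp c v a b w = 0" using xp_trunc by blast
  define I where "I = nat (N0 - k)"
  obtain N where N: "\<forall>i<I. \<forall>a\<ge>N. \<forall>b. xp c u a b (xp c v (k + int i) q w) = 0"
    using uniform_bound_nat[of "\<lambda>i a. \<forall>b. xp c u a b (xp c v (k + int i) q w) = 0" I] xp_trunc by blast
  have "xp c u (a - int i) p (xp c v (k + int i) q w) = 0" if "a \<ge> N + int I" for a i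
  proof (cases "i < I")
    case True
    then have "a - int i \<ge> N" using that by linarith
    then show ?thesis using N True by blast
  next
    case False
    then have "k + int i \<ge> N0" unfolding I_def by linarith
    then show ?thesis using N0 by (simp add: xp_zero)
  qed
  then show ?thesis by blast
qed

text \<open>The defect \<open>D\<close> obeys the recursions for the factors y1 + c and y2 + c and
  vanishes for large \<open>m\<close> or large \<open>k\<close>. So \<open>rec1_zero\<close> brings
  \<open>p\<close>, and after that \<open>q\<close>, to exponent 0, where the identity is
  \<open>bor\<close>.\<close>

proposition local_borcherds:
  assumes c: "c \<noteq> 0"
  shows "E1 (\<lambda>M K. xp c u M p (xp c v K q w)) m n k - E2 (\<lambda>M K. xp c v K q (xp c u M p w)) m n k =
    T3 (X3 c u v w) n m p k q"
proof -
  define A where "A p q = (\<lambda>M K. xp c u M p (xp c v K q w))" for p q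
  define B where "B p q = (\<lambda>M K. xp c v K q (xp c u M p w))" for p q
  define D where "D m p k q = E1 (A p q) m n k - E2 (B p q) m n k - T3 (X3 c u v w) n m p k q" for m p k q
  obtain R where R: "\<And>r a b. r \<ge> R \<Longrightarrow> X3 c u v w r a b = 0" using X3_trunc by blast
  have fA: "fin1 (A p q)" and fB: "fin2 (B p q)" for p q
    unfolding A_def B_def by (rule fin1_xp fin2_xp clinear_xp)+
  have recA1: "E1 (A (p + 1) q) m n k = E1 (A p q) (m + 1) n k + c *\<^sub>C E1 (A p q) m n k" for m p k q
    by (rule E1_step1[OF fA fA]) (simp add: A_def xp_rec[OF c])
  have recA2: "E1 (A p (q + 1)) m n k = E1 (A p q) m n (k + 1) + c *\<^sub>C E1 (A p q) m n k" for m p k q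
    by (rule E1_step2[OF fA fA]) (simp add: A_def xp_rec[OF c] clinear_add[OF clinear_xp] clinear_scale[OF clinear_xp])
  have recB1: "E2 (B (p + 1) q) m n k = E2 (B p q) (m + 1) n k + c *\<^sub>C E2 (B p q) m n k" for m p k q
    by (rule E2_step1[OF fB]) (simp add: B_def xp_rec[OF c] clinear_add[OF clinear_xp] clinear_scale[OF clinear_xp])
  have recB2: "E2 (B p (q + 1)) m n k = E2 (B p q) m n (k + 1) + c *\<^sub>C E2 (B p q) m n k" for m p k q
    by (rule E2_step2[OF fB]) (simp add: B_def xp_rec[OF c])
  obtain NT where NT: "\<And>m k p q. m + k \<ge> NT \<Longrightarrow> T3 (X3 c u v w) n m p k q = 0"
    using T3_X3_large by blast
  have recTp: "T3 (X3 c u v w) n m (p + 1) k q = T3 (X3 c u v w) n (m + 1) p k q + c *\<^sub>C T3 (X3 c u v w) n m p k q" for m p k q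
    by (rule T3_rec_p[of R]) (use R X3_rec[OF c] in auto)
  have recTq: "T3 (X3 c u v w) n m p k (q + 1) = T3 (X3 c u v w) n m p (k + 1) q + c *\<^sub>C T3 (X3 c u v w) n m p k q" for m p k q
    by (rule T3_rec_q[of R]) (use R X3_rec[OF c] in auto)
  have step1: "D m p k 0 = 0" for m p k
  proof (rule rec1_zero[OF c, where f = "\<lambda>m p. D m p k 0"])
    show "D m (p + 1) k 0 = D (m + 1) p k 0 + c *\<^sub>C D m p k 0" for m p
      unfolding D_def recA1 recB1 recTp by (simp add: scale_simps algebra_simps)
    show "D m 0 k 0 = 0" for m
      using bor[of u v w m n k] unfolding D_def A_def B_def T3_def X3_def by (simp add: xp_0 bsum_0)
    show "\<exists>N. \<forall>m\<ge>N. D m p k 0 = 0" for p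
    proof -
      obtain N1 where N1: "\<forall>a\<ge>N1. \<forall>i. xp c u (a - int i) p (xp c v (k + int i) 0 w) = 0"
        using xp_xp_large by blast
      obtain N2 where N2: "\<forall>a\<ge>N2. \<forall>b. xp c u a b w = 0" using xp_trunc by blast
      have "D m p k 0 = 0" if "m \<ge> max (N1 - n) (max N2 (NT - k))" for m
      proof -
        have "E1 (A p 0) m n k = 0" by (rule E1_zero) (use N1 that in \<open>simp add: A_def\<close>)
        moreover have "E2 (B p 0) m n k = 0" by (rule E2_zero) (use N2 that in \<open>simp add: B_def xp_zero\<close>)
        ultimately show ?thesis using NT that by (simp add: D_def)
      qed
      then show ?thesis by blast
    qed
  qed
  have "D m p k q = 0"
  proof (rule rec1_zero[OF c, where f = "\<lambda>k q. D m p k q"])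
    show "D m p k (q + 1) = D m p (k + 1) q + c *\<^sub>C D m p k q" for k q
      unfolding D_def recA2 recB2 recTq by (simp add: scale_simps algebra_simps)
    show "D m p k 0 = 0" for k by (rule step1)
    show "\<exists>N. \<forall>k\<ge>N. D m p k q = 0" for q
    proof -
      obtain N1 where N1: "\<forall>a\<ge>N1. \<forall>i. xp c v (a - int i) q (xp c u (m + int i) p w) = 0"
        using xp_xp_large by blast
      obtain N2 where N2: "\<forall>a\<ge>N2. \<forall>b. xp c v a b w = 0" using xp_trunc by blast
      have "D m p k q = 0" if "k \<ge> max (N1 - n) (max N2 (NT - m))" for k
      proof -
        have "E2 (B p q) m n k = 0" by (rule E2_zero) (use N1 that in \<open>simp add: B_def\<close>)
        moreover have "E1 (A p q) m n k = 0" by (rule E1_zero) (use N2 that in \<open>simp add: A_def xp_zero\<close>)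
        ultimately show ?thesis using NT that by (simp add: D_def)
      qed
      then show ?thesis by blast
    qed
  qed
  then show ?thesis by (simp add: D_def A_def B_def)
qed

end

section \<open>Two commuting module structures, placed at \<open>0\<close> and \<open>z\<close>\<close>

definition rec4 :: "complex \<Rightarrow> (int \<Rightarrow> int \<Rightarrow> int \<Rightarrow> int \<Rightarrow> 'x::complex_vector) \<Rightarrow> bool" where
  "rec4 c g \<longleftrightarrow>
     (\<forall>M P K Q. g M (P + 1) K Q = g (M + 1) P K Q + c *\<^sub>C g M P K Q) \<and>
     (\<forall>M P K Q. g M P K (Q + 1) = g M P (K + 1) Q + c *\<^sub>C g M P K Q)"

text \<open>The exponents \<open>m n k p q\<close> belong to y1, y1 - y2, y2, y1 + c, y2 + c; the
  clauses are the linear relations among these factors. In use, \<open>c\<close> is -z.\<close>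

definition rec5 :: "complex \<Rightarrow> (int \<Rightarrow> int \<Rightarrow> int \<Rightarrow> int \<Rightarrow> int \<Rightarrow> 'x::complex_vector) \<Rightarrow> bool" where
  "rec5 c D \<longleftrightarrow>
     (\<forall>m n k p q. D m (n + 1) k p q = D (m + 1) n k p q - D m n (k + 1) p q) \<and>
     (\<forall>m n k p q. D m n k (p + 1) q = D (m + 1) n k p q + c *\<^sub>C D m n k p q) \<and>
     (\<forall>m n k p q. D m n k p (q + 1) = D m n (k + 1) p q + c *\<^sub>C D m n k p q)"

lemma
  assumes "rec5 c D"
  shows rec5_n: "D m (n + 1) k p q = D (m + 1) n k p q - D m n (k + 1) p q"
    and rec5_p: "D m n k (p + 1) q = D (m + 1) n k p q + c *\<^sub>C D m n k p q"
    and rec5_q: "D m n k p (q + 1) = D m n (k + 1) p q + c *\<^sub>C D m n k p q"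
  using assms unfolding rec5_def by blast+

lemmas rec5_rules = rec5_n rec5_p rec5_q

text \<open>The region where factors in y1 have been traded for factors in y2. Every expansion
  compared below vanishes there, though for different reasons.\<close>

definition deep :: "(int \<Rightarrow> int \<Rightarrow> int \<Rightarrow> int \<Rightarrow> int \<Rightarrow> 'x::complex_vector) \<Rightarrow> bool" where
  "deep D \<longleftrightarrow> (\<forall>n. \<exists>N. \<forall>m k p q. k \<ge> N \<and> q \<ge> N \<and> m \<le> - N \<and> p \<le> - N \<longrightarrow> D m n k p q = 0)"

text \<open>If the identity \<open>D = 0\<close> holds with \<open>y\<^sub>1 - y\<^sub>2\<close> to the power \<open>n + 1\<close>, then \<open>D\<close> at the power \<open>n\<close> does
  not change when factors of the test function are moved from \<open>y\<^sub>1\<close> to \<open>y\<^sub>2\<close>; moving enough of them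
  reaches the region where \<open>D\<close> vanishes.\<close>

lemma rec5_zero:
  assumes D: "rec5 c D" and base: "\<And>m k p q. D m 0 k p q = 0" and deep: "deep D"
  shows "D m n k p q = 0"
proof -
  have rn: "D m (n + 1) k p q = D (m + 1) n k p q - D m n (k + 1) p q"
    and rp: "D m n k (p + 1) q = D (m + 1) n k p q + c *\<^sub>C D m n k p q"
    and rq: "D m n k p (q + 1) = D m n (k + 1) p q + c *\<^sub>C D m n k p q" for m n k p q
    by (rule rec5_rules[OF D])+
  have "\<forall>m k p q. D m n k p q = 0"
  proof (induction n rule: int_induct[where k = 0])
    case base
    then show ?case using assms(2) by blast
  next
    case (step1 n)
    then show ?case by (simp add: rn)
  next
    case (step2 n)
    have a: "D (m + 1) (n - 1) k p q = D m (n - 1) (k + 1) p q" for m k p q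
      using rn[of m "n - 1" k p q] step2 by simp
    have b: "D m (n - 1) k (p + 1) q = D m (n - 1) k p (q + 1)" for m k p q
      unfolding rp rq a ..
    have c: "D m (n - 1) k p q = D (m - int t) (n - 1) (k + int t) (p - int t) (q + int t)" for m k p q t
    proof (induction t)
      case (Suc t)
      show ?case
        using Suc a[of "m - int t - 1" "k + int t" "p - int t" "q + int t"]
          b[of "m - int t - 1" "k + int t + 1" "p - int t - 1" "q + int t"]
        by (simp add: algebra_simps)
    qed simp
    from deep[unfolded deep_def, THEN spec, of "n - 1"] obtain N
      where N: "\<forall>m k p q. k \<ge> N \<and> q \<ge> N \<and> m \<le> - N \<and> p \<le> - N \<longrightarrow> D m (n - 1) k p q = 0" ..
    show ?case
    proof (intro allI)
      fix m k p q
      define t where "t = nat (\<bar>N\<bar> + \<bar>m\<bar> + \<bar>k\<bar> + \<bar>p\<bar> + \<bar>q\<bar>)"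
      show "D m (n - 1) k p q = 0"
        unfolding c[of m k p q t] by (rule N[rule_format], simp add: t_def, intro conjI; linarith)
    qed
  qed
  then show ?thesis by blast
qed

text \<open>The means of identifying two expansions of (y1 - y2)^n: they are compared at n = 0,
  where nothing is expanded.\<close>

lemma rec5_unique:
  assumes D: "rec5 c D" "deep D" and D': "rec5 c D'" "deep D'"
    and base: "\<And>m k p q. D m 0 k p q = D' m 0 k p q"
  shows "D m n k p q = D' m n k p q"
proof -
  have "rec5 c (\<lambda>m n k p q. D m n k p q - D' m n k p q)"
    unfolding rec5_def rec5_rules[OF D(1)] rec5_rules[OF D'(1)] by (simp add: scale_simps algebra_simps)
  moreover have "deep (\<lambda>m n k p q. D m n k p q - D' m n k p q)"
    unfolding deep_def
  proof
    fix n
    from D(2)[unfolded deep_def, THEN spec, of "n"] obtain N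
      where N: "\<forall>m k p q. k \<ge> N \<and> q \<ge> N \<and> m \<le> - N \<and> p \<le> - N \<longrightarrow> D m n k p q = 0" ..
    from D'(2)[unfolded deep_def, THEN spec, of "n"] obtain N'
      where N': "\<forall>m k p q. k \<ge> N' \<and> q \<ge> N' \<and> m \<le> - N' \<and> p \<le> - N' \<longrightarrow> D' m n k p q = 0" ..
    show "\<exists>N. \<forall>m k p q. k \<ge> N \<and> q \<ge> N \<and> m \<le> - N \<and> p \<le> - N \<longrightarrow> D m n k p q - D' m n k p q = 0"
      by (rule exI[of _ "max N N'"]) (auto simp: N N' minus_max_eq_min)
  qed
  moreover have "D m 0 k p q - D' m 0 k p q = 0" for m k p q
    unfolding base by (rule diff_self)
  ultimately have "D m n k p q - D' m n k p q = 0"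
    using rec5_zero[of c "\<lambda>m n k p q. D m n k p q - D' m n k p q"] by metis
  then show ?thesis by (rule eq_iff_diff_eq_0[THEN iffD2])
qed

text \<open>\<open>mk\<close> expands y1 - y2 in powers of y1 and y2, that is around 0;
  \<open>pq\<close> reads it as (y1 - z) - (y2 - z) and expands around z.\<close>

definition E1mk :: "(int \<Rightarrow> int \<Rightarrow> int \<Rightarrow> int \<Rightarrow> 'x::complex_vector) \<Rightarrow> int \<Rightarrow> int \<Rightarrow> int \<Rightarrow> int \<Rightarrow> int \<Rightarrow> 'x" where
  "E1mk g m n k p q = E1 (\<lambda>M K. g M p K q) m n k"
definition E1pq :: "(int \<Rightarrow> int \<Rightarrow> int \<Rightarrow> int \<Rightarrow> 'x::complex_vector) \<Rightarrow> int \<Rightarrow> int \<Rightarrow> int \<Rightarrow> int \<Rightarrow> int \<Rightarrow> 'x" where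
  "E1pq g m n k p q = E1 (\<lambda>P Q. g m P k Q) p n q"
definition E2mk :: "(int \<Rightarrow> int \<Rightarrow> int \<Rightarrow> int \<Rightarrow> 'x::complex_vector) \<Rightarrow> int \<Rightarrow> int \<Rightarrow> int \<Rightarrow> int \<Rightarrow> int \<Rightarrow> 'x" where
  "E2mk g m n k p q = E2 (\<lambda>M K. g M p K q) m n k"
definition E2pq :: "(int \<Rightarrow> int \<Rightarrow> int \<Rightarrow> int \<Rightarrow> 'x::complex_vector) \<Rightarrow> int \<Rightarrow> int \<Rightarrow> int \<Rightarrow> int \<Rightarrow> int \<Rightarrow> 'x" where
  "E2pq g m n k p q = E2 (\<lambda>P Q. g m P k Q) p n q"

lemmas E4_defs = E1mk_def E1pq_def E2mk_def E2pq_def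

lemma rec5_E1mk:
  assumes g: "rec4 c g" and f: "\<And>p q. fin1 (\<lambda>M K. g M p K q)"
  shows "rec5 c (E1mk g)"
  unfolding rec5_def E1mk_def
proof (intro conjI allI)
  fix m n k p q
  show "E1 (\<lambda>M K. g M p K q) m (n + 1) k = E1 (\<lambda>M K. g M p K q) (m + 1) n k - E1 (\<lambda>M K. g M p K q) m n (k + 1)"
    by (rule E1_rec[OF f])
  show "E1 (\<lambda>M K. g M (p + 1) K q) m n k = E1 (\<lambda>M K. g M p K q) (m + 1) n k + c *\<^sub>C E1 (\<lambda>M K. g M p K q) m n k"
    by (rule E1_step1[OF f f]) (use g in \<open>simp add: rec4_def\<close>)
  show "E1 (\<lambda>M K. g M p K (q + 1)) m n k = E1 (\<lambda>M K. g M p K q) m n (k + 1) + c *\<^sub>C E1 (\<lambda>M K. g M p K q) m n k"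
    by (rule E1_step2[OF f f]) (use g in \<open>simp add: rec4_def\<close>)
qed

lemma rec5_E1pq:
  assumes g: "rec4 c g" and f: "\<And>m k. fin1 (\<lambda>P Q. g m P k Q)"
  shows "rec5 c (E1pq g)"
proof -
  have p: "E1 (\<lambda>P Q. g m P k Q) (p + 1) n q = E1 (\<lambda>P Q. g (m + 1) P k Q) p n q + c *\<^sub>C E1 (\<lambda>P Q. g m P k Q) p n q"
    for m n k p q
    unfolding E1_shift1[symmetric]
    by (rule E1_step0[OF f f]) (use g in \<open>simp add: rec4_def\<close>)
  have q: "E1 (\<lambda>P Q. g m P k Q) p n (q + 1) = E1 (\<lambda>P Q. g m P (k + 1) Q) p n q + c *\<^sub>C E1 (\<lambda>P Q. g m P k Q) p n q"
    for m n k p q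
    unfolding E1_shift2[symmetric]
    by (rule E1_step0[OF f f]) (use g in \<open>simp add: rec4_def\<close>)
  show ?thesis
    unfolding rec5_def E1pq_def E1_rec[OF f] p q by simp
qed

lemma rec4_swap: "rec4 c g \<Longrightarrow> rec4 c (\<lambda>K Q M P. g M P K Q)"
  unfolding rec4_def by blast

lemma E2mk_E1mk: "E2mk g m n k p q = (- 1) powi n *\<^sub>C E1mk (\<lambda>K Q M P. g M P K Q) k n m q p"
  and E2pq_E1pq: "E2pq g m n k p q = (- 1) powi n *\<^sub>C E1pq (\<lambda>K Q M P. g M P K Q) k n m q p"
  by (simp_all add: E4_defs E2_E1)

lemma rec5_swap: "rec5 c D \<Longrightarrow> rec5 c (\<lambda>m n k p q. (- 1) powi n *\<^sub>C D k n m q p)"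
proof -
  assume D: "rec5 c D"
  show ?thesis
    unfolding rec5_def rec5_rules[OF D] powi_m1_Suc by (simp add: scale_simps mult.commute)
qed

lemma rec5_E2mk:
  assumes "rec4 c g" and f: "\<And>p q. fin2 (\<lambda>M K. g M p K q)"
  shows "rec5 c (E2mk g)"
  using rec5_swap[OF rec5_E1mk[OF rec4_swap[OF assms(1)]]] f
  unfolding E2mk_E1mk[abs_def] fin2_fin1 by blast

lemma rec5_E2pq:
  assumes "rec4 c g" and f: "\<And>m k. fin2 (\<lambda>P Q. g m P k Q)"
  shows "rec5 c (E2pq g)"
  using rec5_swap[OF rec5_E1pq[OF rec4_swap[OF assms(1)]]] f
  unfolding E2pq_E1pq[abs_def] fin2_fin1 by blast

text \<open>Symmetry between t and t + c in \<open>X\<close>. It is wanted at the point z, where y -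
  z is the local coordinate and y the shifted one.\<close>

lemma T3_swap:
  assumes "\<And>r a b. r \<ge> R \<Longrightarrow> X r a b = 0"
  shows "T3 X n p m q k = T3 (\<lambda>r a b. X r b a) n m p k q"
  unfolding T3_def
  by (subst bsum_swap[of "nat (R - n)"]) (auto intro!: assms bsum_cong simp: algebra_simps)

lemma T3_linear:
  assumes "\<And>r a b. r \<ge> R \<Longrightarrow> X r a b = 0" "clinear f"
  shows "f (T3 X n m p k q) = T3 (\<lambda>r a b. f (X r a b)) n m p k q"
  unfolding T3_def
  by (subst bsum_linear[OF assms(2)], rule T3_ev0_outer[OF assms(1)], assumption,
      subst bsum_linear[OF assms(2)], rule T3_ev0_inner[OF assms(1)], assumption, rule refl)

lemma T3_add:
  assumes X: "\<And>r a b. r \<ge> R \<Longrightarrow> X r a b = 0" and Y: "\<And>r a b. r \<ge> R' \<Longrightarrow> Y r a b = 0"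
  shows "T3 (\<lambda>r a b. X r a b + Y r a b) n m p k q = T3 X n m p k q + T3 Y n m p k q"
proof -
  have "bsum p (\<lambda>j. X (n + int i + int j) a (b - int j) + Y (n + int i + int j) a (b - int j)) =
      bsum p (\<lambda>j. X (n + int i + int j) a (b - int j)) + bsum p (\<lambda>j. Y (n + int i + int j) a (b - int j))" for i a b
    by (rule bsum_add; rule T3_ev0_inner; fact)
  note e = this
  show ?thesis
    unfolding T3_def e by (rule bsum_add; rule T3_ev0_outer; fact)
qed

section \<open>Test functions with poles at 0 and z, acting through both structures\<close>

locale two_mod = m1: weak_mod V Y1 + m2: weak_mod V Y2
  for V :: "'v::complex_vector voa_data" and Y1 Y2 :: "('v, 'w::complex_vector) vertex_map" +
  fixes z :: complex
  assumes z: "z \<noteq> 0"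
    and comm: "md Y1 u m (md Y2 v n w) = md Y2 v n (md Y1 u m w)"
begin

text \<open>Around 0 the local coordinate is t = y, with y - z = t + (-z). Around z it is t = y - z,
  with y = t + z, so the two exponents trade places in \<open>Fz\<close>.\<close>

definition F0 :: "'v \<Rightarrow> int \<Rightarrow> int \<Rightarrow> 'w \<Rightarrow> 'w" where "F0 v m p = m2.xp (- z) v m p"
definition Fz :: "'v \<Rightarrow> int \<Rightarrow> int \<Rightarrow> 'w \<Rightarrow> 'w" where "Fz v m p = m1.xp z v p m"

text \<open>The action of \<open>v \<otimes> y\<^sup>m (y - z)\<^sup>p\<close>, with \<open>Y\<^sub>2\<close> sitting at \<open>y = 0\<close> and \<open>Y\<^sub>1\<close> at \<open>y = z\<close>.\<close>

definition F :: "'v \<Rightarrow> int \<Rightarrow> int \<Rightarrow> 'w \<Rightarrow> 'w" where "F v m p w = F0 v m p w + Fz v m p w"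

lemma clinear_F0: "clinear (F0 v m p)" and clinear_Fz: "clinear (Fz v m p)"
  and clinear_F0_vec: "clinear (\<lambda>v. F0 v m p w)" and clinear_Fz_vec: "clinear (\<lambda>v. Fz v m p w)"
  unfolding F0_def Fz_def
  by (rule m1.clinear_xp m2.clinear_xp m1.clinear_xp_vec m2.clinear_xp_vec)+

lemma clinear_F: "clinear (F v m p)" and clinear_F_vec: "clinear (\<lambda>v. F v m p w)"
  unfolding F_def
  by (rule clinearI; simp add: clinear_add[OF clinear_F0] clinear_add[OF clinear_Fz] clinear_scale[OF clinear_F0]
      clinear_scale[OF clinear_Fz] clinear_add[OF clinear_F0_vec] clinear_add[OF clinear_Fz_vec]
      clinear_scale[OF clinear_F0_vec] clinear_scale[OF clinear_Fz_vec] scaleC_add_right)+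

lemma F0_rec: "F0 v m (p + 1) w = F0 v (m + 1) p w + (- z) *\<^sub>C F0 v m p w"
  unfolding F0_def using z by (simp add: m2.xp_rec)

lemma Fz_rec: "Fz v m (p + 1) w = Fz v (m + 1) p w + (- z) *\<^sub>C Fz v m p w"
  using m1.xp_rec[OF z, of v p m w] by (simp add: Fz_def)

lemma F_rec: "F v m (p + 1) w = F v (m + 1) p w + (- z) *\<^sub>C F v m p w"
  unfolding F_def F0_rec Fz_rec by (simp add: scale_simps)

lemma F0_trunc: "\<exists>N. \<forall>m\<ge>N. \<forall>p. F0 v m p w = 0" and Fz_trunc: "\<exists>N. \<forall>p\<ge>N. \<forall>m. Fz v m p w = 0"
  unfolding F0_def Fz_def by (rule m2.xp_trunc, rule m1.xp_trunc)

lemma F0_Fz: "F0 u m p (Fz v k q w) = Fz v k q (F0 u m p w)"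
proof -
  have a: "md Y2 u n (m1.xp c v a b w) = m1.xp c v a b (md Y2 u n w)" for c n a b w
    unfolding m1.xp_def
    by (subst bsum_linear[OF m2.clinear_md])
      (auto intro!: ev0_scale m1.ev0_md simp: clinear_scale[OF m2.clinear_md] comm)
  show ?thesis
    unfolding F0_def Fz_def m2.xp_def
    by (subst bsum_linear[OF m1.clinear_xp])
      (auto intro!: ev0_scale m2.ev0_md simp: clinear_scale[OF m1.clinear_xp] a)
qed

lemma rec4_comp:
  assumes "clinear \<phi>" "\<And>M P. clinear (G M P)"
    "\<And>M P w. G M (P + 1) w = G (M + 1) P w + (- z) *\<^sub>C G M P w"
    "\<And>M P w. H M (P + 1) w = H (M + 1) P w + (- z) *\<^sub>C H M P w"
  shows "rec4 (- z) (\<lambda>M P K Q. \<phi> (G M P (H K Q w)))"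
  unfolding rec4_def
  using assms by (simp add: clinear_add[OF assms(1)] clinear_scale[OF assms(1)]
      clinear_add[OF assms(2)] clinear_scale[OF assms(2)] clinear_diff[OF assms(1)] clinear_diff[OF assms(2)])

lemma fin1_F0: "(\<And>M. clinear (f M)) \<Longrightarrow> fin1 (\<lambda>M K. f M (F0 v K q w))"
  and fin2_F0: "(\<And>K. clinear (f K)) \<Longrightarrow> fin2 (\<lambda>M K. f K (F0 v M q w))"
  unfolding F0_def by (rule m2.fin1_xp m2.fin2_xp; assumption)+

lemma fin1_Fz: "(\<And>P. clinear (f P)) \<Longrightarrow> fin1 (\<lambda>P Q. f P (Fz v k Q w))"
  and fin2_Fz: "(\<And>Q. clinear (f Q)) \<Longrightarrow> fin2 (\<lambda>P Q. f Q (Fz v k P w))"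
  unfolding Fz_def by (rule m1.fin1_xp m1.fin2_xp; assumption)+

text \<open>The functionals killing every section that vanishes at \<open>y = \<infinity>\<close> to an order depending on \<open>v\<close> only.\<close>

definition regular :: "('w \<Rightarrow> complex) \<Rightarrow> bool" where
  "regular \<phi> \<longleftrightarrow> clinear \<phi> \<and> (\<forall>v. \<exists>N. \<forall>m p w. m + p < N \<longrightarrow> \<phi> (F v m p w) = 0)"

lemma regular_clinear: "regular \<phi> \<Longrightarrow> clinear \<phi>"
  by (simp add: regular_def)

lemma clinear_id: "clinear (\<lambda>x. x)"
  by (rule clinearI) auto

text \<open>The sum ends because \<phi> kills everything of low total degree, whatever the vector
  \<open>h K\<close> is; the bound depends on \<open>u\<close> and \<open>p\<close> only.\<close>

lemma fin1_regular: "regular \<phi> \<Longrightarrow> fin1 (\<lambda>M K. \<phi> (F u M p (h K)))"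
  and fin2_regular: "regular \<phi> \<Longrightarrow> fin2 (\<lambda>M K. \<phi> (F u K p (h M)))"
proof -
  assume "regular \<phi>"
  then obtain N where N: "\<And>m p w. m + p < N \<Longrightarrow> \<phi> (F u m p w) = 0" unfolding regular_def by blast
  have *: "ev0 (\<lambda>i. \<phi> (F u (M - int i) p (h (K + int i))))" for M K
    unfolding ev0_def by (rule exI[of _ "nat (M + p - N + 1)"]) (auto intro!: N)
  show "fin1 (\<lambda>M K. \<phi> (F u M p (h K)))" "fin2 (\<lambda>M K. \<phi> (F u K p (h M)))"
    unfolding fin1_def fin2_def using * by blast+
qed

text \<open>The factor \<open>(y\<^sub>1 - y\<^sub>2)\<^sup>n\<close> may be expanded at \<open>y\<^sub>2 = 0\<close> or at \<open>y\<^sub>2 = z\<close>.\<close>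

lemma E1_regular_Fz:
  assumes J: "regular \<phi>"
  shows "E1mk (\<lambda>M P K Q. \<phi> (F u M P (Fz v K Q w))) m n k p q = E1pq (\<lambda>M P K Q. \<phi> (F u M P (Fz v K Q w))) m n k p q"
proof (rule rec5_unique[of "- z"])
  let ?g = "\<lambda>M P K Q. \<phi> (F u M P (Fz v K Q w))"
  have lin: "clinear \<phi>" by (rule regular_clinear[OF J])
  have r: "rec4 (- z) ?g" by (rule rec4_comp[of \<phi> "F u" "Fz v", OF lin clinear_F F_rec Fz_rec])
  show "rec5 (- z) (E1mk ?g)"
    by (rule rec5_E1mk[OF r]) (rule fin1_regular[OF J])
  show "rec5 (- z) (E1pq ?g)"
    by (rule rec5_E1pq[OF r]) (rule fin1_Fz, rule clinear_compose[OF lin clinear_F])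
  obtain N where N: "\<And>m p w. m + p < N \<Longrightarrow> \<phi> (F u m p w) = 0" using J unfolding regular_def by blast
  obtain N' where N': "\<And>m p. p \<ge> N' \<Longrightarrow> Fz v m p w = 0" using Fz_trunc by blast
  show "deep (E1mk ?g)"
    unfolding deep_def
  proof
    fix n
    show "\<exists>N. \<forall>m k p q. k \<ge> N \<and> q \<ge> N \<and> m \<le> - N \<and> p \<le> - N \<longrightarrow> E1mk ?g m n k p q = 0"
      unfolding E1mk_def
      by (rule exI[of _ "\<bar>N\<bar> + \<bar>n\<bar> + 1"]) (auto intro!: E1_zero N)
  qed
  show "deep (E1pq ?g)"
    unfolding deep_def E1pq_def
    by (intro allI exI[of _ N']) (auto intro!: E1_zero simp: N' clinear_zero[OF clinear_F] clinear_zero[OF lin])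
  show "E1mk ?g m 0 k p q = E1pq ?g m 0 k p q" for m k p q
    by (simp add: E4_defs E1_0)
qed

lemma E2_regular_Fz:
  assumes J: "regular \<phi>"
  shows "E2mk (\<lambda>M P K Q. \<phi> (F v K Q (Fz u M P w))) m n k p q = E2pq (\<lambda>M P K Q. \<phi> (F v K Q (Fz u M P w))) m n k p q"
  unfolding E2mk_E1mk E2pq_E1pq E1_regular_Fz[OF J] ..

text \<open>With y1 near 0 and y2 near z the difference y1 - y2 is invertible, so its powers have
  Taylor expansions in y2 - z and in y1 alike. \<open>E1_E2_Fz_F0\<close> is the mirror
  case.\<close>

lemma E1_E2_F0_Fz:
  assumes lin: "clinear \<phi>"
  shows "E1pq (\<lambda>M P K Q. \<phi> (F0 u M P (Fz v K Q w))) m n k p q = E2mk (\<lambda>M P K Q. \<phi> (F0 u M P (Fz v K Q w))) m n k p q"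
proof (rule rec5_unique[of "- z"])
  let ?g = "\<lambda>M P K Q. \<phi> (F0 u M P (Fz v K Q w))"
  have r: "rec4 (- z) ?g" by (rule rec4_comp[of \<phi> "F0 u" "Fz v", OF lin clinear_F0 F0_rec Fz_rec])
  show "rec5 (- z) (E1pq ?g)"
    by (rule rec5_E1pq[OF r]) (rule fin1_Fz, rule clinear_compose[OF lin clinear_F0])
  show "rec5 (- z) (E2mk ?g)"
    by (rule rec5_E2mk[OF r]) (unfold F0_Fz, rule fin2_F0, rule clinear_compose[OF lin clinear_Fz])
  obtain N where N: "\<And>m p. p \<ge> N \<Longrightarrow> Fz v m p w = 0" using Fz_trunc by blast
  show "deep (E1pq ?g)"
    unfolding deep_def E1pq_def
    by (intro allI exI[of _ N]) (auto intro!: E1_zero simp: N clinear_zero[OF clinear_F0] clinear_zero[OF lin])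
  show "deep (E2mk ?g)"
    unfolding deep_def E2mk_def
    by (intro allI exI[of _ N]) (auto intro!: E2_zero simp: N clinear_zero[OF clinear_F0] clinear_zero[OF lin])
  show "E1pq ?g m 0 k p q = E2mk ?g m 0 k p q" for m k p q
    by (simp add: E4_defs E1_0 E2_0)
qed

lemma E1_E2_Fz_F0:
  assumes lin: "clinear \<phi>"
  shows "E1mk (\<lambda>M P K Q. \<phi> (Fz u M P (F0 v K Q w))) m n k p q = E2pq (\<lambda>M P K Q. \<phi> (Fz u M P (F0 v K Q w))) m n k p q"
proof (rule rec5_unique[of "- z"])
  let ?g = "\<lambda>M P K Q. \<phi> (Fz u M P (F0 v K Q w))"
  have r: "rec4 (- z) ?g" by (rule rec4_comp[of \<phi> "Fz u" "F0 v", OF lin clinear_Fz Fz_rec F0_rec])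
  show "rec5 (- z) (E1mk ?g)"
    by (rule rec5_E1mk[OF r]) (rule fin1_F0, rule clinear_compose[OF lin clinear_Fz])
  show "rec5 (- z) (E2pq ?g)"
    by (rule rec5_E2pq[OF r]) (unfold F0_Fz[symmetric], rule fin2_Fz, rule clinear_compose[OF lin clinear_F0])
  obtain N where N: "\<And>m p. m \<ge> N \<Longrightarrow> F0 v m p w = 0" using F0_trunc by blast
  show "deep (E1mk ?g)"
    unfolding deep_def E1mk_def
    by (intro allI exI[of _ N]) (auto intro!: E1_zero simp: N clinear_zero[OF clinear_Fz] clinear_zero[OF lin])
  show "deep (E2pq ?g)"
    unfolding deep_def E2pq_def
    by (intro allI exI[of _ N]) (auto intro!: E2_zero simp: N clinear_zero[OF clinear_Fz] clinear_zero[OF lin])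
  show "E1mk ?g m 0 k p q = E2pq ?g m 0 k p q" for m k p q
    by (simp add: E4_defs E1_0 E2_0)
qed

definition FT :: "'v \<Rightarrow> 'v \<Rightarrow> 'w \<Rightarrow> int \<Rightarrow> int \<Rightarrow> int \<Rightarrow> 'w" where
  "FT u v w r a b = F (md (vop V) u r v) a b w"

lemma FT_trunc: "\<exists>R. \<forall>r\<ge>R. \<forall>a b. FT u v w r a b = 0"
proof -
  obtain R where "\<forall>r\<ge>R. md (vop V) u r v = 0" using m1.md_trunc_V by blast
  then show ?thesis unfolding FT_def by (intro exI[of _ R]) (simp add: clinear_zero[OF clinear_F_vec])
qed

lemma FT_split:
  "T3 (FT u v w) n m p k q = T3 (m2.X3 (- z) u v w) n m p k q + T3 (m1.X3 z u v w) n p m q k"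
proof -
  obtain R1 where R1: "\<And>r a b. r \<ge> R1 \<Longrightarrow> m1.X3 z u v w r a b = 0" using m1.X3_trunc by blast
  obtain R2 where R2: "\<And>r a b. r \<ge> R2 \<Longrightarrow> m2.X3 (- z) u v w r a b = 0" using m2.X3_trunc by blast
  have "FT u v w = (\<lambda>r a b. m2.X3 (- z) u v w r a b + m1.X3 z u v w r b a)"
    by (simp add: FT_def F_def F0_def Fz_def m1.X3_def m2.X3_def fun_eq_iff)
  then show ?thesis
    using T3_add[of R2 "m2.X3 (- z) u v w" R1 "\<lambda>r a b. m1.X3 z u v w r b a"] R1 R2
    by (simp add: T3_swap[of R1 "m1.X3 z u v w"])
qed

lemma local_F0:
  "E1mk (\<lambda>M P K Q. F0 u M P (F0 v K Q w)) m n k p q - E2mk (\<lambda>M P K Q. F0 v K Q (F0 u M P w)) m n k p q =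
   T3 (m2.X3 (- z) u v w) n m p k q"
  unfolding E4_defs F0_def by (rule m2.local_borcherds) (use z in simp)

lemma local_Fz:
  "E1pq (\<lambda>M P K Q. Fz u M P (Fz v K Q w)) m n k p q - E2pq (\<lambda>M P K Q. Fz v K Q (Fz u M P w)) m n k p q =
   T3 (m1.X3 z u v w) n p m q k"
  unfolding E4_defs Fz_def by (rule m1.local_borcherds) (use z in simp)

text \<open>At n = 0 nothing is expanded, so the formula holds for the vectors themselves; the cross
  terms cancel because the two structures commute.\<close>

lemma commutator_F: "F u m p (F v k q w) - F v k q (F u m p w) = T3 (FT u v w) 0 m p k q"
  using local_F0[of u v w m 0 k p q] local_Fz[of u v w m 0 k p q]
  unfolding FT_split E4_defs E1_0 E2_0
  by (simp add: F_def clinear_add[OF clinear_F0] clinear_add[OF clinear_Fz] F0_Fz algebra_simps)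

text \<open>Each \<open>F\<close> is split into its parts at 0 and at z. Parts at the same point
  satisfy the local Borcherds identity there; parts at different points cancel, since both orders
  expand (y1 - y2)^n where it has no pole. Decay of \<phi> permits the change of expansion before
  the splitting.\<close>

proposition borcherds_F:
  assumes J: "regular \<phi>"
  shows "E1mk (\<lambda>M P K Q. \<phi> (F u M P (F v K Q w))) m n k p q -
      E2mk (\<lambda>M P K Q. \<phi> (F v K Q (F u M P w))) m n k p q = \<phi> (T3 (FT u v w) n m p k q)"
proof -
  have lin: "clinear \<phi>" by (rule regular_clinear[OF J])
  note lc = clinear_compose[OF lin clinear_F0] clinear_compose[OF lin clinear_Fz]
  have "E1mk (\<lambda>M P K Q. \<phi> (F u M P (F v K Q w))) m n k p q =
      E1mk (\<lambda>M P K Q. \<phi> (F u M P (F0 v K Q w))) m n k p q + E1mk (\<lambda>M P K Q. \<phi> (F u M P (Fz v K Q w))) m n k p q"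
    unfolding E1mk_def
    by (subst E1_add[symmetric], (rule fin1_regular[OF J])+) (simp add: F_def[of v] clinear_add[OF clinear_F] clinear_add[OF lin])
  also have "E1mk (\<lambda>M P K Q. \<phi> (F u M P (F0 v K Q w))) m n k p q =
      E1mk (\<lambda>M P K Q. \<phi> (F0 u M P (F0 v K Q w))) m n k p q + E1mk (\<lambda>M P K Q. \<phi> (Fz u M P (F0 v K Q w))) m n k p q"
    unfolding E1mk_def
    by (subst E1_add[symmetric], (rule fin1_F0 lc)+) (simp add: F_def[of u] clinear_add[OF lin])
  \<comment> \<open>The expansion is moved to z while \<open>F u\<close> is still whole:
    \<open>F0 u\<close> alone has no decay that would make the expansion around 0 finite.\<close>
  also have "E1mk (\<lambda>M P K Q. \<phi> (F u M P (Fz v K Q w))) m n k p q =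
      E1pq (\<lambda>M P K Q. \<phi> (F0 u M P (Fz v K Q w))) m n k p q + E1pq (\<lambda>M P K Q. \<phi> (Fz u M P (Fz v K Q w))) m n k p q"
    unfolding E1_regular_Fz[OF J] unfolding E1pq_def
    by (subst E1_add[symmetric], (rule fin1_Fz lc)+) (simp add: F_def[of u] clinear_add[OF lin])
  finally have l: "E1mk (\<lambda>M P K Q. \<phi> (F u M P (F v K Q w))) m n k p q =
      E1mk (\<lambda>M P K Q. \<phi> (F0 u M P (F0 v K Q w))) m n k p q + E1mk (\<lambda>M P K Q. \<phi> (Fz u M P (F0 v K Q w))) m n k p q +
      (E1pq (\<lambda>M P K Q. \<phi> (F0 u M P (Fz v K Q w))) m n k p q + E1pq (\<lambda>M P K Q. \<phi> (Fz u M P (Fz v K Q w))) m n k p q)" .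
  have "E2mk (\<lambda>M P K Q. \<phi> (F v K Q (F u M P w))) m n k p q =
      E2mk (\<lambda>M P K Q. \<phi> (F v K Q (F0 u M P w))) m n k p q + E2mk (\<lambda>M P K Q. \<phi> (F v K Q (Fz u M P w))) m n k p q"
    unfolding E2mk_def
    by (subst E2_add[symmetric], (rule fin2_regular[OF J])+) (simp add: F_def[of u] clinear_add[OF clinear_F] clinear_add[OF lin])
  also have "E2mk (\<lambda>M P K Q. \<phi> (F v K Q (F0 u M P w))) m n k p q =
      E2mk (\<lambda>M P K Q. \<phi> (F0 v K Q (F0 u M P w))) m n k p q + E2mk (\<lambda>M P K Q. \<phi> (Fz v K Q (F0 u M P w))) m n k p q"
    unfolding E2mk_def
    by (subst E2_add[symmetric], (rule fin2_F0 lc)+) (simp add: F_def[of v] clinear_add[OF lin])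
  also have "E2mk (\<lambda>M P K Q. \<phi> (F v K Q (Fz u M P w))) m n k p q =
      E2pq (\<lambda>M P K Q. \<phi> (F0 v K Q (Fz u M P w))) m n k p q + E2pq (\<lambda>M P K Q. \<phi> (Fz v K Q (Fz u M P w))) m n k p q"
    unfolding E2_regular_Fz[OF J] unfolding E2pq_def
    by (subst E2_add[symmetric], (rule fin2_Fz lc)+) (simp add: F_def[of v] clinear_add[OF lin])
  finally have r: "E2mk (\<lambda>M P K Q. \<phi> (F v K Q (F u M P w))) m n k p q =
      E2mk (\<lambda>M P K Q. \<phi> (F0 v K Q (F0 u M P w))) m n k p q + E2mk (\<lambda>M P K Q. \<phi> (Fz v K Q (F0 u M P w))) m n k p q +
      (E2pq (\<lambda>M P K Q. \<phi> (F0 v K Q (Fz u M P w))) m n k p q + E2pq (\<lambda>M P K Q. \<phi> (Fz v K Q (Fz u M P w))) m n k p q)" .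
  have b1: "E1pq (\<lambda>M P K Q. \<phi> (F0 u M P (Fz v K Q w))) m n k p q = E2mk (\<lambda>M P K Q. \<phi> (Fz v K Q (F0 u M P w))) m n k p q"
    unfolding E1_E2_F0_Fz[OF lin] unfolding F0_Fz ..
  have b2: "E1mk (\<lambda>M P K Q. \<phi> (Fz u M P (F0 v K Q w))) m n k p q = E2pq (\<lambda>M P K Q. \<phi> (F0 v K Q (Fz u M P w))) m n k p q"
    unfolding E1_E2_Fz_F0[OF lin] unfolding F0_Fz ..
  have c0: "E1mk (\<lambda>M P K Q. \<phi> (F0 u M P (F0 v K Q w))) m n k p q - E2mk (\<lambda>M P K Q. \<phi> (F0 v K Q (F0 u M P w))) m n k p q =
      \<phi> (T3 (m2.X3 (- z) u v w) n m p k q)"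
    unfolding local_F0[symmetric] clinear_diff[OF lin] unfolding E4_defs
    by (subst E1_linear[OF lin], rule fin1_F0, rule clinear_F0,
        subst E2_linear[OF lin], rule fin2_F0, rule clinear_F0, rule refl)
  have cz: "E1pq (\<lambda>M P K Q. \<phi> (Fz u M P (Fz v K Q w))) m n k p q - E2pq (\<lambda>M P K Q. \<phi> (Fz v K Q (Fz u M P w))) m n k p q =
      \<phi> (T3 (m1.X3 z u v w) n p m q k)"
    unfolding local_Fz[symmetric] clinear_diff[OF lin] unfolding E4_defs
    by (subst E1_linear[OF lin], rule fin1_Fz, rule clinear_Fz,
        subst E2_linear[OF lin], rule fin2_Fz, rule clinear_Fz, rule refl)
  show ?thesis
    unfolding l r FT_split clinear_add[OF lin] c0[symmetric] cz[symmetric] b1 b2 by simp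
qed

lemma borcherds_F_0:
  assumes J: "regular \<phi>"
  shows "E1 (\<lambda>M K. \<phi> (F u M 0 (F v K 0 w))) m n k - E2 (\<lambda>M K. \<phi> (F v K 0 (F u M 0 w))) m n k =
      bsum m (\<lambda>i. \<phi> (F (md (vop V) u (n + int i) v) (m + k - int i) 0 w))"
proof -
  obtain R where R: "\<And>r a b. r \<ge> R \<Longrightarrow> FT u v w r a b = 0" using FT_trunc by blast
  have "\<phi> (T3 (FT u v w) n m 0 k 0) = T3 (\<lambda>r a b. \<phi> (FT u v w r a b)) n m 0 k 0"
    by (rule T3_linear[of R "FT u v w" \<phi>]) (auto intro: R regular_clinear[OF J])
  also have "\<dots> = bsum m (\<lambda>i. \<phi> (F (md (vop V) u (n + int i) v) (m + k - int i) 0 w))"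
    by (simp add: T3_def bsum_0 FT_def)
  finally show ?thesis
    using borcherds_F[OF J, of u v w m n k 0 0] unfolding E4_defs by simp
qed

text \<open>The commutator formula moves \<open>F v k q\<close> to the outside, where \<phi> kills
  it for low k + q independently of the vector; the correction involves only finitely many modes of
  u on v, each with its own bound.\<close>

lemma regular_F:
  assumes J: "regular \<phi>"
  shows "regular (\<lambda>w. \<phi> (F u m p w))"
  unfolding regular_def
proof (intro conjI allI)
  have lin: "clinear \<phi>" by (rule regular_clinear[OF J])
  show "clinear (\<lambda>w. \<phi> (F u m p w))" by (rule clinear_compose[OF lin clinear_F])
  fix v
  obtain N where N: "\<And>m p w. m + p < N \<Longrightarrow> \<phi> (F v m p w) = 0" using J unfolding regular_def by blast
  obtain R where R: "\<And>r. r \<ge> R \<Longrightarrow> md (vop V) u r v = 0" using m1.md_trunc_V by blast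
  \<comment> \<open>The bounds are negated so as to be closed upwards, the form that
    \<open>uniform_bound_nat\<close> handles.\<close>
  have "\<exists>N'. \<forall>a\<ge>N'. \<forall>m p w. m + p \<le> - a \<longrightarrow> \<phi> (F (md (vop V) u (int i) v) m p w) = 0" for i
  proof -
    obtain N' where "\<And>m p w. m + p < N' \<Longrightarrow> \<phi> (F (md (vop V) u (int i) v) m p w) = 0" using J unfolding regular_def by blast
    then show ?thesis by (intro exI[of _ "1 - N'"]) auto
  qed
  then obtain N' where N': "\<And>i a m p w. i < nat R \<Longrightarrow> a \<ge> N' \<Longrightarrow> m + p \<le> - a \<Longrightarrow> \<phi> (F (md (vop V) u (int i) v) m p w) = 0"
    using uniform_bound_nat[of "\<lambda>i a. \<forall>m p w. m + p \<le> - a \<longrightarrow> \<phi> (F (md (vop V) u (int i) v) m p w) = 0" "nat R"] by blast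
  \<comment> \<open>Every term of the commutator sum has total exponent at most m + p + k + q, hence
    at most -N'.\<close>
  have "\<phi> (F u m p (F v k q w)) = 0" if kq: "k + q < min N (- N' - m - p)" for k q w
  proof -
    have X: "\<phi> (FT u v w (int i + int j) a b) = 0" if "a + b \<le> - N'" for i j a b
    proof (cases "i + j < nat R")
      case True
      then show ?thesis using N'[of "i + j" N' a b w] that by (simp add: FT_def)
    next
      case False
      then have "md (vop V) u (int i + int j) v = 0" by (intro R) linarith
      then show ?thesis by (simp add: FT_def clinear_zero[OF clinear_F_vec] clinear_zero[OF lin])
    qed
    obtain R' where R': "\<And>r a b. r \<ge> R' \<Longrightarrow> FT u v w r a b = 0" using FT_trunc by blast
    have "\<phi> (T3 (FT u v w) 0 m p k q) = T3 (\<lambda>r a b. \<phi> (FT u v w r a b)) 0 m p k q"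
      by (rule T3_linear[of R' "FT u v w" \<phi>]) (auto intro: R' lin)
    also have "\<dots> = 0"
      unfolding T3_def using kq by (intro bsum_zero) (simp add: X)
    finally have "\<phi> (T3 (FT u v w) 0 m p k q) = 0" .
    moreover have "\<phi> (F v k q (F u m p w)) = 0" using N kq by simp
    ultimately show ?thesis
      using commutator_F[of u m p v k q w] by (metis clinear_diff[OF lin] diff_zero)
  qed
  then show "\<exists>N. \<forall>k q w. k + q < N \<longrightarrow> \<phi> (F u m p (F v k q w)) = 0" by blast
qed

end

section \<open>Direct sums and divided powers\<close>

lemma finite_Sum_any_clinear: "clinear f \<Longrightarrow> finite {i. g i \<noteq> 0} \<Longrightarrow> finite {i. f (g i) \<noteq> 0}"
  by (erule rev_finite_subset) (auto simp: clinear_zero)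

lemma component_eq:
  assumes "direct_sum UNIV U" "is_decomposition U w f"
  shows "component U i w = f i"
proof -
  have "\<exists>!f. is_decomposition U w f" using assms(1) unfolding direct_sum_def by blast
  then have "(THE f. is_decomposition U w f) = f" using assms(2) by (blast intro: the1_equality)
  then show ?thesis unfolding component_def by simp
qed

lemma decomposition_component:
  assumes "direct_sum UNIV U"
  shows "is_decomposition U w (\<lambda>i. component U i w)"
proof -
  obtain f where f: "is_decomposition U w f" using assms unfolding direct_sum_def by blast
  have "(\<lambda>i. component U i w) = f" using component_eq[OF assms f] by blast
  then show ?thesis using f by simp
qed

lemma component_mem: "direct_sum UNIV U \<Longrightarrow> component U i w \<in> U i"
  and component_finite: "direct_sum UNIV U \<Longrightarrow> finite {i. component U i w \<noteq> 0}"
  and component_sum: "direct_sum UNIV U \<Longrightarrow> w = Sum_any (\<lambda>i. component U i w)"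
  using decomposition_component[of U w] unfolding is_decomposition_def by blast+

lemma direct_sum_subspace: "direct_sum UNIV U \<Longrightarrow> complex_vector.subspace (U i)"
  unfolding direct_sum_def by blast

lemma component_hom:
  assumes d: "direct_sum UNIV U" and w: "w \<in> U h"
  shows "component U i w = (if i = h then w else 0)"
proof (rule component_eq[OF d])
  have "finite {i. (if i = h then w else 0) \<noteq> 0}" by (rule finite_subset[of _ "{h}"]) auto
  moreover have "w = Sum_any (\<lambda>i. if i = h then w else 0)" by (subst Sum_any_single[of h]) auto
  ultimately show "is_decomposition U w (\<lambda>i. if i = h then w else 0)"
    using w complex_vector.subspace_0[OF direct_sum_subspace[OF d]] unfolding is_decomposition_def by auto
qed

lemma clinear_component:
  assumes d: "direct_sum UNIV U"
  shows "clinear (component U i)"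
proof (rule clinearI)
  note s = direct_sum_subspace[OF d]
  fix x y c
  have "is_decomposition U (x + y) (\<lambda>i. component U i x + component U i y)"
    unfolding is_decomposition_def
  proof (intro conjI allI)
    show "component U i x + component U i y \<in> U i" for i
      using complex_vector.subspace_add[OF s] component_mem[OF d] by blast
    show "finite {i. component U i x + component U i y \<noteq> 0}"
      by (rule finite_subset[OF _ finite_UnI[OF component_finite[OF d, of x] component_finite[OF d, of y]]]) auto
    show "x + y = (\<Sum>i. component U i x + component U i y)"
      by (subst Sum_any.distrib[OF component_finite[OF d] component_finite[OF d]])
        (simp add: component_sum[OF d, symmetric])
  qed
  then show "component U i (x + y) = component U i x + component U i y" by (rule component_eq[OF d])
  have "is_decomposition U (c *\<^sub>C x) (\<lambda>i. c *\<^sub>C component U i x)"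
    unfolding is_decomposition_def
  proof (intro conjI allI)
    show "c *\<^sub>C component U i x \<in> U i" for i
      using complex_vector.subspace_scale[OF s] component_mem[OF d] by blast
    show "finite {i. c *\<^sub>C component U i x \<noteq> 0}"
      by (rule finite_subset[OF _ component_finite[OF d, of x]]) auto
    show "c *\<^sub>C x = (\<Sum>i. c *\<^sub>C component U i x)"
      by (subst clinear_Sum_any[OF clinear_scaleC component_finite[OF d], symmetric])
        (simp add: component_sum[OF d, symmetric])
  qed
  then show "component U i (c *\<^sub>C x) = c *\<^sub>C component U i x" by (rule component_eq[OF d])
qed

lemma hom_induct:
  assumes d: "direct_sum UNIV U"
    and hom: "\<And>h v. v \<in> U h \<Longrightarrow> P v" and add: "\<And>x y. P x \<Longrightarrow> P y \<Longrightarrow> P (x + y)"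
  shows "P w"
proof -
  have P0: "P 0" using hom complex_vector.subspace_0[OF direct_sum_subspace[OF d]] by blast
  have "P (\<Sum>i\<in>S. component U i w)" for S
    by (induction S rule: infinite_finite_induct) (auto intro: P0 add hom component_mem[OF d])
  then show ?thesis
    using component_sum[OF d, of w] unfolding Sum_any.expand_set by metis
qed

text \<open>Divided powers T^k / k!. In terms of them e^(c T) has the plain coefficients c^k, and
  the conjugation formulas carry only binomial coefficients.\<close>

definition dp :: "('w \<Rightarrow> 'w) \<Rightarrow> nat \<Rightarrow> 'w \<Rightarrow> 'w::complex_vector" where
  "dp T k w = (1 / fact k) *\<^sub>C (T ^^ k) w"

lemma dp_0 [simp]: "dp T 0 w = w"
  by (simp add: dp_def scaleC_one)

lemma dp_Suc: "clinear T \<Longrightarrow> T (dp T k w) = of_nat (Suc k) *\<^sub>C dp T (Suc k) w"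
  by (simp add: dp_def clinear_scale scaleC_scaleC del: of_nat_Suc)

lemma clinear_funpow: "clinear T \<Longrightarrow> clinear (T ^^ k)" for T :: "'w::complex_vector \<Rightarrow> 'w"
  by (induction k) (auto intro!: clinearI simp: clinear_add clinear_scale)

lemma clinear_dp: "clinear T \<Longrightarrow> clinear (dp T k)"
  unfolding dp_def by (intro clinearI) (simp_all add: clinear_add[OF clinear_funpow]
      clinear_scale[OF clinear_funpow] scaleC_add_right scaleC_scaleC mult.commute)

lemma dp_Suc': "clinear T \<Longrightarrow> dp T k (T w) = of_nat (Suc k) *\<^sub>C dp T (Suc k) w"
  by (simp add: dp_def clinear_scale scaleC_scaleC funpow_swap1 del: of_nat_Suc)

lemma dp_Suc_eq: "clinear T \<Longrightarrow> dp T (Suc k) w = (1 / of_nat (Suc k)) *\<^sub>C T (dp T k w)"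
  by (simp add: dp_Suc scaleC_scaleC scaleC_one del: of_nat_Suc)

lemma dp_dp: "clinear T \<Longrightarrow> dp T j (dp T k w) = of_nat ((j + k) choose j) *\<^sub>C dp T (j + k) w"
  by (simp add: dp_def clinear_scale[OF clinear_funpow] scaleC_scaleC funpow_add binomial_fact)

lemma exp_locnil_dp: "exp_locnil c T w = Sum_any (\<lambda>k. c ^ k *\<^sub>C dp T k w)"
  unfolding exp_locnil_def dp_def by (simp add: scaleC_scaleC)


section \<open>Triples with given sum\<close>

text \<open>Index set for \<open>dL_md\<close>: the \<open>K\<close> factors L(1) are shared out as
  \<open>j\<close> on the algebra vector, \<open>l\<close> on the module vector and \<open>i\<close>
  on the mode index.\<close>

definition tri :: "nat \<Rightarrow> (nat \<times> nat \<times> nat) set" where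
  "tri K = {(j, l, i). j + l + i = K}"

lemma finite_tri [simp]: "finite (tri K)"
  by (rule finite_subset[of _ "{..K} \<times> {..K} \<times> {..K}"]) (auto simp: tri_def)

lemma tri_0: "tri 0 = {(0, 0, 0)}"
  by (auto simp: tri_def)

lemma sum_tri_Suc1:
  "(\<And>l i. f (0, l, i) = 0) \<Longrightarrow> (\<Sum>(j, l, i)\<in>tri K. f (Suc j, l, i)) = (sum f (tri (Suc K)) :: 'a::comm_monoid_add)"
  by (rule sum.reindex_bij_witness_not_neutral[of "{}" "{t\<in>tri (Suc K). fst t = 0}" _
        "\<lambda>(j, l, i). (j - 1, l, i)" "\<lambda>(j, l, i). (Suc j, l, i)"])
    (auto simp: tri_def intro: finite_subset[OF _ finite_tri[of "Suc K", unfolded tri_def]])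

lemma sum_tri_Suc2:
  "(\<And>j i. f (j, 0, i) = 0) \<Longrightarrow> (\<Sum>(j, l, i)\<in>tri K. f (j, Suc l, i)) = (sum f (tri (Suc K)) :: 'a::comm_monoid_add)"
  by (rule sum.reindex_bij_witness_not_neutral[of "{}" "{t\<in>tri (Suc K). fst (snd t) = 0}" _
        "\<lambda>(j, l, i). (j, l - 1, i)" "\<lambda>(j, l, i). (j, Suc l, i)"])
    (auto simp: tri_def intro: finite_subset[OF _ finite_tri[of "Suc K", unfolded tri_def]])

lemma sum_tri_Suc3:
  "(\<And>j l. f (j, l, 0) = 0) \<Longrightarrow> (\<Sum>(j, l, i)\<in>tri K. f (j, l, Suc i)) = (sum f (tri (Suc K)) :: 'a::comm_monoid_add)"
  by (rule sum.reindex_bij_witness_not_neutral[of "{}" "{t\<in>tri (Suc K). snd (snd t) = 0}" _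
        "\<lambda>(j, l, i). (j, l, i - 1)" "\<lambda>(j, l, i). (j, l, Suc i)"])
    (auto simp: tri_def intro: finite_subset[OF _ finite_tri[of "Suc K", unfolded tri_def]])


section \<open>Conformal weights\<close>

locale voa =
  fixes V :: "'v::complex_vector voa_data"
  assumes voa: "vertex_operator_algebra V"
begin

lemma weak_vop: "weak_module V UNIV (vop V)"
  using voa unfolding vertex_operator_algebra_def by (elim conjE) blast

lemma vop_vac_neg: "n < 0 \<Longrightarrow> vop V v n (vac V) = 0" and vop_vac_0: "vop V v 0 (vac V) = v"
proof -
  have "\<forall>v. (\<forall>n<0. vop V v n (vac V) = 0) \<and> vop V v 0 (vac V) = v"
    using voa unfolding vertex_operator_algebra_def by (elim conjE)
  then show "n < 0 \<Longrightarrow> vop V v n (vac V) = 0" "vop V v 0 (vac V) = v" by blast+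
qed

lemma vop_derivative: "vop V (Lop V (vop V) (- 1) v) n w = of_int (n + 1) *\<^sub>C vop V v (n + 1) w"
proof -
  have "\<forall>v n w. vop V (Lop V (vop V) (- 1) v) n w = of_int (n + 1) *\<^sub>C vop V v (n + 1) w"
    using voa unfolding vertex_operator_algebra_def by (elim conjE)
  then show ?thesis by blast
qed

lemma direct_sum_weight: "direct_sum UNIV (weight_space V)"
  using voa unfolding vertex_operator_algebra_def by (elim conjE) blast

lemma weight_bounded: "\<exists>N. \<forall>n<N. weight_space V n = {0}"
  using voa unfolding vertex_operator_algebra_def by (elim conjE) blast

lemma md_m2_vac: "md (vop V) v (- 2) (vac V) = Lop V (vop V) (- 1) v"
  using vop_derivative[of v 0 "vac V"] by (simp add: md_def vop_vac_0 scaleC_one)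

abbreviation wt :: "int \<Rightarrow> 'v set" where "wt \<equiv> weight_space V"

lemma wt_iff: "v \<in> wt h \<longleftrightarrow> Lop V (vop V) 0 v = of_int h *\<^sub>C v"
  by (simp add: weight_space_def eigenspace_def)

lemmas wt_induct = hom_induct[OF direct_sum_weight, case_names hom add]

end

section \<open>Commutators of modes with L(-1), L(0) and L(1)\<close>

locale voa_mod = voa V + weak_mod V Y for V :: "'v::complex_vector voa_data" and Y :: "('v, 'w::complex_vector) vertex_map"
begin

lemma Lop_md: "Lop V Y n = md Y (conf V) (n + 1)"
  by (simp add: Lop_def md_def fun_eq_iff, metis minus_diff_commute)

lemma clinear_Lop: "clinear (Lop V Y n)"
  unfolding Lop_md by (rule clinear_md)

lemma commutator: "md Y u m (md Y v k w) - md Y v k (md Y u m w) = bsum m (\<lambda>i. md Y (md (vop V) u (int i) v) (m + k - int i) w)"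
  using bor[of u v w m 0 k] by (simp add: E1_0 E2_0)

lemma bsum_single: "(\<And>i. i \<noteq> i0 \<Longrightarrow> g i = 0) \<Longrightarrow> bsum n g = (of_int n gchoose i0) *\<^sub>C g i0"
  unfolding bsum_def by (rule Sum_any_single) simp

lemma gbinomial_m2: "((- 2 :: complex) gchoose i) * (- 1) ^ i = of_nat (Suc i)"
proof -
  have "(- 2 :: complex) gchoose i = (- 1) ^ i * ((2 + of_nat i - 1) gchoose i)" by (rule gbinomial_minus)
  also have "(2 + of_nat i - 1 :: complex) = of_nat (Suc i)" by simp
  also have "(of_nat (Suc i) gchoose i :: complex) = of_nat (Suc i)"
    by (subst binomial_gbinomial[symmetric]) simp
  finally show ?thesis by (simp add: mult.commute mult.left_commute power_mult_distrib[symmetric])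
qed

text \<open>On a module this follows from the Borcherds identity for v and the vacuum with (y1 -
  y2)^(-2), because L(-1) v = v_(-2) 1. Only the mode -1 of the vacuum is nonzero, which leaves at
  most one term of each sum.\<close>

lemma md_derivative: "md Y (Lop V (vop V) (- 1) v) k w = of_int (- k) *\<^sub>C md Y v (k - 1) w"
proof -
  have "md Y (Lop V (vop V) (- 1) v) k w =
      E1 (\<lambda>M K. md Y v M (md Y (vac V) K w)) 0 (- 2) k - E2 (\<lambda>M K. md Y (vac V) K (md Y v M w)) 0 (- 2) k"
    using bor[of v "vac V" w 0 "- 2" k] by (simp add: bsum_0 md_m2_vac)
  also have "E1 (\<lambda>M K. md Y v M (md Y (vac V) K w)) 0 (- 2) k = (if k < 0 then of_int (- k) *\<^sub>C md Y v (k - 1) w else 0)"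
  proof (cases "k < 0")
    case True
    have "E1 (\<lambda>M K. md Y v M (md Y (vac V) K w)) 0 (- 2) k =
        (of_int (- 2) gchoose nat (- 1 - k)) *\<^sub>C (- 1) ^ nat (- 1 - k) *\<^sub>C md Y v (- 2 - int (nat (- 1 - k))) (md Y (vac V) (k + int (nat (- 1 - k))) w)"
      unfolding E1_def
      by (subst bsum_single[of "nat (- 1 - k)"]) (auto simp: md_vac clinear_zero[OF clinear_md])
    also have "\<dots> = of_nat (Suc (nat (- 1 - k))) *\<^sub>C md Y v (k - 1) w"
      using True gbinomial_m2[of "nat (- 1 - k)"] by (simp add: md_vac scaleC_scaleC)
    also have "of_nat (Suc (nat (- 1 - k))) = (of_int (- k) :: complex)"
      using True by (simp add: nat_diff_distrib)
    finally show ?thesis using True by simp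
  next
    case False
    then show ?thesis
      by (subst E1_zero) (auto simp: md_vac clinear_zero[OF clinear_md])
  qed
  also have "E2 (\<lambda>M K. md Y (vac V) K (md Y v M w)) 0 (- 2) k = (if k < 0 then 0 else of_int k *\<^sub>C md Y v (k - 1) w)"
  proof (cases "k \<ge> 1")
    case True
    have "E2 (\<lambda>M K. md Y (vac V) K (md Y v M w)) 0 (- 2) k =
        (of_int (- 2) gchoose nat (k - 1)) *\<^sub>C (- 1) ^ nat (k - 1) *\<^sub>C md Y (vac V) (- 2 + k - int (nat (k - 1))) (md Y v (0 + int (nat (k - 1))) w)"
      unfolding E2_def
      by (subst bsum_single[of "nat (k - 1)"]) (auto simp: md_vac scaleC_one power_int_minus)
    also have "\<dots> = of_nat (Suc (nat (k - 1))) *\<^sub>C md Y v (k - 1) w"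
      using True gbinomial_m2[of "nat (k - 1)"] by (simp add: md_vac scaleC_scaleC)
    also have "of_nat (Suc (nat (k - 1))) = (of_int k :: complex)"
      using True by (simp add: nat_diff_distrib)
    finally show ?thesis using True by simp
  next
    case False
    then show ?thesis
      by (subst E2_zero) (auto simp: md_vac)
  qed
  finally show ?thesis by (cases "k < 0") (simp_all add: complex_vector.scale_minus_left)
qed

lemma bsum_1: "bsum 1 g = g 0 + g 1"
proof -
  have "bsum 1 g = (\<Sum>i\<in>{0,1}. (of_int 1 gchoose i) *\<^sub>C g i)"
    unfolding bsum_def
  proof (rule Sum_any.expand_superset)
    have "(of_int 1 gchoose i :: complex) = 0" if "i \<notin> {0, 1}" for i
      using that binomial_gbinomial[of 1 i, where 'a = complex] by (simp add: binomial_eq_0)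
    then show "{a. (of_int 1 gchoose a) *\<^sub>C g a \<noteq> 0} \<subseteq> {0, 1}"
      by (metis (mono_tags, lifting) mem_Collect_eq scaleC_zero(2) subsetI)
  qed simp
  then show ?thesis by (simp add: scaleC_one)
qed

lemma bsum_2: "bsum 2 g = g 0 + 2 *\<^sub>C g 1 + g 2"
proof -
  have g2: "(2 gchoose 2 :: complex) = 1"
    using binomial_gbinomial[of 2 2, where 'a = complex] by simp
  have "bsum 2 g = (\<Sum>i\<in>{0,1,2}. (of_int 2 gchoose i) *\<^sub>C g i)"
    unfolding bsum_def
  proof (rule Sum_any.expand_superset)
    have "(of_int 2 gchoose i :: complex) = 0" if "i \<notin> {0, 1, 2}" for i
      using that binomial_gbinomial[of 2 i, where 'a = complex] by (simp add: binomial_eq_0)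
    then show "{a. (of_int 2 gchoose a) *\<^sub>C g a \<noteq> 0} \<subseteq> {0, 1, 2}"
      by (metis (mono_tags, lifting) mem_Collect_eq scaleC_zero(2) subsetI)
  qed simp
  then show ?thesis by (simp add: scaleC_one g2 add.assoc)
qed

lemma conf_modes:
  "md (vop V) (conf V) 0 v = Lop V (vop V) (- 1) v" "md (vop V) (conf V) 1 v = Lop V (vop V) 0 v"
  "md (vop V) (conf V) 2 v = Lop V (vop V) 1 v"
  by (simp_all add: md_def Lop_def)

lemma commutator_L0:
  assumes "v \<in> wt h"
  shows "Lop V Y 0 (md Y v k w) = md Y v k (Lop V Y 0 w) + of_int (h - k - 1) *\<^sub>C md Y v k w"
proof -
  have "Lop V Y 0 (md Y v k w) - md Y v k (Lop V Y 0 w) = bsum 1 (\<lambda>i. md Y (md (vop V) (conf V) (int i) v) (1 + k - int i) w)"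
    unfolding Lop_md using commutator[of "conf V" 1 v k w] by simp
  also have "\<dots> = md Y (Lop V (vop V) (- 1) v) (k + 1) w + md Y (Lop V (vop V) 0 v) k w"
    unfolding bsum_1 by (simp add: conf_modes add.commute)
  also have "\<dots> = of_int (h - k - 1) *\<^sub>C md Y v k w"
    using assms unfolding wt_iff
    by (simp add: md_derivative clinear_scale[OF clinear_md_vec] scale_simps algebra_simps)
  finally show ?thesis by (simp add: algebra_simps)
qed

lemma commutator_L1:
  assumes "v \<in> wt h"
  shows "Lop V Y 1 (md Y v k w) = md Y v k (Lop V Y 1 w) + of_int (2 * h - k - 2) *\<^sub>C md Y v (k + 1) w
    + md Y (Lop V (vop V) 1 v) k w"
proof -
  have "Lop V Y 1 (md Y v k w) - md Y v k (Lop V Y 1 w) = bsum 2 (\<lambda>i. md Y (md (vop V) (conf V) (int i) v) (2 + k - int i) w)"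
    unfolding Lop_md using commutator[of "conf V" 2 v k w] by simp
  also have "\<dots> = md Y (Lop V (vop V) (- 1) v) (k + 2) w + 2 *\<^sub>C md Y (Lop V (vop V) 0 v) (k + 1) w + md Y (Lop V (vop V) 1 v) k w"
    unfolding bsum_2 by (simp add: conf_modes add.commute)
  also have "\<dots> = of_int (2 * h - k - 2) *\<^sub>C md Y v (k + 1) w + md Y (Lop V (vop V) 1 v) k w"
    using assms unfolding wt_iff
    by (simp add: md_derivative clinear_scale[OF clinear_md_vec] scale_simps algebra_simps)
  finally show ?thesis by (simp add: algebra_simps)
qed

end

context voa begin

sublocale VV: voa_mod V "vop V"
  by unfold_locales (rule weak_vop)+

abbreviation Ld :: "nat \<Rightarrow> 'v \<Rightarrow> 'v" where "Ld \<equiv> dp (Lop V (vop V) 1)"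

lemma wt_subspace: "complex_vector.subspace (wt h)"
  by (rule direct_sum_subspace[OF direct_sum_weight])

lemma wt_md: "u \<in> wt a \<Longrightarrow> v \<in> wt b \<Longrightarrow> md (vop V) u n v \<in> wt (a + b - n - 1)"
proof -
  assume u: "u \<in> wt a" and v: "v \<in> wt b"
  have "Lop V (vop V) 0 (md (vop V) u n v) = of_int b *\<^sub>C md (vop V) u n v + of_int (a - n - 1) *\<^sub>C md (vop V) u n v"
    using VV.commutator_L0[OF u, of n v] v by (simp add: wt_iff clinear_scale[OF VV.clinear_md])
  also have "\<dots> = of_int (a + b - n - 1) *\<^sub>C md (vop V) u n v"
    unfolding scaleC_add_left[symmetric] by (simp add: algebra_simps)
  finally show ?thesis unfolding wt_iff .
qed

lemma wt_L1: "v \<in> wt h \<Longrightarrow> Lop V (vop V) 1 v \<in> wt (h - 1)"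
proof -
  assume v: "v \<in> wt h"
  obtain c where c: "\<And>m n v. Lop V (vop V) m (Lop V (vop V) n v) - Lop V (vop V) n (Lop V (vop V) m v) =
        of_int (m - n) *\<^sub>C Lop V (vop V) (m + n) v +
        (if m + n = 0 then (of_int (m ^ 3 - m) / 12 * c) *\<^sub>C v else 0)"
    using voa unfolding vertex_operator_algebra_def by (elim conjE) blast
  have "Lop V (vop V) 0 (Lop V (vop V) 1 v) - Lop V (vop V) 1 (Lop V (vop V) 0 v) = - Lop V (vop V) 1 v"
    using c[of 0 1 v] by (simp add: minus1_scaleC)
  then show ?thesis
    using v unfolding wt_iff
    by (simp add: clinear_scale[OF VV.clinear_Lop] scale_simps algebra_simps)
qed

lemma wt_Ld: "v \<in> wt h \<Longrightarrow> Ld k v \<in> wt (h - int k)"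
proof (induction k)
  case (Suc k)
  then have "Lop V (vop V) 1 (Ld k v) \<in> wt (h - int (Suc k))" using wt_L1[of "Ld k v" "h - int k"] by (simp add: algebra_simps)
  then show ?case
    unfolding dp_Suc_eq[OF VV.clinear_Lop] by (rule complex_vector.subspace_scale[OF wt_subspace])
qed simp

text \<open>L(1) lowers weights by one, and the weights of V are bounded below.\<close>

lemma Ld_trunc: "\<exists>N. \<forall>k\<ge>N. Ld k v = 0"
proof (induction v rule: wt_induct)
  case (hom h v)
  obtain N where N: "\<And>n. n < N \<Longrightarrow> wt n = {0}" using weight_bounded by blast
  have "Ld k v = 0" if "k \<ge> nat (h - N + 1)" for k
    using wt_Ld[OF hom, of k] N[of "h - int k"] that by auto
  then show ?case by blast
next
  case (add x y)
  then obtain N N' where "\<forall>k\<ge>N. Ld k x = 0" "\<forall>k\<ge>N'. Ld k y = 0" by blast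
  then have "\<forall>k\<ge>max N N'. Ld k (x + y) = 0"
    by (simp add: clinear_add[OF clinear_dp[OF VV.clinear_Lop]])
  then show ?case by blast
qed

lemma L0_vac: "Lop V (vop V) 0 (vac V) = 0" and L1_vac: "Lop V (vop V) 1 (vac V) = 0"
  by (simp_all add: Lop_def vop_vac_neg)

lemma vac_wt: "vac V \<in> wt 0"
  by (simp add: wt_iff L0_vac)

lemma Ld_vac: "k > 0 \<Longrightarrow> Ld k (vac V) = 0"
proof (cases k)
  case (Suc j)
  have "Ld (Suc j) (vac V) = (1 / of_nat (Suc j)) *\<^sub>C Ld j (Lop V (vop V) 1 (vac V))"
    by (simp add: dp_Suc'[OF VV.clinear_Lop] scaleC_scaleC scaleC_one del: of_nat_Suc)
  then show ?thesis using Suc by (simp add: L1_vac clinear_zero[OF clinear_dp[OF VV.clinear_Lop]])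
qed simp

end

section \<open>Conjugation of modes by the exponential of L(1)\<close>

context voa_mod begin

abbreviation dL :: "nat \<Rightarrow> 'w \<Rightarrow> 'w" where "dL \<equiv> dp (Lop V Y 1)"

text \<open>The component form of \<open>e\<^bsup>c L(1)\<^esup> Y(u, x) = Y(e\<^bsup>c (1 - c x) L(1)\<^esup> (1 - c x)\<^bsup>-2 L(0)\<^esup> u, x / (1 - c x)) e\<^bsup>c L(1)\<^esup>\<close>.\<close>

proposition dL_md:
  assumes u: "u \<in> wt a"
  shows "dL K (md Y u n w) =
    (\<Sum>(j, l, i)\<in>tri K. (of_int (2 * a - int j - n - 2) gchoose i) *\<^sub>C md Y (Ld j u) (n + int i) (dL l w))"
proof (induction K)
  case 0
  then show ?case by (simp add: tri_0 scaleC_one)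
next
  case (Suc K)
  define X where "X j = (of_int (2 * a - int j - n - 2) :: complex)" for j :: nat
  define G where "G j l i = md Y (Ld j u) (n + int i) (dL l w)" for j l i :: nat
  have XS: "X (Suc j) + 1 = X j" for j by (simp add: X_def)
  \<comment> \<open>\<open>Ld j u\<close> has weight a - j, so \<open>commutator_L1\<close> gives
    the factor 2 (a - j) - (n + i) - 2 = X j - j - i.\<close>
  have LG: "Lop V Y 1 (G j l i) = of_nat (Suc l) *\<^sub>C G j (Suc l) i
      + (X j - of_nat j - of_nat i) *\<^sub>C G j l (Suc i) + of_nat (Suc j) *\<^sub>C G (Suc j) l i" for j l i
    unfolding G_def commutator_L1[OF wt_Ld[OF u]] dp_Suc[OF clinear_Lop] dp_Suc[OF VV.clinear_Lop]
      clinear_scale[OF clinear_md] clinear_scale[OF clinear_md_vec]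
    by (simp add: X_def algebra_simps)
  \<comment> \<open>\<open>c1\<close> is what remains of (j + l + i) (X j gchoose i) after the
    contributions raising \<open>l\<close> and \<open>j\<close> are taken away;
    \<open>c1_Suc\<close> says that the shift of the mode supplies exactly this.\<close>
  define c1 where "c1 j i = of_nat i * (X j gchoose i) - of_nat j * ((X j + 1 gchoose i) - (X j gchoose i))" for j i
  have c1_0: "c1 j 0 = 0" for j by (simp add: c1_def)
  have c1_Suc: "c1 j (Suc i) = (X j gchoose i) * (X j - of_nat j - of_nat i)" for j i
    using gbinomial_mult_1[of "X j" i] unfolding c1_def gbinomial_Suc_Suc by (simp add: algebra_simps)
  have "of_nat (Suc K) *\<^sub>C dL (Suc K) (md Y u n w) = Lop V Y 1 (dL K (md Y u n w))"
    by (rule dp_Suc[OF clinear_Lop, symmetric])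
  also have "\<dots> = (\<Sum>(j, l, i)\<in>tri K. (X j gchoose i) *\<^sub>C Lop V Y 1 (G j l i))"
    unfolding Suc X_def[symmetric] G_def[symmetric] clinear_sum[OF clinear_Lop] split_def clinear_scale[OF clinear_Lop] ..
  also have "\<dots> = (\<Sum>(j, l, i)\<in>tri K. (of_nat (Suc l) * (X j gchoose i)) *\<^sub>C G j (Suc l) i)
      + (\<Sum>(j, l, i)\<in>tri K. c1 j (Suc i) *\<^sub>C G j l (Suc i))
      + (\<Sum>(j, l, i)\<in>tri K. (of_nat (Suc j) * (X (Suc j) + 1 gchoose i)) *\<^sub>C G (Suc j) l i)"
    unfolding LG XS c1_Suc sum.distrib[symmetric] split_def
    by (intro sum.cong refl) (simp only: scaleC_add_right scaleC_scaleC mult.commute)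
  also have "(\<Sum>(j, l, i)\<in>tri K. (of_nat (Suc l) * (X j gchoose i)) *\<^sub>C G j (Suc l) i) =
      (\<Sum>(j, l, i)\<in>tri (Suc K). (of_nat l * (X j gchoose i)) *\<^sub>C G j l i)"
    using sum_tri_Suc2[of "\<lambda>(j, l, i). (of_nat l * (X j gchoose i)) *\<^sub>C G j l i" K] by simp
  also have "(\<Sum>(j, l, i)\<in>tri K. c1 j (Suc i) *\<^sub>C G j l (Suc i)) = (\<Sum>(j, l, i)\<in>tri (Suc K). c1 j i *\<^sub>C G j l i)"
    using sum_tri_Suc3[of "\<lambda>(j, l, i). c1 j i *\<^sub>C G j l i" K] by (simp add: c1_0)
  also have "(\<Sum>(j, l, i)\<in>tri K. (of_nat (Suc j) * (X (Suc j) + 1 gchoose i)) *\<^sub>C G (Suc j) l i) =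
      (\<Sum>(j, l, i)\<in>tri (Suc K). (of_nat j * (X j + 1 gchoose i)) *\<^sub>C G j l i)"
    using sum_tri_Suc1[of "\<lambda>(j, l, i). (of_nat j * (X j + 1 gchoose i)) *\<^sub>C G j l i" K] by simp
  also have "(\<Sum>(j, l, i)\<in>tri (Suc K). (of_nat l * (X j gchoose i)) *\<^sub>C G j l i)
      + (\<Sum>(j, l, i)\<in>tri (Suc K). c1 j i *\<^sub>C G j l i)
      + (\<Sum>(j, l, i)\<in>tri (Suc K). (of_nat j * (X j + 1 gchoose i)) *\<^sub>C G j l i) =
      (\<Sum>(j, l, i)\<in>tri (Suc K). of_nat (Suc K) *\<^sub>C (X j gchoose i) *\<^sub>C G j l i)"
    unfolding sum.distrib[symmetric] split_def scaleC_add_left[symmetric] scaleC_scaleC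
  proof (rule sum.cong[OF refl])
    fix t assume "t \<in> tri (Suc K)"
    then obtain j l i where t: "t = (j, l, i)" "j + l + i = Suc K" by (auto simp: tri_def)
    have "of_nat l * (X j gchoose i) + c1 j i + of_nat j * (X j + 1 gchoose i) = of_nat (j + l + i) * (X j gchoose i)"
      by (simp add: c1_def algebra_simps)
    then show "(of_nat (fst (snd t)) * (X (fst t) gchoose snd (snd t)) + c1 (fst t) (snd (snd t)) +
          of_nat (fst t) * (X (fst t) + 1 gchoose snd (snd t))) *\<^sub>C G (fst t) (fst (snd t)) (snd (snd t)) =
        (of_nat (Suc K) * (X (fst t) gchoose snd (snd t))) *\<^sub>C G (fst t) (fst (snd t)) (snd (snd t))"
      unfolding t by (simp only: fst_conv snd_conv t(2))
  qed
  also have "\<dots> = of_nat (Suc K) *\<^sub>C (\<Sum>(j, l, i)\<in>tri (Suc K). (X j gchoose i) *\<^sub>C G j l i)"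
    by (simp add: complex_vector.scale_sum_right split_def)
  finally show ?case
    unfolding X_def G_def by (simp only: complex_vector.scale_cancel_left of_nat_eq_0_iff) simp
qed

end

context voa begin

text \<open>Preparation for the iterate side of \<open>left_borcherds_hom\<close>. Each summand is
  opened by \<open>dL_md\<close>; the coefficients with equal total shift of the mode add up by
  \<open>binomial_convolution\<close>.\<close>

lemma Ld_md_binomial:
  assumes u: "u \<in> wt a"
  shows "(\<Sum>i\<le>K. ((- 1) ^ i * (of_int m gchoose i)) *\<^sub>C Ld (K - i) (md (vop V) u (n + int i) v)) =
    (\<Sum>(j, l, i)\<in>tri K. (of_int (2 * a - int j - m - n - 2) gchoose i) *\<^sub>C md (vop V) (Ld j u) (n + int i) (Ld l v))"
proof -
  define X where "X j = (of_int (2 * a - int j - n - 2) :: complex)" for j :: nat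
  define G where "G j l i = md (vop V) (Ld j u) (n + int i) (Ld l v)" for j l i :: nat
  have "(\<Sum>i\<le>K. ((- 1) ^ i * (of_int m gchoose i)) *\<^sub>C Ld (K - i) (md (vop V) u (n + int i) v)) =
      (\<Sum>i\<le>K. \<Sum>(j, l, i')\<in>tri (K - i). ((- 1) ^ i * (of_int m gchoose i) * (X j - of_nat i gchoose i')) *\<^sub>C G j l (i + i'))"
  proof (rule sum.cong[OF refl])
    fix i
    have e: "of_int (2 * a - int j - (n + int i) - 2) = X j - of_nat i" for j by (simp add: X_def)
    show "((- 1) ^ i * (of_int m gchoose i)) *\<^sub>C Ld (K - i) (md (vop V) u (n + int i) v) =
       (\<Sum>(j, l, i')\<in>tri (K - i). ((- 1) ^ i * (of_int m gchoose i) * (X j - of_nat i gchoose i')) *\<^sub>C G j l (i + i'))"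
      unfolding VV.dL_md[OF u] e G_def
      by (simp only: complex_vector.scale_sum_right split_def scaleC_scaleC add.assoc of_nat_add)
  qed
  also have "\<dots> = (\<Sum>(i, j, l, i')\<in>(SIGMA i:{..K}. tri (K - i)). ((- 1) ^ i * (of_int m gchoose i) * (X j - of_nat i gchoose i')) *\<^sub>C G j l (i + i'))"
    by (subst sum.Sigma) (auto simp: split_def)
  also have "\<dots> = (\<Sum>((j, l, I), i)\<in>(SIGMA t:tri K. {..snd (snd t)}). ((- 1) ^ i * (of_int m gchoose i) * (X j - of_nat i gchoose (I - i))) *\<^sub>C G j l I)"
    by (rule sum.reindex_bij_witness[of _ "\<lambda>((j, l, I), i). (i, j, l, I - i)" "\<lambda>(i, j, l, i'). ((j, l, i + i'), i)"])
      (auto simp: tri_def)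
  also have "\<dots> = (\<Sum>(j, l, I)\<in>tri K. \<Sum>i\<le>I. ((- 1) ^ i * (of_int m gchoose i) * (X j - of_nat i gchoose (I - i))) *\<^sub>C G j l I)"
    by (simp add: sum.Sigma split_def)
  also have "\<dots> = (\<Sum>(j, l, I)\<in>tri K. (X j - of_int m gchoose I) *\<^sub>C G j l I)"
    by (simp add: complex_vector.scale_sum_left[symmetric] binomial_convolution split_def)
  finally show ?thesis
    by (simp add: X_def G_def algebra_simps)
qed

end

section \<open>The opposite vertex operator\<close>

lemma Sum_any_iterated:
  assumes "finite J" "\<And>j i. j \<notin> J \<Longrightarrow> g j i = 0" "\<And>j. finite {i. g j i \<noteq> 0}"
  shows "Sum_any (\<lambda>j. Sum_any (\<lambda>i. g j i)) = Sum_any (\<lambda>(j, i). g j i)"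
    and "finite {t. (case t of (j, i) \<Rightarrow> g j i) \<noteq> 0}"
proof -
  have J: "{j. \<exists>i. g j i \<noteq> 0} \<subseteq> J" using assms(2) by blast
  have "{i. \<exists>j. g j i \<noteq> 0} \<subseteq> (\<Union>j\<in>J. {i. g j i \<noteq> 0})" using assms(2) by blast
  then have I: "finite {i. \<exists>j. g j i \<noteq> 0}" using assms(1,3) by (meson finite_UN finite_subset)
  note fin = finite_cartesian_product[OF finite_subset[OF J assms(1)] I]
  show "Sum_any (\<lambda>j. Sum_any (\<lambda>i. g j i)) = Sum_any (\<lambda>(j, i). g j i)"
    by (rule Sum_any.cartesian_product[OF fin]) auto
  show "finite {t. (case t of (j, i) \<Rightarrow> g j i) \<noteq> 0}"
    by (rule finite_subset[OF _ fin]) auto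
qed

lemma finite_Sum_any_cartesian:
  assumes "finite J" "\<And>j i. j \<notin> J \<Longrightarrow> g j i = 0" "\<And>j. finite {i. g j i \<noteq> 0}"
  shows "Sum_any (\<lambda>(i, j). g j i) = Sum_any (\<lambda>j. Sum_any (\<lambda>i. g j i))"
proof -
  have "Sum_any (\<lambda>(j, i). g j i) = Sum_any (\<lambda>(i, j). g j i)"
    by (rule Sum_any.reindex_cong[of "\<lambda>(i, j). (j, i)"]) (auto simp: bij_def inj_def)
  then show ?thesis using Sum_any_iterated(1)[of J g] assms by simp
qed

lemma Sum_any_group:
  fixes f :: "'a \<Rightarrow> 'b::comm_monoid_add" and d :: "'a \<Rightarrow> nat"
  assumes "finite {t. f t \<noteq> 0}" and "\<And>K. finite {t. d t = K}"
  shows "Sum_any f = Sum_any (\<lambda>K. sum f {t. d t = K})"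
proof -
  let ?A = "{t. f t \<noteq> 0}"
  have "Sum_any f = sum f ?A" by (simp add: Sum_any.expand_set)
  also have "\<dots> = (\<Sum>K\<in>d ` ?A. sum f {t \<in> ?A. d t = K})"
    by (rule sum.image_gen[OF assms(1)])
  also have "\<dots> = (\<Sum>K\<in>d ` ?A. sum f {t. d t = K})"
    by (intro sum.cong refl sum.mono_neutral_left) (auto simp: assms(2))
  also have "\<dots> = Sum_any (\<lambda>K. sum f {t. d t = K})"
  proof (rule Sum_any.expand_superset[symmetric])
    show "{K. sum f {t. d t = K} \<noteq> 0} \<subseteq> d ` ?A"
    proof
      fix K assume "K \<in> {K. sum f {t. d t = K} \<noteq> 0}"
      then obtain t where "d t = K" "f t \<noteq> 0"
        by (metis (mono_tags, lifting) mem_Collect_eq sum.neutral)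
      then show "K \<in> d ` ?A" by blast
    qed
  qed (use assms(1) in simp)
  finally show ?thesis .
qed

lemma Sum_any_tri:
  "finite {t. f t \<noteq> 0} \<Longrightarrow> Sum_any f = Sum_any (\<lambda>K. sum f (tri K))"
  using Sum_any_group[of f "\<lambda>(j, l, i). j + l + i"] finite_tri unfolding tri_def
  by (simp add: split_def)

lemma Sum_any_diagonal:
  fixes f :: "nat \<times> nat \<Rightarrow> 'b::comm_monoid_add"
  assumes "finite {t. f t \<noteq> 0}"
  shows "Sum_any f = Sum_any (\<lambda>K. \<Sum>i\<le>K. f (i, K - i))"
proof -
  have "finite {t. (\<lambda>(i, j). i + j) t = K}" for K :: nat
    by (rule finite_subset[of _ "{..K} \<times> {..K}"]) auto
  then have "Sum_any f = Sum_any (\<lambda>K. sum f {t. (\<lambda>(i, j). i + j) t = K})"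
    by (rule Sum_any_group[OF assms])
  also have "\<dots> = Sum_any (\<lambda>K. \<Sum>i\<le>K. f (i, K - i))"
  proof (rule Sum_any.cong)
    fix K show "sum f {t. (\<lambda>(i, j). i + j) t = K} = (\<Sum>i\<le>K. f (i, K - i))"
      by (rule sum.reindex_bij_witness[of _ "\<lambda>i. (i, K - i)" fst]) auto
  qed
  finally show ?thesis .
qed

lemma Sum_any_shift_nat:
  assumes "\<And>j. j + c < 0 \<Longrightarrow> f j = 0"
  shows "Sum_any f = Sum_any (\<lambda>k. f (int k - c))"
proof (rule Sum_any_reindex)
  show "inj (\<lambda>k. int k - c)" by (auto simp: inj_def)
  fix j assume j: "j \<notin> range (\<lambda>k. int k - c)"
  have "j + c < 0"
  proof (rule ccontr)
    assume "\<not> j + c < 0"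
    then have "j = int (nat (j + c)) - c" by simp
    then show False using j by blast
  qed
  then show "f j = 0" by (rule assms)
qed

context voa begin

lemma clinear_Ld: "clinear (Ld k)"
  by (rule clinear_dp[OF VV.clinear_Lop])

lemma conj_vec_component:
  "conj_vec V v m = Sum_any (\<lambda>n. if m + 2 * n \<ge> 0 then (- 1) powi n *\<^sub>C Ld (nat (m + 2 * n)) (component wt n v) else 0)"
proof -
  let ?f = "\<lambda>(n, k). if m = int k - 2 * n then ((- 1) powi n / fact k) *\<^sub>C (Lop V (vop V) 1 ^^ k) (component wt n v) else 0"
  have "conj_vec V v m = Sum_any ?f" unfolding conj_vec_def ..
  also have "\<dots> = Sum_any (\<lambda>n. ?f (n, nat (m + 2 * n)))"
  proof (rule Sum_any_reindex)
    show "inj (\<lambda>n. (n, nat (m + 2 * n)))" by (auto simp: inj_def)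
    fix e :: "int \<times> nat" assume e: "e \<notin> range (\<lambda>n. (n, nat (m + 2 * n)))"
    obtain n k where "e = (n, k)" by (cases e)
    moreover have "m \<noteq> int k - 2 * n"
    proof
      assume "m = int k - 2 * n"
      then have "e = (n, nat (m + 2 * n))" using \<open>e = (n, k)\<close> by simp
      then show False using e by blast
    qed
    ultimately show "?f e = 0" by simp
  qed
  also have "\<dots> = Sum_any (\<lambda>n. if m + 2 * n \<ge> 0 then (- 1) powi n *\<^sub>C Ld (nat (m + 2 * n)) (component wt n v) else 0)"
    by (rule Sum_any.cong) (auto simp: dp_def scaleC_scaleC)
  finally show ?thesis .
qed

lemma conj_vec_hom:
  assumes v: "v \<in> wt h"
  shows "conj_vec V v m = (if m + 2 * h \<ge> 0 then (- 1) powi h *\<^sub>C Ld (nat (m + 2 * h)) v else 0)"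
  unfolding conj_vec_component
  by (subst Sum_any_single[of h]) (auto simp: component_hom[OF direct_sum_weight v] clinear_zero[OF clinear_Ld])

lemma Sum_any_conj_hom:
  assumes v: "v \<in> wt h" and G: "\<And>j. clinear (G j)"
  shows "Sum_any (\<lambda>j. G j (conj_vec V v j)) = (- 1) powi h *\<^sub>C Sum_any (\<lambda>k. G (int k - 2 * h) (Ld k v))"
proof -
  obtain N where N: "\<forall>k\<ge>N. Ld k v = 0" using Ld_trunc by blast
  have e: "ev0 (\<lambda>k. G (int k - 2 * h) (Ld k v))"
    unfolding ev0_def by (rule exI[of _ N]) (simp add: N clinear_zero[OF G])
  have "Sum_any (\<lambda>j. G j (conj_vec V v j)) = Sum_any (\<lambda>k. G (int k - 2 * h) (conj_vec V v (int k - 2 * h)))"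
    by (rule Sum_any_shift_nat) (simp add: conj_vec_hom[OF v] clinear_zero[OF G])
  also have "\<dots> = Sum_any (\<lambda>k. (- 1) powi h *\<^sub>C G (int k - 2 * h) (Ld k v))"
    by (rule Sum_any.cong) (simp add: conj_vec_hom[OF v] clinear_scale[OF G])
  also have "\<dots> = (- 1) powi h *\<^sub>C Sum_any (\<lambda>k. G (int k - 2 * h) (Ld k v))"
    by (rule clinear_Sum_any[OF clinear_scaleC e[unfolded ev0_finite], symmetric])
  finally show ?thesis .
qed

lemma clinear_conj_vec: "clinear (\<lambda>v. conj_vec V v m)"
proof -
  define f where "f v n = (if m + 2 * n \<ge> 0 then (- 1) powi n *\<^sub>C Ld (nat (m + 2 * n)) (component wt n v) else 0)" for v n
  have lin: "clinear (\<lambda>v. f v n)" for n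
    unfolding f_def
    by (rule clinearI) (simp_all add: clinear_add[OF clinear_Ld] clinear_scale[OF clinear_Ld]
        clinear_add[OF clinear_component[OF direct_sum_weight]] clinear_scale[OF clinear_component[OF direct_sum_weight]]
        scaleC_add_right scaleC_scaleC mult.commute)
  have fin: "finite {n. f v n \<noteq> 0}" for v
    by (rule finite_subset[OF _ component_finite[OF direct_sum_weight, of v]])
      (auto simp: f_def clinear_zero[OF clinear_Ld])
  show ?thesis
  proof (rule clinearI)
    show "conj_vec V (x + y) m = conj_vec V x m + conj_vec V y m" for x y
      unfolding conj_vec_component f_def[symmetric] clinear_add[OF lin] by (rule Sum_any.distrib[OF fin fin])
    show "conj_vec V (c *\<^sub>C x) m = c *\<^sub>C conj_vec V x m" for c x
      unfolding conj_vec_component f_def[symmetric] clinear_scale[OF lin] by (rule clinear_Sum_any[OF clinear_scaleC fin, symmetric])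
  qed
qed

lemma finite_conj_vec: "finite {m. conj_vec V v m \<noteq> 0}"
proof (induction v rule: wt_induct)
  case (hom h v)
  obtain N where N: "\<And>k. k \<ge> N \<Longrightarrow> Ld k v = 0" using Ld_trunc by blast
  have "m \<in> {- 2 * h..int N - 2 * h}" if "conj_vec V v m \<noteq> 0" for m
  proof -
    have "m + 2 * h \<ge> 0" "Ld (nat (m + 2 * h)) v \<noteq> 0"
      using that by (auto simp: conj_vec_hom[OF hom] split: if_splits)
    then have "m + 2 * h \<ge> 0" "nat (m + 2 * h) < N" using N by (auto simp: not_le[symmetric])
    then show ?thesis by auto
  qed
  then have "{m. conj_vec V v m \<noteq> 0} \<subseteq> {- 2 * h..int N - 2 * h}" by blast
  then show ?case by (rule finite_subset) simp
next
  case (add x y)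
  show ?case
    by (rule finite_subset[OF _ finite_UnI[OF add]]) (auto simp: clinear_add[OF clinear_conj_vec])
qed

lemma conj_vec_vac: "conj_vec V (vac V) m = (if m = 0 then vac V else 0)"
  by (auto simp: conj_vec_hom[OF vac_wt] Ld_vac scaleC_one)

text \<open>The map \<open>v \<mapsto> e\<^bsup>x L(1)\<^esup> (-x\<^sup>-\<^sup>2)\<^bsup>L(0)\<^esup> v\<close>, followed by itself at \<open>x\<^sup>-\<^sup>1\<close>, is the identity.\<close>

lemma conj_vec_involution:
  "Sum_any (\<lambda>j. conj_vec V (conj_vec V v j) (j - s)) = (if s = 0 then v else 0)"
proof (induction v rule: wt_induct)
  case (hom h v)
  have c: "conj_vec V (conj_vec V v (int k - 2 * h)) (int k - 2 * h - s) =
      (if int k \<le> - s then ((- 1) ^ k * of_nat (nat (- s) choose k)) *\<^sub>C Ld (nat (- s)) v else 0)" for k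
  proof -
    have w: "Ld k v \<in> wt (h - int k)" by (rule wt_Ld[OF hom])
    have "(- 1 :: complex) powi h * (- 1) powi (h - int k) = (- 1) ^ k"
      by (simp add: power_int_diff power_int_minus field_simps)
    moreover have "Ld (nat (- int k - s)) (Ld k v) = of_nat (nat (- s) choose k) *\<^sub>C Ld (nat (- s)) v" if "int k \<le> - s"
    proof -
      have "nat (- int k - s) + k = nat (- s)" using that by simp
      then show ?thesis
        using that binomial_symmetric[of k "nat (- s)"] by (simp add: dp_dp[OF VV.clinear_Lop]) (metis diff_add_inverse2)
    qed
    ultimately show ?thesis
      using clinear_scale[OF clinear_conj_vec, of "(- 1) powi h"]
      by (auto simp: conj_vec_hom[OF hom] conj_vec_hom[OF w] scaleC_scaleC)
  qed
  have "Sum_any (\<lambda>j. conj_vec V (conj_vec V v j) (j - s)) =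
      Sum_any (\<lambda>k. conj_vec V (conj_vec V v (int k - 2 * h)) (int k - 2 * h - s))"
    by (rule Sum_any_shift_nat) (simp add: conj_vec_hom[OF hom] clinear_zero[OF clinear_conj_vec])
  also have "\<dots> = (\<Sum>k\<le>nat (- s). if int k \<le> - s then ((- 1) ^ k * of_nat (nat (- s) choose k)) *\<^sub>C Ld (nat (- s)) v else 0)"
    unfolding c by (rule Sum_any.expand_superset) auto
  also have "\<dots> = (if s = 0 then v else 0)"
  proof (cases "s < 0")
    case True
    then have "(\<Sum>k\<le>nat (- s). if int k \<le> - s then ((- 1) ^ k * of_nat (nat (- s) choose k)) *\<^sub>C Ld (nat (- s)) v else 0) =
       (\<Sum>k\<le>nat (- s). (- 1) ^ k * of_nat (nat (- s) choose k)) *\<^sub>C Ld (nat (- s)) v"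
      unfolding complex_vector.scale_sum_left by (intro sum.cong) auto
    also have "(\<Sum>k\<le>nat (- s). (- 1) ^ k * of_nat (nat (- s) choose k)) = (0 :: complex)"
      using True by (intro choose_alternating_sum) simp
    finally show ?thesis using True by simp
  next
    case False
    then show ?thesis by (cases "s = 0") (simp_all add: scaleC_one)
  qed
  finally show ?case .
next
  case (add x y)
  have fin: "finite {j. conj_vec V (conj_vec V v j) (j - s) \<noteq> 0}" for v
    by (rule finite_subset[OF _ finite_conj_vec[of v]]) (auto simp: clinear_zero[OF clinear_conj_vec])
  show ?case
    unfolding clinear_add[OF clinear_conj_vec] Sum_any.distrib[OF fin fin] add by simp
qed

end


section \<open>Modules for the tensor product\<close>

lemma tensor_relI: "p - q \<in> tensor_relators \<Longrightarrow> tensor_rel p q"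
  unfolding tensor_rel_def by (rule complex_vector.span_base)

lemma tprod_add_left: "(a + a') \<otimes> b = a \<otimes> b + a' \<otimes> b"
  by transfer (rule tensor_relI, unfold tensor_relators_def diff_diff_add[symmetric], blast)

lemma tprod_add_right: "a \<otimes> (b + b') = a \<otimes> b + a \<otimes> b'"
  by transfer (rule tensor_relI, unfold tensor_relators_def diff_diff_add[symmetric], blast)

lemma tprod_scale_left: "(c *\<^sub>C a) \<otimes> b = c *\<^sub>C (a \<otimes> b)"
  by transfer (rule tensor_relI, unfold tensor_relators_def, blast)

lemma tprod_scale_right: "a \<otimes> (c *\<^sub>C b) = c *\<^sub>C (a \<otimes> b)"
  by transfer (rule tensor_relI, unfold tensor_relators_def, blast)

lemma clinear_tprod1: "clinear (\<lambda>a. a \<otimes> b)" and clinear_tprod2: "clinear (\<lambda>b. a \<otimes> b)"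
  by (rule clinearI; simp add: tprod_add_left tprod_add_right tprod_scale_left tprod_scale_right)+

text \<open>The chosen representative of \<open>t\<close> is fixed, so the lift is a fixed finite
  combination of values of \<open>f x\<close>, each linear in x.\<close>

lemma tensor_lift_fun_linear:
  assumes "\<And>u v. clinear (\<lambda>x. f x u v)"
  shows "clinear (\<lambda>x. tensor_lift (f x) t)"
  unfolding tensor_lift_def free_lift_def
  by (rule clinearI) (simp_all add: clinear_add[OF assms] clinear_scale[OF assms] scaleC_add_right sum.distrib
      complex_vector.scale_sum_right scaleC_scaleC mult.commute split_def)

section \<open>Vertex operators of the tensor product on pure tensors\<close>

context voa begin

definition tvop :: "'v \<Rightarrow> 'v \<Rightarrow> int \<Rightarrow> 'v \<Rightarrow> 'v \<Rightarrow> ('v, 'v) tensor" where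
  "tvop u v n u' v' = Sum_any (\<lambda>i. vop V u i u' \<otimes> vop V v (n - i) v')"

lemma finite_tvop: "finite {i. vop V u i u' \<otimes> vop V v (n - i) v' \<noteq> 0}"
proof -
  obtain N where N: "\<And>i. i < N \<Longrightarrow> vop V u i u' = 0" using weak_vop unfolding weak_module_def by blast
  obtain N' where N': "\<And>i. i < N' \<Longrightarrow> vop V v i v' = 0" using weak_vop unfolding weak_module_def by blast
  have "i \<in> {N..n - N'}" if "vop V u i u' \<otimes> vop V v (n - i) v' \<noteq> 0" for i
  proof -
    have "vop V u i u' \<noteq> 0" "vop V v (n - i) v' \<noteq> 0"
      using that by (auto simp: clinear_zero[OF clinear_tprod1] clinear_zero[OF clinear_tprod2])
    then have "\<not> i < N" "\<not> n - i < N'" using N N' by blast+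
    then show ?thesis by auto
  qed
  then have "{i. vop V u i u' \<otimes> vop V v (n - i) v' \<noteq> 0} \<subseteq> {N..n - N'}" by blast
  then show ?thesis by (rule finite_subset) simp
qed

lemma clinear_vop: "clinear (vop V v n)" and clinear_vop_vec: "clinear (\<lambda>v. vop V v n w)"
  using VV.clinear_md[of v "- n - 1"] VV.clinear_md_vec[of "- n - 1" w] by (simp_all add: md_def)

lemma clinear_tvop:
  "clinear (\<lambda>u. tvop u v n u' v')" "clinear (\<lambda>v. tvop u v n u' v')"
  "clinear (\<lambda>u'. tvop u v n u' v')" "clinear (\<lambda>v'. tvop u v n u' v')"
  unfolding tvop_def
  by (rule clinearI; simp add: clinear_add[OF clinear_vop] clinear_add[OF clinear_vop_vec] clinear_scale[OF clinear_vop]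
      clinear_scale[OF clinear_vop_vec] tprod_add_left tprod_add_right tprod_scale_left tprod_scale_right
      Sum_any.distrib[OF finite_tvop finite_tvop] clinear_Sum_any[OF clinear_scaleC finite_tvop])+

lemma vop_tensor: "vop (tensor_voa V) (u \<otimes> v) n (u' \<otimes> v') = tvop u v n u' v'"
proof -
  have "vop (tensor_voa V) (u \<otimes> v) n (u' \<otimes> v') =
      tensor_lift (\<lambda>u v. tensor_lift (\<lambda>u' v'. tvop u v n u' v') (u' \<otimes> v')) (u \<otimes> v)"
    by (simp add: tensor_voa_def tvop_def)
  also have "\<dots> = tensor_lift (\<lambda>u' v'. tvop u v n u' v') (u' \<otimes> v')"
    by (rule tensor_lift_tprod; rule tensor_lift_fun_linear; rule clinear_tvop)
  also have "\<dots> = tvop u v n u' v'"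
    by (rule tensor_lift_tprod; rule clinear_tvop)
  finally show ?thesis .
qed

lemma vop_vac: "vop V (vac V) n w = (if n = 0 then w else 0)"
  using VV.md_vac[of "- n - 1" w] by (simp add: md_def)

lemma vop_tensor_11: "vop (tensor_voa V) (u \<otimes> vac V) n (v \<otimes> vac V) = vop V u n v \<otimes> vac V"
  unfolding vop_tensor tvop_def
  by (subst Sum_any_single[of n]) (auto simp: vop_vac clinear_zero[OF clinear_tprod2])

lemma vop_tensor_22: "vop (tensor_voa V) (vac V \<otimes> u) n (vac V \<otimes> v) = vac V \<otimes> vop V u n v"
  unfolding vop_tensor tvop_def
  by (subst Sum_any_single[of 0]) (auto simp: vop_vac clinear_zero[OF clinear_tprod1])

text \<open>Negative powers of x belong to the modes >= 0, and u_n 1 = 0 for these. So the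
  commutator formula for u \<otimes> 1 and 1 \<otimes> v has no terms: this is why the two slots
  commute.\<close>

lemma vop_tensor_12: "n < 0 \<Longrightarrow> vop (tensor_voa V) (u \<otimes> vac V) n (vac V \<otimes> v) = 0"
  unfolding vop_tensor tvop_def
  by (subst Sum_any_single[of n])
    (auto simp: vop_vac vop_vac_neg clinear_zero[OF clinear_tprod2] clinear_zero[OF clinear_tprod1])

end

locale tensor_mod = voa V for V :: "'v::complex_vector voa_data" +
  fixes YA :: "(('v, 'v) tensor, 'a::complex_vector) vertex_map"
  assumes weak_A: "weak_module (tensor_voa V) UNIV YA"
begin

lemma bor_A: "borcherds (tensor_voa V) YA s t w"
  using weak_A unfolding weak_module_def jacobi_iff_borcherds by (elim conjE) blast

lemma clinear_YA: "clinear (\<lambda>t. YA t n w)" "clinear (YA t n)"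
proof -
  have "\<forall>n. \<forall>w\<in>UNIV. clinear (\<lambda>v. YA v n w)"
    using weak_A unfolding weak_module_def by (elim conjE)
  moreover have "\<forall>v n. clinear_on UNIV (YA v n)"
    using weak_A unfolding weak_module_def by (elim conjE)
  ultimately show "clinear (\<lambda>t. YA t n w)" "clinear (YA t n)"
    by (auto intro!: clinearI simp: clinear_on_def)
qed

lemma trunc_YA: "\<exists>N. \<forall>n<N. YA t n w = 0"
  using weak_A unfolding weak_module_def by (elim conjE) blast

lemma vac_YA: "YA (vac V \<otimes> vac V) n w = (if n = 0 then w else 0)"
proof -
  have "\<forall>n. \<forall>w\<in>UNIV. YA (vac (tensor_voa V)) n w = (if n = 0 then w else 0)"
    using weak_A unfolding weak_module_def by (elim conjE)
  then show ?thesis by (simp add: tensor_voa_def)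
qed

lemma weak_slot1: "weak_module V UNIV (slot1 V YA)"
proof -
  have "borcherds V (slot1 V YA) u v w" for u v w
    using bor_A[of "u \<otimes> vac V" "v \<otimes> vac V" w]
    unfolding borcherds_def md_def slot1_def vop_tensor_11 .
  moreover have "clinear (\<lambda>v. slot1 V YA v n w)" for n w
    unfolding slot1_def by (rule clinear_compose[OF clinear_YA(1) clinear_tprod1])
  moreover have "clinear_on UNIV (slot1 V YA v n)" for v n
    unfolding slot1_def clinear_on_def by (simp add: clinear_add[OF clinear_YA(2)] clinear_scale[OF clinear_YA(2)])
  ultimately show ?thesis
    unfolding weak_module_def jacobi_iff_borcherds
    using trunc_YA vac_YA by (simp add: slot1_def)
qed

lemma weak_slot2: "weak_module V UNIV (slot2 V YA)"
proof -
  have "borcherds V (slot2 V YA) u v w" for u v w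
    using bor_A[of "vac V \<otimes> u" "vac V \<otimes> v" w]
    unfolding borcherds_def md_def slot2_def vop_tensor_22 .
  moreover have "clinear (\<lambda>v. slot2 V YA v n w)" for n w
    unfolding slot2_def by (rule clinear_compose[OF clinear_YA(1) clinear_tprod2])
  moreover have "clinear_on UNIV (slot2 V YA v n)" for v n
    unfolding slot2_def clinear_on_def by (simp add: clinear_add[OF clinear_YA(2)] clinear_scale[OF clinear_YA(2)])
  ultimately show ?thesis
    unfolding weak_module_def jacobi_iff_borcherds
    using trunc_YA vac_YA by (simp add: slot2_def)
qed

lemma slots_commute: "md (slot1 V YA) u m (md (slot2 V YA) v n w) = md (slot2 V YA) v n (md (slot1 V YA) u m w)"
proof -
  have "md (slot1 V YA) u m (md (slot2 V YA) v n w) - md (slot2 V YA) v n (md (slot1 V YA) u m w) =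
      bsum m (\<lambda>i. md YA (md (vop (tensor_voa V)) (u \<otimes> vac V) (int i) (vac V \<otimes> v)) (m + n - int i) w)"
    using bor_A[of "u \<otimes> vac V" "vac V \<otimes> v" w, unfolded borcherds_def, rule_format, of m 0 n]
    by (simp add: E1_0 E2_0 md_def slot1_def slot2_def)
  also have "\<dots> = 0"
    by (rule bsum_zero) (simp add: md_def vop_tensor_12 clinear_zero[OF clinear_YA(1)])
  finally show ?thesis by simp
qed

sublocale s1: voa_mod V "slot1 V YA"
  by unfold_locales (rule weak_slot1 weak_vop)+

sublocale s2: voa_mod V "slot2 V YA"
  by unfold_locales (rule weak_slot2 weak_vop)+

end

locale tensor_mod_z = tensor_mod V YA for V :: "'v::complex_vector voa_data"
    and YA :: "(('v, 'v) tensor, 'a::complex_vector) vertex_map" +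
  fixes z :: complex
  assumes z_nonzero: "z \<noteq> 0"
begin

sublocale two_mod V "slot1 V YA" "slot2 V YA" z
  by unfold_locales (rule z_nonzero, rule slots_commute)

end

section \<open>Components of the defining identities\<close>

lemma powi_minus_base: "(- z) powi n = (- 1) powi n * (z powi n :: complex)"
  by (metis mult_minus1 power_int_mult_distrib)

text \<open>The signs come from the argument -x0 of the delta functions and combine into a power of
  -z. Giving the exponent through \<open>e\<close> lets one lemma match both ways in which it is
  written later.\<close>

lemma powi_sign:
  assumes "e = - p - 1 - int l"
  shows "(- z) powi (- p - 1 - int l) = z powi e * (- 1) ^ l * (- 1 :: complex) powi (p + 1)"
proof -
  have "(- 1 :: complex) powi (- p - 1 - int l) = (- 1) powi (- (p + 1 + int l))" by simp
  also have "\<dots> = (- 1) powi (p + 1 + int l)" by (rule powi_m1_minus)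
  also have "\<dots> = (- 1) powi (p + 1) * (- 1) ^ l" by (subst power_int_add) simp_all
  finally show ?thesis
    unfolding assms powi_minus_base[of z] by (simp only: mult_ac)
qed

text \<open>Put y = 1/x1 and M = -p - 1: the coefficient is the value on a power of y times (y -
  z)^M, expanded at infinity here and at 0 in \<open>coeff_P_right\<close>.\<close>

lemma coeff_P_left:
  "(mscale (minv X0) (fdelta (minv X1) (mneg (Const z)) X0) \<odot> in_X1 g) (p, q, r) =
     (if r = 0 then bsum (- p - 1) (\<lambda>l. (- z) ^ l *\<^sub>C g (q - p - 1 - int l)) else 0)" (is "(?F \<odot> ?G) ?d = _")
proof -
  have "(?F \<odot> ?G) ?d = Sum_any (\<lambda>l. ?F (p, p + 1 + int l, 0) *\<^sub>C ?G (?d - (p, p + 1 + int l, 0)))"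
    by (rule fmult_line[where t = "\<lambda>i j k. nat (j - (i + 1))"])
      (auto simp: inj_def mscale_simps fdelta_P2 in_X1_def split: if_splits)
  also have "\<dots> = Sum_any (\<lambda>l. if r = 0 then (of_int (- p - 1) gchoose l) *\<^sub>C (- z) ^ l *\<^sub>C g (q - p - 1 - int l) else 0)"
    by (rule Sum_any.cong)
      (simp add: mscale_simps fdelta_P2 in_X1_def scaleC_scaleC scaleC_complex_def algebra_simps, metis minus_diff_commute)
  finally show ?thesis by (cases "r = 0") (simp_all add: bsum_def)
qed

lemma coeff_P_right:
  "(mscale (minv X0) (fdelta (Const z) (mneg (minv X1)) (mneg X0)) \<odot> in_X1 g) (p, q, r) =
     (if r = 0 then bsum (- p - 1) (\<lambda>l. (- z) powi (- p - 1 - int l) *\<^sub>C g (q + int l)) else 0)" (is "(?F \<odot> ?G) ?d = _")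
proof -
  have s: "(- z) powi (- p - 1 - int l) = z powi (- int l - (p + 1)) * (- 1) ^ l * (- 1) powi (p + 1)" for l
    by (rule powi_sign) simp
  have "(?F \<odot> ?G) ?d = Sum_any (\<lambda>l. ?F (p, - int l, 0) *\<^sub>C ?G (?d - (p, - int l, 0)))"
    by (rule fmult_line[where t = "\<lambda>i j k. nat (- j)"])
      (auto simp: inj_def mscale_simps fdelta_P3 in_X1_def split: if_splits)
  also have "\<dots> = Sum_any (\<lambda>l. if r = 0 then (of_int (- p - 1) gchoose l) *\<^sub>C (- z) powi (- p - 1 - int l) *\<^sub>C g (q + int l) else 0)"
    unfolding s by (rule Sum_any.cong)
      (simp add: mscale_simps fdelta_P3 in_X1_def scaleC_scaleC scaleC_complex_def)
  finally show ?thesis by (cases "r = 0") (simp_all add: bsum_def)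
qed

lemma Sum_any_sum_swap:
  assumes "finite J" "\<And>j. j \<in> J \<Longrightarrow> finite {s. g j s \<noteq> (0::'x::comm_monoid_add)}"
  shows "(\<Sum>j\<in>J. Sum_any (g j)) = Sum_any (\<lambda>s. \<Sum>j\<in>J. g j s)"
  using assms
proof (induction J rule: finite_induct)
  case (insert j J)
  have "finite {s. (\<Sum>j\<in>J. g j s) \<noteq> 0}"
  proof (rule finite_subset)
    show "{s. (\<Sum>j\<in>J. g j s) \<noteq> 0} \<subseteq> (\<Union>j\<in>J. {s. g j s \<noteq> 0})"
      by (auto intro: ccontr)
  qed (use insert in auto)
  then show ?case using insert by (simp add: Sum_any.distrib)
qed simp

lemma bsum_sum:
  assumes "finite J" "\<And>j. j \<in> J \<Longrightarrow> ev0 (g j)"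
  shows "(\<Sum>j\<in>J. bsum n (g j)) = bsum n (\<lambda>i. \<Sum>j\<in>J. g j i)"
proof -
  have "finite {i. (of_int n gchoose i) *\<^sub>C g j i \<noteq> 0}" if "j \<in> J" for j
    using ev0_scale[OF assms(2)[OF that]] unfolding ev0_finite .
  then show ?thesis
    unfolding bsum_def complex_vector.scale_sum_right by (rule Sum_any_sum_swap[OF assms(1)])
qed

text \<open>Counterpart of \<open>rec1_zero\<close> for decay at infinity: the starting region lies
  at very negative \<open>m\<close>, and the recursion carries vanishing upwards.\<close>

lemma rec1_zero_down:
  fixes f :: "int \<Rightarrow> int \<Rightarrow> 'x::complex_vector"
  assumes rec: "\<And>m p. f m (p + 1) = f (m + 1) p + c *\<^sub>C f m p"
    and base: "\<And>m. f m 0 = 0"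
    and van: "\<And>p. \<exists>N. \<forall>m\<le>N. f m p = 0"
  shows "f m p = 0"
proof -
  have "\<forall>m. f m p = 0"
  proof (induction p rule: int_induct[where k = 0])
    case base
    then show ?case using assms(2) ..
  next
    case (step1 i)
    then show ?case by (simp add: rec)
  next
    case (step2 i)
    have fi: "f m i = 0" for m using step2(2) ..
    have r: "f (m + 1) (i - 1) = - (c *\<^sub>C f m (i - 1))" for m
    proof -
      have "f m i = f (m + 1) (i - 1) + c *\<^sub>C f m (i - 1)" using rec[of m "i - 1"] by simp
      then have "f (m + 1) (i - 1) + c *\<^sub>C f m (i - 1) = 0" unfolding fi by (rule sym)
      then show ?thesis by (rule eq_neg_iff_add_eq_0[THEN iffD2])
    qed
    from van[of "i - 1"] obtain N where N: "\<forall>m\<le>N. f m (i - 1) = 0" ..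
    have "f m (i - 1) = 0" for m
    proof (cases "m \<le> N")
      case False
      then have "N \<le> m" by simp
      then show ?thesis
      proof (induction rule: int_ge_induct)
        case base
        then show ?case using N by simp
      next
        case (step j)
        show ?case unfolding r step by simp
      qed
    qed (simp add: N)
    then show ?case ..
  qed
  then show ?thesis ..
qed

lemma clinear_Sum_any_fun:
  assumes "\<And>j. clinear (f j)" "\<And>a. finite {j. f j a \<noteq> 0}"
  shows "clinear (\<lambda>a. Sum_any (\<lambda>j. f j a))"
  by (rule clinearI)
    (simp_all add: clinear_add[OF assms(1)] clinear_scale[OF assms(1)] Sum_any.distrib[OF assms(2) assms(2)]
      clinear_Sum_any[OF clinear_scaleC assms(2)])


section \<open>The \<open>P(z)\<close> construction\<close>

context tensor_mod_z begin

abbreviation TPz where "TPz \<equiv> TP V z YA"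
abbreviation YPz where "YPz \<equiv> YP V z YA"
abbreviation TQz where "TQz \<equiv> TQ V (- inverse z) (theta YA)"
abbreviation YQz where "YQz \<equiv> YQ V (- inverse z) (theta YA)"

text \<open>The value of \<open>e\<^bsup>x L(1)\<^esup> (-x\<^sup>-\<^sup>2)\<^bsup>L(0)\<^esup> v\<close>, with \<open>y = x\<^sup>-\<^sup>1\<close>, on \<open>y\<^bsup>q - 1\<^esup> (y - z)\<^sup>M\<close>.\<close>

definition PO :: "'v \<Rightarrow> int \<Rightarrow> int \<Rightarrow> 'a \<Rightarrow> 'a" where
  "PO v q M a = Sum_any (\<lambda>j. F (conj_vec V v j) (q - 1 - j) M a)"

definition Jv :: "'v \<Rightarrow> int set" where
  "Jv v = {j. conj_vec V v j \<noteq> 0}"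

lemma finite_Jv: "finite (Jv v)"
  unfolding Jv_def by (rule finite_conj_vec)

lemma finite_conj_op: "(\<And>j. f j 0 = 0) \<Longrightarrow> finite {j. f j (conj_vec V v j) \<noteq> 0}"
  by (rule finite_subset[OF _ finite_conj_vec[of v]]) auto

lemma Sum_any_Jv: "(\<And>j. f j 0 = 0) \<Longrightarrow> Sum_any (\<lambda>j. f j (conj_vec V v j)) = (\<Sum>j\<in>Jv v. f j (conj_vec V v j))"
  by (rule Sum_any.expand_superset[OF finite_Jv]) (auto simp: Jv_def)

lemma F_vec_zero: "F 0 m p w = 0" and F0_vec_zero: "F0 0 m p w = 0" and Fz_vec_zero: "Fz 0 m p w = 0"
  by (rule clinear_zero[OF clinear_F_vec] clinear_zero[OF clinear_F0_vec] clinear_zero[OF clinear_Fz_vec])+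

lemma PO_sum: "PO v q M a = (\<Sum>j\<in>Jv v. F (conj_vec V v j) (q - 1 - j) M a)"
  unfolding PO_def by (rule Sum_any_Jv) (rule F_vec_zero)

lemma clinear_PO: "clinear (PO v q M)"
  unfolding PO_sum[abs_def]
  by (rule clinearI) (simp_all add: clinear_add[OF clinear_F] clinear_scale[OF clinear_F] sum.distrib complex_vector.scale_sum_right)

lemma clinear_PO_vec: "clinear (\<lambda>v. PO v q M a)"
  unfolding PO_def
proof (rule clinear_Sum_any_fun)
  show "clinear (\<lambda>v. F (conj_vec V v j) (q - 1 - j) M a)" for j
    by (rule clinear_compose[OF clinear_F_vec clinear_conj_vec])
  show "finite {j. F (conj_vec V v j) (q - 1 - j) M a \<noteq> 0}" for v
    by (rule finite_conj_op) (rule F_vec_zero)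
qed

lemma opposite_F0: "opposite V (slot2 V YA) v n a = (\<Sum>j\<in>Jv v. F0 (conj_vec V v j) (n - 1 - j) 0 a)"
proof -
  have "opposite V (slot2 V YA) v n a = Sum_any (\<lambda>j. F0 (conj_vec V v j) (n - 1 - j) 0 a)"
    unfolding opposite_def F0_def by (rule Sum_any.cong) (simp add: s2.xp_0 md_def)
  also have "\<dots> = (\<Sum>j\<in>Jv v. F0 (conj_vec V v j) (n - 1 - j) 0 a)"
    by (rule Sum_any_Jv) (rule F0_vec_zero)
  finally show ?thesis .
qed

text \<open>The support has two parameters: \<open>i\<close> from the delta function, which expands
  y = z + x0 in powers of x0, and \<open>j\<close> from the Laurent polynomial attached to v.
  Summing over \<open>i\<close> gives the action at z of y^(q-1-j) (y - z)^(-p-1).\<close>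

lemma P_term_coeff:
  assumes lin: "clinear \<phi>"
  shows "P_term V z YA v \<phi> a (p, q, r) =
    (if r = 0 then (\<Sum>j\<in>Jv v. \<phi> (Fz (conj_vec V v j) (q - 1 - j) (- p - 1) a)) else 0)"
proof -
  let ?h = "\<lambda>(i::nat, j::int). (int i, q - j, 0::int)"
  let ?F = "mscale (Const (inverse z)) (fdelta (minv X1) (mneg X0) (Const z))"
  let ?G = "in_X0_X1 (\<lambda>i j. \<phi> (slot1 V YA (conj_vec V v j) i a))"
  define g where "g j i = (of_int (q - 1 - j) gchoose i) *\<^sub>C z powi (q - 1 - j - int i) *\<^sub>C
      \<phi> (md (slot1 V YA) (conj_vec V v j) (- p - 1 + int i) a)" for j :: int and i :: nat
  have g_sum: "Sum_any (g j) = \<phi> (Fz (conj_vec V v j) (q - 1 - j) (- p - 1) a)" for j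
  proof -
    have "\<phi> (Fz (conj_vec V v j) (q - 1 - j) (- p - 1) a) =
        bsum (q - 1 - j) (\<lambda>i. \<phi> (z powi (q - 1 - j - int i) *\<^sub>C md (slot1 V YA) (conj_vec V v j) (- p - 1 + int i) a))"
      unfolding Fz_def s1.xp_def
      by (rule bsum_linear[OF lin]) (rule ev0_scale, rule s1.ev0_md)
    then show ?thesis unfolding g_def bsum_def clinear_scale[OF lin] by simp
  qed
  have "P_term V z YA v \<phi> a (p, q, r) = Sum_any (\<lambda>l. ?F (?h l) *\<^sub>C ?G ((p, q, r) - ?h l))"
    unfolding P_term_def
    by (rule fmult_line[where t = "\<lambda>i j k. (nat i, q - j)"])
      (auto simp: inj_def mscale_simps fdelta_P1 split: if_splits)
  also have "\<dots> = Sum_any (\<lambda>l. if r = 0 then case l of (i, j) \<Rightarrow> g j i else 0)"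
  proof (rule Sum_any.cong)
    fix l :: "nat \<times> int"
    obtain i j where l: "l = (i, j)" by (cases l)
    have "inverse z * z powi (q - j - int i) = z powi (q - 1 - j - int i)"
      using z_nonzero by (simp add: power_int_diff power_int_add field_simps)
    moreover have "(of_int (int i - (q - j)) gchoose i) * (- 1) ^ i = (of_int (q - 1 - j) gchoose i :: complex)"
      using gbinomial_negate_int[of i "j - q"] by (simp add: algebra_simps)
    ultimately show "?F (?h l) *\<^sub>C ?G ((p, q, r) - ?h l) = (if r = 0 then case l of (i, j) \<Rightarrow> g j i else 0)"
      unfolding l by (simp add: mscale_simps fdelta_P1 in_X0_X1_def g_def scaleC_complex_def md_def)
  qed
  also have "\<dots> = (if r = 0 then Sum_any (\<lambda>(i, j). g j i) else 0)" by (cases "r = 0") simp_all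
  also have "Sum_any (\<lambda>(i, j). g j i) = Sum_any (\<lambda>j. Sum_any (g j))"
  proof (rule finite_Sum_any_cartesian[OF finite_Jv])
    show "g j i = 0" if "j \<notin> Jv v" for j i
      using that by (simp add: g_def Jv_def clinear_zero[OF s1.clinear_md_vec] clinear_zero[OF lin])
    show "finite {i. g j i \<noteq> 0}" for j
      unfolding ev0_finite[symmetric] g_def
      by (intro ev0_scale ev0_linear[where f = \<phi>] s1.ev0_md lin)
  qed
  also have "Sum_any (\<lambda>j. Sum_any (g j)) = (\<Sum>j\<in>Jv v. \<phi> (Fz (conj_vec V v j) (q - 1 - j) (- p - 1) a))"
    unfolding g_sum by (rule Sum_any_Jv) (simp add: Fz_vec_zero clinear_zero[OF lin])
  finally show ?thesis .
qed

text \<open>The residue in x0 sets the exponent of y - z to 0, where the contributions at z and at 0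
  combine into \<open>F\<close>.\<close>

lemma YP_PO:
  assumes lin: "clinear \<phi>"
  shows "YPz v n \<phi> = (\<lambda>a. \<phi> (PO v n 0 a))"
proof
  fix a
  have "YPz v n \<phi> a = (\<Sum>j\<in>Jv v. \<phi> (Fz (conj_vec V v j) (n - 1 - j) 0 a)) + \<phi> (opposite V (slot2 V YA) v n a)"
    by (simp add: YP_def Res_X0_def in_X1_def P_term_coeff[OF lin])
  also have "\<dots> = \<phi> (PO v n 0 a)"
    unfolding opposite_F0 PO_sum clinear_sum[OF lin] F_def clinear_add[OF lin] sum.distrib by simp
  finally show "YPz v n \<phi> a = \<phi> (PO v n 0 a)" .
qed

lemma P_right_F0:
  assumes lin: "clinear \<phi>"
  shows "bsum M (\<lambda>l. (- z) powi (M - int l) *\<^sub>C \<phi> (opposite V (slot2 V YA) v (q + int l) a)) =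
    (\<Sum>j\<in>Jv v. \<phi> (F0 (conj_vec V v j) (q - 1 - j) M a))"
proof -
  have "\<phi> (F0 w (q - 1 - j) M a) = bsum M (\<lambda>l. (- z) powi (M - int l) *\<^sub>C \<phi> (F0 w (q + int l - 1 - j) 0 a))" for w j
  proof -
    have "\<phi> (F0 w (q - 1 - j) M a) = bsum M (\<lambda>l. \<phi> ((- z) powi (M - int l) *\<^sub>C md (slot2 V YA) w (q - 1 - j + int l) a))"
      unfolding F0_def s2.xp_def
      by (rule bsum_linear[OF lin]) (rule ev0_scale, rule s2.ev0_md)
    then show ?thesis
      unfolding clinear_scale[OF lin] F0_def s2.xp_0 by (simp add: algebra_simps)
  qed
  note e = this
  have ev: "ev0 (\<lambda>l. (- z) powi (M - int l) *\<^sub>C \<phi> (F0 w (q + int l - 1 - j) 0 a))" for w j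
  proof -
    have "ev0 (\<lambda>l. md (slot2 V YA) w ((q - 1 - j) + int l) a)" by (rule s2.ev0_md)
    then show ?thesis
      unfolding F0_def s2.xp_0 by (intro ev0_scale ev0_linear[where f = \<phi>] lin) (simp add: algebra_simps)
  qed
  show ?thesis
    unfolding e bsum_sum[OF finite_Jv ev] opposite_F0 clinear_sum[OF lin] complex_vector.scale_sum_right ..
qed

text \<open>Coefficientwise the delta identity says that the values on y^(q-1) (y - z)^M are
  obtained from those with M = 0 by expanding (y - z)^M at infinity.\<close>

lemma TP_iff:
  "\<phi> \<in> TPz \<longleftrightarrow> clinear \<phi> \<and> (\<forall>v. \<exists>N. \<forall>n<N. \<forall>a. \<phi> (PO v n 0 a) = 0) \<and>
     (\<forall>v a M q. bsum M (\<lambda>l. (- z) ^ l *\<^sub>C \<phi> (PO v (q + M - int l) 0 a)) = \<phi> (PO v q M a))"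
proof (cases "clinear \<phi>")
  case True
  note lin = True
  have b: "(mscale (minv X0) (fdelta (minv X1) (mneg (Const z)) X0) \<odot> in_X1 (\<lambda>n. YPz v n \<phi> a)
      = P_term V z YA v \<phi> a
      + mscale (minv X0) (fdelta (Const z) (mneg (minv X1)) (mneg X0))
          \<odot> in_X1 (\<lambda>n. \<phi> (opposite V (slot2 V YA) v n a))) \<longleftrightarrow>
      (\<forall>M q. bsum M (\<lambda>l. (- z) ^ l *\<^sub>C \<phi> (PO v (q + M - int l) 0 a)) = \<phi> (PO v q M a))" (is "?L \<longleftrightarrow> ?R") for v a
  proof -
    have "?L \<longleftrightarrow> (\<forall>p q. \<forall>r::int. (if r = 0 then bsum (- p - 1) (\<lambda>l. (- z) ^ l *\<^sub>C \<phi> (PO v (q - p - 1 - int l) 0 a)) else 0) =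
        (if r = 0 then (\<Sum>j\<in>Jv v. \<phi> (Fz (conj_vec V v j) (q - 1 - j) (- p - 1) a)) else 0) +
        (if r = 0 then (\<Sum>j\<in>Jv v. \<phi> (F0 (conj_vec V v j) (q - 1 - j) (- p - 1) a)) else 0))"
      unfolding fun_eq_iff split_paired_All plus_fun_apply coeff_P_left coeff_P_right P_term_coeff[OF lin] YP_PO[OF lin]
        P_right_F0[OF lin] by (rule refl)
    also have "\<dots> \<longleftrightarrow> (\<forall>p q. bsum (- p - 1) (\<lambda>l. (- z) ^ l *\<^sub>C \<phi> (PO v (q + (- p - 1) - int l) 0 a)) = \<phi> (PO v q (- p - 1) a))"
      unfolding PO_sum clinear_sum[OF lin] F_def clinear_add[OF lin] sum.distrib
      by (auto simp: algebra_simps)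
    also have "\<dots> \<longleftrightarrow> ?R"
    proof (intro iffI allI)
      fix M q
      assume "\<forall>p q. bsum (- p - 1) (\<lambda>l. (- z) ^ l *\<^sub>C \<phi> (PO v (q + (- p - 1) - int l) 0 a)) = \<phi> (PO v q (- p - 1) a)"
      from this[rule_format, of "- M - 1" q]
      show "bsum M (\<lambda>l. (- z) ^ l *\<^sub>C \<phi> (PO v (q + M - int l) 0 a)) = \<phi> (PO v q M a)" by simp
    qed blast
    finally show ?thesis .
  qed
  show ?thesis
    unfolding TP_def mem_Collect_eq dual_def b unfolding YP_PO[OF lin] fun_eq_iff zero_fun_apply using lin by blast
qed (simp add: TP_def dual_def)

text \<open>\<open>conj_vec_involution\<close> inverts the passage from \<open>F\<close> to
  \<open>PO\<close>, so that bounds known for \<open>PO\<close> can be carried back to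
  \<open>F\<close>.\<close>

lemma F_PO: "F w m M a = (\<Sum>j\<in>Jv w. PO (conj_vec V w j) (m + 1 + j) M a)"
proof -
  have fin: "finite {s. F (conj_vec V (conj_vec V w j) (j - s)) (m + s) M a \<noteq> 0}" for j
  proof -
    have "finite {i. F (conj_vec V (conj_vec V w j) i) (m + j - i) M a \<noteq> 0}"
      by (rule finite_conj_op) (rule F_vec_zero)
    then have "finite ((\<lambda>i. j - i) ` {i. F (conj_vec V (conj_vec V w j) i) (m + j - i) M a \<noteq> 0})" by simp
    moreover have "{s. F (conj_vec V (conj_vec V w j) (j - s)) (m + s) M a \<noteq> 0} \<subseteq>
        (\<lambda>i. j - i) ` {i. F (conj_vec V (conj_vec V w j) i) (m + j - i) M a \<noteq> 0}"
    proof
      fix s assume "s \<in> {s. F (conj_vec V (conj_vec V w j) (j - s)) (m + s) M a \<noteq> 0}"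
      then have "j - s \<in> {i. F (conj_vec V (conj_vec V w j) i) (m + j - i) M a \<noteq> 0}" by (simp add: algebra_simps)
      then show "s \<in> (\<lambda>i. j - i) ` {i. F (conj_vec V (conj_vec V w j) i) (m + j - i) M a \<noteq> 0}"
        by (rule image_eqI[rotated]) simp
    qed
    ultimately show ?thesis by (rule rev_finite_subset)
  qed
  have "PO (conj_vec V w j) (m + 1 + j) M a = Sum_any (\<lambda>s. F (conj_vec V (conj_vec V w j) (j - s)) (m + s) M a)" for j
    unfolding PO_def
    by (rule Sum_any.reindex_cong[of "\<lambda>s. j - s"])
      (auto simp: fun_eq_iff algebra_simps bij_def inj_def surj_def intro: exI[of _ "j - _"])
  then have "(\<Sum>j\<in>Jv w. PO (conj_vec V w j) (m + 1 + j) M a) =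
      (\<Sum>j\<in>Jv w. Sum_any (\<lambda>s. F (conj_vec V (conj_vec V w j) (j - s)) (m + s) M a))" by simp
  also have "\<dots> = Sum_any (\<lambda>s. \<Sum>j\<in>Jv w. F (conj_vec V (conj_vec V w j) (j - s)) (m + s) M a)"
    by (rule Sum_any_sum_swap[OF finite_Jv fin])
  also have "\<dots> = Sum_any (\<lambda>s. F (Sum_any (\<lambda>j. conj_vec V (conj_vec V w j) (j - s))) (m + s) M a)"
  proof (rule Sum_any.cong)
    fix s
    have "Sum_any (\<lambda>j. conj_vec V (conj_vec V w j) (j - s)) = (\<Sum>j\<in>Jv w. conj_vec V (conj_vec V w j) (j - s))"
      by (rule Sum_any_Jv) (rule clinear_zero[OF clinear_conj_vec])
    then show "(\<Sum>j\<in>Jv w. F (conj_vec V (conj_vec V w j) (j - s)) (m + s) M a) =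
        F (Sum_any (\<lambda>j. conj_vec V (conj_vec V w j) (j - s))) (m + s) M a"
      using clinear_sum[OF clinear_F_vec] by metis
  qed
  also have "\<dots> = F w m M a"
    unfolding conj_vec_involution by (subst Sum_any_single[of 0]) (auto simp: F_vec_zero)
  finally show ?thesis ..
qed

text \<open>Both sides satisfy the same recursion in \<open>M\<close>, agree at M = 0 and vanish for
  very negative \<open>m\<close>, by decay of \<phi> at infinity.\<close>

lemma regular_expand:
  assumes J: "regular \<phi>"
  shows "\<phi> (F w m M a) = bsum M (\<lambda>l. (- z) ^ l *\<^sub>C \<phi> (F w (m + M - int l) 0 a))"
proof -
  have lin: "clinear \<phi>" by (rule regular_clinear[OF J])
  obtain N where N: "\<And>m p a. m + p < N \<Longrightarrow> \<phi> (F w m p a) = 0" using J unfolding regular_def by blast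
  have ev: "ev0 (\<lambda>l. (- z) ^ l *\<^sub>C \<phi> (F w (b - int l) 0 a))" for b
    by (rule ev0_scale, rule ev0_int_down[where f = "\<lambda>i. \<phi> (F w i 0 a)" and N = N]) (simp add: N)
  let ?f = "\<lambda>m M. \<phi> (F w m M a) - bsum M (\<lambda>l. (- z) ^ l *\<^sub>C \<phi> (F w (m + M - int l) 0 a))"
  have "?f m M = 0"
  proof (rule rec1_zero_down[where f = ?f and c = "- z"])
    fix m M
    have "bsum (M + 1) (\<lambda>l. (- z) ^ l *\<^sub>C \<phi> (F w (m + (M + 1) - int l) 0 a)) =
        bsum M (\<lambda>l. (- z) ^ l *\<^sub>C \<phi> (F w (m + 1 + M - int l) 0 a)) +
        bsum M (\<lambda>l. (- z) *\<^sub>C (- z) ^ l *\<^sub>C \<phi> (F w (m + M - int l) 0 a))"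
      unfolding bsum_pascal[OF ev] by (simp add: algebra_simps scaleC_scaleC)
    also have "bsum M (\<lambda>l. (- z) *\<^sub>C (- z) ^ l *\<^sub>C \<phi> (F w (m + M - int l) 0 a)) =
        (- z) *\<^sub>C bsum M (\<lambda>l. (- z) ^ l *\<^sub>C \<phi> (F w (m + M - int l) 0 a))"
      by (rule bsum_scale[OF ev])
    finally show "?f m (M + 1) = ?f (m + 1) M + (- z) *\<^sub>C ?f m M"
      unfolding F_rec clinear_add[OF lin] clinear_scale[OF lin] by (simp add: scaleC_complex_def algebra_simps)
  next
    show "?f m 0 = 0" for m by (simp add: bsum_0 scaleC_one)
    have z0: "bsum p (\<lambda>l. (- z) ^ l *\<^sub>C \<phi> (F w (m + p - int l) 0 a)) = 0" if "m \<le> N - p - 1" for m p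
      by (rule bsum_zero) (use that in \<open>simp add: N\<close>)
    show "\<exists>N. \<forall>m\<le>N. ?f m p = 0" for p
      by (rule exI[of _ "N - p - 1"]) (auto simp: N z0 bsum_zero)
  qed
  then show ?thesis by simp
qed

lemma PO_trunc_uniform:
  assumes "\<And>v. \<exists>N. \<forall>n<N. \<forall>a. \<phi> (PO v n 0 a) = 0"
  shows "\<exists>N. \<forall>j\<in>Jv w. \<forall>n<N. \<forall>a. \<phi> (PO (conj_vec V w j) n 0 a) = 0"
proof -
  have "\<exists>N. \<forall>j\<in>S. \<forall>n<N. \<forall>a. \<phi> (PO (conj_vec V w j) n 0 a) = 0" if "finite S" for S
    using that
  proof induction
    case (insert j S)
    obtain N where N: "\<forall>j\<in>S. \<forall>n<N. \<forall>a. \<phi> (PO (conj_vec V w j) n 0 a) = 0" using insert by blast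
    obtain N' where N': "\<forall>n<N'. \<forall>a. \<phi> (PO (conj_vec V w j) n 0 a) = 0" using assms by blast
    show ?case by (rule exI[of _ "min N N'"]) (use N N' in auto)
  qed auto
  then show ?thesis using finite_Jv by blast
qed

lemma regular_trunc_uniform:
  assumes "regular \<phi>"
  shows "\<exists>N. \<forall>j\<in>Jv w. \<forall>m p a. m + p < N \<longrightarrow> \<phi> (F (conj_vec V w j) m p a) = 0"
proof -
  have "\<exists>N. \<forall>j\<in>S. \<forall>m p a. m + p < N \<longrightarrow> \<phi> (F (conj_vec V w j) m p a) = 0" if "finite S" for S
    using that
  proof induction
    case (insert j S)
    obtain N where N: "\<forall>j\<in>S. \<forall>m p a. m + p < N \<longrightarrow> \<phi> (F (conj_vec V w j) m p a) = 0" using insert by blast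
    obtain N' where N': "\<forall>m p a. m + p < N' \<longrightarrow> \<phi> (F (conj_vec V w j) m p a) = 0" using assms unfolding regular_def by blast
    show ?case by (rule exI[of _ "min N N'"]) (use N N' in auto)
  qed auto
  then show ?thesis using finite_Jv by blast
qed

lemma finite_set_lower_bound: "finite (S::int set) \<Longrightarrow> \<exists>B. \<forall>j\<in>S. \<bar>j\<bar> \<le> B"
  by (rule exI[of _ "\<Sum>j\<in>S. \<bar>j\<bar>"]) (auto intro: member_le_sum)

text \<open>The two truncation conditions differ in shape: one concerns M = 0 and powers of x, the
  other all pairs of exponents of low sum. The delta identity bridges them, as it reduces every
  \<open>M\<close> to 0 without raising the total exponent.\<close>

lemma TP_iff_regular: "\<phi> \<in> TPz \<longleftrightarrow> regular \<phi>"
proof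
  assume T: "\<phi> \<in> TPz"
  then have lin: "clinear \<phi>" and tr: "\<And>v. \<exists>N. \<forall>n<N. \<forall>a. \<phi> (PO v n 0 a) = 0"
    and b: "\<And>v a M q. \<phi> (PO v q M a) = bsum M (\<lambda>l. (- z) ^ l *\<^sub>C \<phi> (PO v (q + M - int l) 0 a))"
    unfolding TP_iff by simp_all
  show "regular \<phi>"
    unfolding regular_def
  proof (intro conjI lin allI)
    fix w
    obtain N where N: "\<And>j n a. j \<in> Jv w \<Longrightarrow> n < N \<Longrightarrow> \<phi> (PO (conj_vec V w j) n 0 a) = 0"
      using PO_trunc_uniform[OF tr] by blast
    obtain B where B: "\<And>j. j \<in> Jv w \<Longrightarrow> \<bar>j\<bar> \<le> B" using finite_set_lower_bound[OF finite_Jv] by blast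
    \<comment> \<open>\<open>F_PO\<close> uses \<open>PO\<close> at q = m + 1 + j with j <= B, and
      the expansion at infinity reaches exponents q + p - l, all below N.\<close>
    have "\<phi> (F w m p a) = 0" if mp: "m + p < N - B - 1" for m p a
    proof -
      have "\<phi> (PO (conj_vec V w j) (m + 1 + j) p a) = 0" if j: "j \<in> Jv w" for j
        using mp B[OF j] by (subst b, intro bsum_zero) (simp add: N[OF j])
      then show ?thesis unfolding F_PO clinear_sum[OF lin] by (intro sum.neutral) blast
    qed
    then show "\<exists>N. \<forall>m p a. m + p < N \<longrightarrow> \<phi> (F w m p a) = 0" by blast
  qed
next
  assume J: "regular \<phi>"
  have lin: "clinear \<phi>" by (rule regular_clinear[OF J])
  show "\<phi> \<in> TPz"
    unfolding TP_iff
  proof (intro conjI lin allI)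
    fix v
    obtain N where N: "\<And>j m p a. j \<in> Jv v \<Longrightarrow> m + p < N \<Longrightarrow> \<phi> (F (conj_vec V v j) m p a) = 0"
      using regular_trunc_uniform[OF J] by blast
    obtain B where B: "\<And>j. j \<in> Jv v \<Longrightarrow> \<bar>j\<bar> \<le> B" using finite_set_lower_bound[OF finite_Jv] by blast
    have "\<phi> (PO v n 0 a) = 0" if n: "n < N - B" for n a
      unfolding PO_sum clinear_sum[OF lin]
    proof (intro sum.neutral ballI)
      fix j assume j: "j \<in> Jv v"
      show "\<phi> (F (conj_vec V v j) (n - 1 - j) 0 a) = 0" using n B[OF j] by (intro N[OF j]) simp
    qed
    then show "\<exists>N. \<forall>n<N. \<forall>a. \<phi> (PO v n 0 a) = 0" by blast
    fix a M q
    have ev: "ev0 (\<lambda>l. (- z) ^ l *\<^sub>C \<phi> (F (conj_vec V v j) (q + M - int l - 1 - j) 0 a))" if j: "j \<in> Jv v" for j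
    proof -
      have "ev0 (\<lambda>l. \<phi> (F (conj_vec V v j) ((q + M - 1 - j) - int l) 0 a))"
        by (rule ev0_int_down[where f = "\<lambda>i. \<phi> (F (conj_vec V v j) i 0 a)" and N = N]) (simp add: N[OF j])
      then show ?thesis by (intro ev0_scale) (simp add: algebra_simps)
    qed
    have "\<phi> (PO v q M a) = (\<Sum>j\<in>Jv v. bsum M (\<lambda>l. (- z) ^ l *\<^sub>C \<phi> (F (conj_vec V v j) (q + M - int l - 1 - j) 0 a)))"
      unfolding PO_sum clinear_sum[OF lin]
      by (subst regular_expand[OF J]) (simp add: algebra_simps)
    also have "\<dots> = bsum M (\<lambda>l. \<Sum>j\<in>Jv v. (- z) ^ l *\<^sub>C \<phi> (F (conj_vec V v j) (q + M - int l - 1 - j) 0 a))"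
      by (rule bsum_sum[OF finite_Jv ev])
    also have "\<dots> = bsum M (\<lambda>l. (- z) ^ l *\<^sub>C \<phi> (PO v (q + M - int l) 0 a))"
      unfolding PO_sum clinear_sum[OF lin] complex_vector.scale_sum_right ..
    finally show "bsum M (\<lambda>l. (- z) ^ l *\<^sub>C \<phi> (PO v (q + M - int l) 0 a)) = \<phi> (PO v q M a)" ..
  qed
qed

end

lemma E1_sum:
  assumes "finite J" "\<And>j. j \<in> J \<Longrightarrow> fin1 (g j)"
  shows "E1 (\<lambda>M K. \<Sum>j\<in>J. g j M K) m n k = (\<Sum>j\<in>J. E1 (g j) m n k)"
  unfolding E1_def complex_vector.scale_sum_right
  by (rule bsum_sum[symmetric]) (use assms in \<open>auto intro!: ev0_scale fin1D\<close>)

lemma E2_sum: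
  assumes "finite J" "\<And>j. j \<in> J \<Longrightarrow> fin2 (g j)"
  shows "E2 (\<lambda>M K. \<Sum>j\<in>J. g j M K) m n k = (\<Sum>j\<in>J. E2 (g j) m n k)"
proof -
  have "bsum n (\<lambda>i. \<Sum>j\<in>J. (- 1) ^ i *\<^sub>C g j (m + int i) (n + k - int i)) =
      (\<Sum>j\<in>J. bsum n (\<lambda>i. (- 1) ^ i *\<^sub>C g j (m + int i) (n + k - int i)))"
    by (rule bsum_sum[symmetric]) (use assms in \<open>auto intro!: ev0_scale fin2D\<close>)
  then show ?thesis by (simp add: E2_def complex_vector.scale_sum_right)
qed

lemma fin1_sum: "finite J \<Longrightarrow> (\<And>j. j \<in> J \<Longrightarrow> fin1 (g j)) \<Longrightarrow> fin1 (\<lambda>M K. \<Sum>j\<in>J. (g j M K :: 'x::complex_vector))"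
  and fin2_sum: "finite J \<Longrightarrow> (\<And>j. j \<in> J \<Longrightarrow> fin2 (g j)) \<Longrightarrow> fin2 (\<lambda>M K. \<Sum>j\<in>J. (g j M K :: 'x::complex_vector))"
  by (induction J rule: finite_induct; auto intro!: fin1_add fin2_add; simp add: fin1_def fin2_def ev0_def)+

lemma powi_m1_twice: "(- 1 :: complex) powi n * (- 1) powi n = 1"
  by (cases "even n") (simp_all add: power_int_minus_left)

text \<open>Reflection of exponents is y -> 1/y, and (1/y1 - 1/y2)^n = (-1)^n (y1 y2)^(-n) (y1 -
  y2)^n with the two regions of expansion interchanged.\<close>

lemma E1_reflect: "E1 (\<lambda>M K. g (A - M) (B - K)) m n k = (- 1) powi n *\<^sub>C E2 g (A - m - n) n (B - k - n)"
  and E2_reflect: "E2 (\<lambda>M K. g (A - M) (B - K)) m n k = (- 1) powi n *\<^sub>C E1 g (A - m - n) n (B - k - n)"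
  by (simp_all add: E1_def E2_def scaleC_scaleC powi_m1_twice scaleC_one algebra_simps)

lemma fin1_reflect: "fin2 g \<Longrightarrow> fin1 (\<lambda>M K. g (A - M) (B - K))"
  and fin2_reflect: "fin1 g \<Longrightarrow> fin2 (\<lambda>M K. g (A - M) (B - K))"
proof -
  assume g: "fin2 g"
  have "ev0 (\<lambda>l. g ((A - M) + int l) ((B - K) - int l))" for M K by (rule fin2D[OF g])
  then show "fin1 (\<lambda>M K. g (A - M) (B - K))" unfolding fin1_def by (simp add: algebra_simps)
next
  assume g: "fin1 g"
  have "ev0 (\<lambda>l. g ((A - M) - int l) ((B - K) + int l))" for M K by (rule fin1D[OF g])
  then show "fin2 (\<lambda>M K. g (A - M) (B - K))" unfolding fin2_def by (simp add: algebra_simps)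
qed

section \<open>The Jacobi identity for the action on functionals\<close>

context tensor_mod_z begin

lemma PO_hom_any:
  assumes v: "v \<in> wt h"
  shows "PO v q M a = (- 1) powi h *\<^sub>C Sum_any (\<lambda>k. F (Ld k v) (q - 1 - int k + 2 * h) M a)"
    and "ev0 (\<lambda>k. F (Ld k v) (q - 1 - int k + 2 * h) M a)"
proof -
  obtain N where N: "\<forall>k\<ge>N. Ld k v = 0" using Ld_trunc by blast
  show e: "ev0 (\<lambda>k. F (Ld k v) (q - 1 - int k + 2 * h) M a)"
    unfolding ev0_def by (rule exI[of _ N]) (simp add: N F_vec_zero)
  have e: "q - 1 - (int k - 2 * h) = q - 1 - int k + 2 * h" for k by simp
  show "PO v q M a = (- 1) powi h *\<^sub>C Sum_any (\<lambda>k. F (Ld k v) (q - 1 - int k + 2 * h) M a)"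
    unfolding PO_def Sum_any_conj_hom[of v h "\<lambda>j w. F w (q - 1 - j) M a", OF v clinear_F_vec] by (simp only: e)
qed

lemma PO_hom:
  assumes v: "v \<in> wt h" and N: "\<forall>k\<ge>N. Ld k v = 0"
  shows "PO v q M a = (- 1) powi h *\<^sub>C (\<Sum>k<N. F (Ld k v) (q - 1 - int k + 2 * h) M a)"
  unfolding PO_hom_any(1)[OF v] by (subst ev0_Sum_any[of N]) (simp_all add: N F_vec_zero)

text \<open>Operators act on functionals by precomposition, so products are reversed, while y -> 1/y
  interchanges the two expansions. \<open>borcherds_F_0\<close> opens the left side into a sum over
  triples (j, l, i), the iterate on the right opens by \<open>Ld_md_binomial\<close>, and the two
  are compared degree by degree.\<close>

lemma left_borcherds_hom:
  assumes J: "regular \<phi>" and u: "u \<in> wt a" and v: "v \<in> wt b"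
  shows "E1 (\<lambda>M K. \<phi> (PO v (- K - 1) 0 (PO u (- M - 1) 0 x))) m n k -
      E2 (\<lambda>M K. \<phi> (PO u (- M - 1) 0 (PO v (- K - 1) 0 x))) m n k =
    bsum m (\<lambda>i. \<phi> (PO (md (vop V) u (n + int i) v) (- (m + k - int i) - 1) 0 x))"
proof -
  have lin: "clinear \<phi>" by (rule regular_clinear[OF J])
  obtain N where Nu: "\<forall>k\<ge>N. Ld k u = 0" and Nv: "\<forall>k\<ge>N. Ld k v = 0"
  proof -
    obtain N1 N2 where "\<forall>k\<ge>N1. Ld k u = 0" "\<forall>k\<ge>N2. Ld k v = 0" using Ld_trunc by metis
    then show ?thesis using that[of "max N1 N2"] by simp
  qed
  \<comment> \<open>\<open>A j - M\<close> and \<open>B l - K\<close> are the exponents of y carried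
    by \<open>Ld j u\<close> and \<open>Ld l v\<close> for the modes M and K; \<open>T\<close> below
    is the total exponent of y at j = l = i = 0.\<close>
  define A where "A j = 2 * a - 2 - int j" for j
  define B where "B l = 2 * b - 2 - int l" for l
  define s :: complex where "s = (- 1) powi a * (- 1) powi b"
  define T where "T = 2 * a + 2 * b - 4 - m - k - 2 * n"
  define \<Psi> where "\<Psi> r w = \<phi> (F w r 0 x)" for r w
  have lin\<Psi>: "clinear (\<Psi> r)" for r
    unfolding \<Psi>_def by (rule clinear_compose[OF lin clinear_F_vec])
  have POu: "PO u (- M - 1) 0 y = (- 1) powi a *\<^sub>C (\<Sum>j<N. F (Ld j u) (A j - M) 0 y)" for M y
    unfolding PO_hom[OF u Nu] A_def by (simp add: algebra_simps)
  have POv: "PO v (- K - 1) 0 y = (- 1) powi b *\<^sub>C (\<Sum>l<N. F (Ld l v) (B l - K) 0 y)" for K y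
    unfolding PO_hom[OF v Nv] B_def by (simp add: algebra_simps)
  define G1 where "G1 j l M K = \<phi> (F (Ld l v) K 0 (F (Ld j u) M 0 x))" for j l M K
  define G2 where "G2 j l M K = \<phi> (F (Ld j u) M 0 (F (Ld l v) K 0 x))" for j l M K
  have f1: "fin2 (G1 j l)" and f2: "fin1 (G2 j l)" for j l
    unfolding G1_def G2_def by (rule fin2_regular[OF J], rule fin1_regular[OF J])
  have vu: "\<phi> (PO v (- K - 1) 0 (PO u (- M - 1) 0 x)) = s *\<^sub>C (\<Sum>j<N. \<Sum>l<N. G1 j l (A j - M) (B l - K))" for M K
    unfolding POu POv G1_def s_def clinear_scale[OF clinear_F] clinear_sum[OF clinear_F] clinear_scale[OF lin] clinear_sum[OF lin]
      complex_vector.scale_sum_right scaleC_scaleC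
    by (subst sum.swap) (simp add: mult.commute)
  have uv: "\<phi> (PO u (- M - 1) 0 (PO v (- K - 1) 0 x)) = s *\<^sub>C (\<Sum>j<N. \<Sum>l<N. G2 j l (A j - M) (B l - K))" for M K
    unfolding POu POv G2_def s_def clinear_scale[OF clinear_F] clinear_sum[OF clinear_F] clinear_scale[OF lin] clinear_sum[OF lin]
      complex_vector.scale_sum_right scaleC_scaleC ..
  have "E1 (\<lambda>M K. \<phi> (PO v (- K - 1) 0 (PO u (- M - 1) 0 x))) m n k =
      s *\<^sub>C (\<Sum>j<N. \<Sum>l<N. (- 1) powi n *\<^sub>C E2 (G1 j l) (A j - m - n) n (B l - k - n))"
    unfolding vu
    by (subst E1_scale, intro fin1_sum fin1_reflect f1 finite_lessThan, subst E1_sum,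
        rule finite_lessThan, intro fin1_sum fin1_reflect f1 finite_lessThan, subst E1_sum,
        rule finite_lessThan, intro fin1_reflect f1, unfold E1_reflect, rule refl)
  moreover have "E2 (\<lambda>M K. \<phi> (PO u (- M - 1) 0 (PO v (- K - 1) 0 x))) m n k =
      s *\<^sub>C (\<Sum>j<N. \<Sum>l<N. (- 1) powi n *\<^sub>C E1 (G2 j l) (A j - m - n) n (B l - k - n))"
    unfolding uv
    by (subst E2_scale, intro fin2_sum fin2_reflect f2 finite_lessThan, subst E2_sum,
        rule finite_lessThan, intro fin2_sum fin2_reflect f2 finite_lessThan, subst E2_sum,
        rule finite_lessThan, intro fin2_reflect f2, unfold E2_reflect, rule refl)
  moreover have "E2 (G1 j l) (A j - m - n) n (B l - k - n) = E1 (G2 j l) (A j - m - n) n (B l - k - n) -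
      bsum (A j - m - n) (\<lambda>i. \<Psi> (T - int (j + l + i)) (md (vop V) (Ld j u) (n + int i) (Ld l v)))" for j l
    using borcherds_F_0[OF J, of "Ld j u" "Ld l v" x "A j - m - n" n "B l - k - n"]
    unfolding G1_def G2_def \<Psi>_def by (simp add: A_def B_def T_def algebra_simps)
  ultimately have lhs: "E1 (\<lambda>M K. \<phi> (PO v (- K - 1) 0 (PO u (- M - 1) 0 x))) m n k -
      E2 (\<lambda>M K. \<phi> (PO u (- M - 1) 0 (PO v (- K - 1) 0 x))) m n k =
    (- (s * (- 1) powi n)) *\<^sub>C (\<Sum>j<N. \<Sum>l<N. bsum (A j - m - n) (\<lambda>i. \<Psi> (T - int (j + l + i)) (md (vop V) (Ld j u) (n + int i) (Ld l v))))"
    by (simp add: scaleC_complex_def sum_subtractf right_diff_distrib sum_distrib_left mult.assoc sum_negf)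
  define c where "c = - (s * (- 1) powi n)"
  obtain R where R: "\<And>j l i. j < N \<Longrightarrow> l < N \<Longrightarrow> i \<ge> R \<Longrightarrow> md (vop V) (Ld j u) i (Ld l v) = 0"
  proof -
    have "\<exists>R. \<forall>i\<ge>R. \<forall>l<N. md (vop V) (Ld j u) i (Ld l v) = 0" for j
    proof -
      obtain R where "\<forall>l<N. \<forall>i\<ge>R. md (vop V) (Ld j u) i (Ld l v) = 0"
        using uniform_bound_nat[of "\<lambda>l i. md (vop V) (Ld j u) i (Ld l v) = 0" N] VV.md_trunc by blast
      then show ?thesis by blast
    qed
    then obtain R where "\<forall>j<N. \<forall>i\<ge>R. \<forall>l<N. md (vop V) (Ld j u) i (Ld l v) = 0"
      using uniform_bound_nat[of "\<lambda>j i. \<forall>l<N. md (vop V) (Ld j u) i (Ld l v) = 0" N] by blast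
    then show ?thesis using that by blast
  qed
  define I where "I = nat (R - n)"
  define f where "f = (\<lambda>(j, l, i). c *\<^sub>C (of_int (A j - m - n) gchoose i) *\<^sub>C
      \<Psi> (T - int (j + l + i)) (md (vop V) (Ld j u) (n + int i) (Ld l v)))"
  have md0: "md (vop V) (Ld j u) (n + int i) (Ld l v) = 0" if "\<not> (j < N \<and> l < N \<and> i < I)" for j l i
  proof (cases "j < N \<and> l < N")
    case True
    then have "n + int i \<ge> R" using that by (simp add: I_def)
    then show ?thesis using R True by blast
  next
    case False
    then have "Ld j u = 0 \<or> Ld l v = 0" using Nu Nv not_less by blast
    then show ?thesis using clinear_zero[OF VV.clinear_md] clinear_zero[OF VV.clinear_md_vec] by auto
  qed
  have f0: "f (j, l, i) = 0" if "\<not> (j < N \<and> l < N \<and> i < I)" for j l i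
    unfolding f_def by (simp add: md0[OF that] clinear_zero[OF lin\<Psi>])
  have box: "{t. f t \<noteq> 0} \<subseteq> {..<N} \<times> {..<N} \<times> {..<I}"
    using f0 by auto
  have finf: "finite {t. f t \<noteq> 0}" by (rule finite_subset[OF box]) simp
  have "c *\<^sub>C (\<Sum>j<N. \<Sum>l<N. bsum (A j - m - n) (\<lambda>i. \<Psi> (T - int (j + l + i)) (md (vop V) (Ld j u) (n + int i) (Ld l v)))) =
      (\<Sum>j<N. \<Sum>l<N. \<Sum>i<I. f (j, l, i))"
    unfolding f_def complex_vector.scale_sum_right
    by (intro sum.cong refl, subst bsum_finite[of I]) (auto simp: md0 clinear_zero[OF lin\<Psi>] complex_vector.scale_sum_right)
  also have "\<dots> = Sum_any f"
    unfolding sum.cartesian_product using Sum_any.expand_superset[OF _ box]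
    by (simp add: split_def)
  also have "\<dots> = Sum_any (\<lambda>K. sum f (tri K))"
    by (rule Sum_any_tri[OF finf])
  finally have L: "E1 (\<lambda>M K. \<phi> (PO v (- K - 1) 0 (PO u (- M - 1) 0 x))) m n k -
      E2 (\<lambda>M K. \<phi> (PO u (- M - 1) 0 (PO v (- K - 1) 0 x))) m n k = Sum_any (\<lambda>K. sum f (tri K))"
    unfolding lhs c_def .
  define w where "w i = md (vop V) u (n + int i) v" for i :: nat
  define h where "h i = a + b - n - int i - 1" for i :: nat
  have ww: "w i \<in> wt (h i)" for i
    using wt_md[OF u v, of "n + int i"] by (simp add: w_def h_def algebra_simps)
  obtain R' where R': "\<And>i. i \<ge> R' \<Longrightarrow> md (vop V) u i v = 0" using VV.md_trunc by blast
  have w0: "w i = 0" if "i \<ge> nat (R' - n)" for i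
    unfolding w_def by (rule R') (use that in linarith)
  define g where "g i l = (c * (- 1) ^ i * (of_int m gchoose i)) *\<^sub>C \<Psi> (T - int (i + l)) (Ld l (w i))" for i l
  have evg: "ev0 (\<lambda>l. \<Psi> (T - int (i + l)) (Ld l (w i)))" for i
  proof -
    obtain N' where "\<forall>k\<ge>N'. Ld k (w i) = 0" using Ld_trunc by blast
    then show ?thesis unfolding ev0_def by (intro exI[of _ N']) (simp add: clinear_zero[OF lin\<Psi>])
  qed
  have "(of_int m gchoose i) *\<^sub>C \<phi> (PO (w i) (- (m + k - int i) - 1) 0 x) = Sum_any (g i)" for i
  proof -
    have "\<phi> (PO (w i) (- (m + k - int i) - 1) 0 x) =
        (- 1) powi h i *\<^sub>C \<phi> (Sum_any (\<lambda>l. F (Ld l (w i)) (- (m + k - int i) - 1 - 1 - int l + 2 * h i) 0 x))"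
      by (simp only: PO_hom_any(1)[OF ww] clinear_scale[OF lin])
    also have "\<phi> (Sum_any (\<lambda>l. F (Ld l (w i)) (- (m + k - int i) - 1 - 1 - int l + 2 * h i) 0 x)) =
        Sum_any (\<lambda>l. \<phi> (F (Ld l (w i)) (- (m + k - int i) - 1 - 1 - int l + 2 * h i) 0 x))"
      by (rule clinear_Sum_any[OF lin]) (rule PO_hom_any(2)[OF ww, unfolded ev0_finite])
    also have "\<dots> = Sum_any (\<lambda>l. \<Psi> (T - int (i + l)) (Ld l (w i)))"
      by (rule Sum_any.cong) (simp add: \<Psi>_def T_def h_def algebra_simps)
    finally have e: "\<phi> (PO (w i) (- (m + k - int i) - 1) 0 x) =
        (- 1) powi h i *\<^sub>C Sum_any (\<lambda>l. \<Psi> (T - int (i + l)) (Ld l (w i)))" .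
    have "(- 1 :: complex) powi h i = c * (- 1) ^ i"
    proof -
      have "h i = (a + b) + - (n + (int i + 1))" by (simp add: h_def)
      then have "(- 1 :: complex) powi h i = (- 1) powi (a + b) * (- 1) powi (n + (int i + 1))"
        by (simp only: power_int_add powi_m1_minus) (subst power_int_add, simp_all only: powi_m1_minus, simp)
      then show ?thesis
        unfolding c_def s_def by (simp add: power_int_add)
    qed
    then show ?thesis
      unfolding e g_def
      using clinear_Sum_any[OF clinear_scaleC evg[of i, unfolded ev0_finite], of "c * (- 1) ^ i * (of_int m gchoose i)"]
      by (simp add: scaleC_scaleC mult.commute mult.left_commute)
  qed
  then have r1: "bsum m (\<lambda>i. \<phi> (PO (w i) (- (m + k - int i) - 1) 0 x)) = Sum_any (\<lambda>i. Sum_any (g i))"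
    unfolding bsum_def by simp
  have r2: "Sum_any (\<lambda>i. Sum_any (g i)) = Sum_any (\<lambda>(i, l). g i l)"
    and fing: "finite {t. (case t of (i, l) \<Rightarrow> g i l) \<noteq> 0}"
  proof -
    note * = Sum_any_iterated[of "{..<nat (R' - n)}" g]
    have 1: "g i l = 0" if "i \<notin> {..<nat (R' - n)}" for i l
      using w0[of i] that by (simp add: g_def clinear_zero[OF clinear_Ld] clinear_zero[OF lin\<Psi>])
    have 2: "finite {l. g i l \<noteq> 0}" for i
      unfolding g_def ev0_finite[symmetric] by (rule ev0_scale[OF evg])
    show "Sum_any (\<lambda>i. Sum_any (g i)) = Sum_any (\<lambda>(i, l). g i l)" using *(1) 1 2 by simp
    show "finite {t. (case t of (i, l) \<Rightarrow> g i l) \<noteq> 0}" using *(2) 1 2 by simp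
  qed
  note r1
  also note r2
  also have "Sum_any (\<lambda>(i, l). g i l) = Sum_any (\<lambda>K. \<Sum>i\<le>K. g i (K - i))"
    using Sum_any_diagonal[OF fing] by simp
  also have "\<dots> = Sum_any (\<lambda>K. sum f (tri K))"
  proof (rule Sum_any.cong)
    fix K
    \<comment> \<open>The exponent of y depends on the degree \<open>K\<close> only, so the one
      linear map \<open>\<Psi> (T - int K)\<close> can be pulled out and
      \<open>Ld_md_binomial\<close> used inside it.\<close>
    have "(\<Sum>i\<le>K. g i (K - i)) = c *\<^sub>C \<Psi> (T - int K) (\<Sum>i\<le>K. ((- 1) ^ i * (of_int m gchoose i)) *\<^sub>C Ld (K - i) (w i))"
      unfolding clinear_sum[OF lin\<Psi>] clinear_scale[OF lin\<Psi>] complex_vector.scale_sum_right scaleC_scaleC g_def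
      by (intro sum.cong) (simp_all add: mult.assoc)
    also have "\<dots> = sum f (tri K)"
      unfolding w_def Ld_md_binomial[OF u] clinear_sum[OF lin\<Psi>] complex_vector.scale_sum_right f_def
      by (intro sum.cong) (auto simp: tri_def A_def clinear_scale[OF lin\<Psi>] algebra_simps)
    finally show "(\<Sum>i\<le>K. g i (K - i)) = sum f (tri K)" .
  qed
  finally show ?thesis unfolding L w_def by simp
qed

lemma regular_PO_trunc: "regular \<phi> \<Longrightarrow> \<exists>N. \<forall>n<N. \<forall>a. \<phi> (PO v n 0 a) = 0"
  unfolding TP_iff_regular[symmetric] TP_iff by blast

lemma fin1_PO: "regular \<phi> \<Longrightarrow> fin1 (\<lambda>M K. \<phi> (PO v (- K - 1) 0 (f M)))"
  and fin2_PO: "regular \<phi> \<Longrightarrow> fin2 (\<lambda>M K. \<phi> (PO v (- M - 1) 0 (f K)))"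
proof -
  assume "regular \<phi>"
  then obtain N where N: "\<And>n a. n < N \<Longrightarrow> \<phi> (PO v n 0 a) = 0" using regular_PO_trunc by blast
  have *: "ev0 (\<lambda>i. \<phi> (PO v (- (K + int i) - 1) 0 (f (M - int i))))" for K M
    unfolding ev0_def by (rule exI[of _ "nat (- N - K)"]) (auto intro!: N)
  then show "fin1 (\<lambda>M K. \<phi> (PO v (- K - 1) 0 (f M)))" "fin2 (\<lambda>M K. \<phi> (PO v (- M - 1) 0 (f K)))"
    unfolding fin1_def fin2_def by blast+
qed

lemma PO_vec_zero: "PO 0 q M a = 0"
  by (rule clinear_zero[OF clinear_PO_vec])

lemma left_borcherds:
  assumes J: "regular \<phi>"
  shows "E1 (\<lambda>M K. \<phi> (PO v (- K - 1) 0 (PO u (- M - 1) 0 x))) m n k -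
      E2 (\<lambda>M K. \<phi> (PO u (- M - 1) 0 (PO v (- K - 1) 0 x))) m n k =
    bsum m (\<lambda>i. \<phi> (PO (md (vop V) u (n + int i) v) (- (m + k - int i) - 1) 0 x))"
proof -
  have lin: "clinear \<phi>" by (rule regular_clinear[OF J])
  have ev: "ev0 (\<lambda>i. \<phi> (PO (md (vop V) u (n + int i) v) (- (m + k - int i) - 1) 0 x))" for u v
    by (rule ev0_mono[OF VV.ev0_md[of u n v]]) (simp add: PO_vec_zero clinear_zero[OF lin])
  note lins = clinear_add[OF clinear_PO_vec] clinear_add[OF clinear_PO] clinear_add[OF lin]
    clinear_add[OF VV.clinear_md] clinear_add[OF VV.clinear_md_vec]
  show ?thesis
  proof (induction u rule: wt_induct)
    case u: (hom a u)
    show ?case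
    proof (induction v rule: wt_induct)
      case (hom b v)
      show ?case by (rule left_borcherds_hom[OF J u hom])
    next
      case (add v v')
      show ?case
        unfolding lins E1_add[OF fin1_PO[OF J] fin1_PO[OF J]] E2_add[OF fin2_PO[OF J] fin2_PO[OF J]] bsum_add[OF ev ev]
          add[symmetric] by simp
    qed
  next
    case (add u u')
    show ?case
      unfolding lins E1_add[OF fin1_PO[OF J] fin1_PO[OF J]] E2_add[OF fin2_PO[OF J] fin2_PO[OF J]] bsum_add[OF ev ev]
        add[symmetric] by simp
  qed
qed

lemma regular_zero: "regular 0"
  unfolding regular_def by (auto intro!: clinearI)

lemma regular_scale: "regular \<phi> \<Longrightarrow> regular (c *\<^sub>C \<phi>)"
proof -
  assume J: "regular \<phi>"
  have "\<exists>N. \<forall>m p w. m + p < N \<longrightarrow> (c *\<^sub>C \<phi>) (F v m p w) = 0" for v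
  proof -
    obtain N where "\<forall>m p w. m + p < N \<longrightarrow> \<phi> (F v m p w) = 0" using J unfolding regular_def by blast
    then show ?thesis by (intro exI[of _ N]) (simp add: scaleC_fun_def)
  qed
  moreover have "clinear (c *\<^sub>C \<phi>)"
    unfolding scaleC_fun_def by (rule clinear_compose[OF clinear_scaleC regular_clinear[OF J]])
  ultimately show ?thesis unfolding regular_def by blast
qed

lemma regular_add:
  assumes "regular \<phi>" "regular \<phi>'"
  shows "regular (\<phi> + \<phi>')"
  unfolding regular_def
proof (intro conjI allI)
  show "clinear (\<phi> + \<phi>')"
    by (rule clinearI) (simp_all add: clinear_add[OF regular_clinear[OF assms(1)]] clinear_add[OF regular_clinear[OF assms(2)]]
        clinear_scale[OF regular_clinear[OF assms(1)]] clinear_scale[OF regular_clinear[OF assms(2)]] scaleC_add_right)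
  fix v
  obtain N where "\<forall>m p w. m + p < N \<longrightarrow> \<phi> (F v m p w) = 0" using assms(1) unfolding regular_def by blast
  moreover obtain N' where "\<forall>m p w. m + p < N' \<longrightarrow> \<phi>' (F v m p w) = 0" using assms(2) unfolding regular_def by blast
  ultimately show "\<exists>N. \<forall>m p w. m + p < N \<longrightarrow> (\<phi> + \<phi>') (F v m p w) = 0"
    by (intro exI[of _ "min N N'"]) simp
qed

lemma regular_PO:
  assumes J: "regular \<phi>"
  shows "regular (\<lambda>a. \<phi> (PO v n 0 a))"
proof -
  have "regular (\<lambda>a. \<Sum>j\<in>S. \<phi> (F (conj_vec V v j) (n - 1 - j) 0 a))" if "finite S" for S
    using that
  proof induction
    case empty
    then show ?case using regular_zero by (simp add: zero_fun_def)
  next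
    case (insert j S)
    then show ?case using regular_add[OF regular_F[OF J, of "conj_vec V v j" "n - 1 - j" 0]] by (simp add: plus_fun_def)
  qed
  then show ?thesis unfolding PO_sum clinear_sum[OF regular_clinear[OF J]] using finite_Jv by blast
qed

lemma PO_vac: "PO (vac V) n 0 a = (if n = 0 then a else 0)"
proof -
  have "PO (vac V) n 0 a = F (vac V) (n - 1) 0 a"
    unfolding PO_def by (subst Sum_any_single[of 0]) (auto simp: conj_vec_vac F_vec_zero)
  also have "\<dots> = md (slot2 V YA) (vac V) (n - 1) a"
    unfolding F_def F0_def Fz_def s2.xp_0 s1.xp_def by (subst bsum_zero) (auto simp: s1.md_vac)
  finally show ?thesis by (simp add: s2.md_vac)
qed

theorem weak_module_TP: "weak_module V (TPz) (YPz)"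
  unfolding weak_module_def
proof (intro conjI)
  have T: "TPz = Collect regular" using TP_iff_regular by blast
  have Y: "YPz v n \<phi> = (\<lambda>a. \<phi> (PO v n 0 a))" if "regular \<phi>" for v n \<phi>
    by (rule YP_PO[OF regular_clinear[OF that]])
  show "complex_vector.subspace (TPz)"
    unfolding complex_vector.subspace_def T using regular_zero regular_add regular_scale by simp
  show "\<forall>v n. \<forall>w\<in>TPz. YPz v n w \<in> TPz"
    unfolding T by (simp add: Y regular_PO)
  show "\<forall>v n. clinear_on (TPz) (YPz v n)"
    unfolding T clinear_on_def by (simp add: Y regular_add regular_scale) (simp add: fun_eq_iff scaleC_fun_def)
  show "\<forall>n. \<forall>w\<in>TPz. clinear (\<lambda>v. YPz v n w)"
  proof (intro allI ballI)
    fix n \<phi> assume "\<phi> \<in> TPz"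
    then have J: "regular \<phi>" unfolding T by simp
    note lin = regular_clinear[OF J]
    show "clinear (\<lambda>v. YPz v n \<phi>)"
      unfolding Y[OF J]
      by (rule clinearI) (simp_all add: fun_eq_iff scaleC_fun_def clinear_add[OF clinear_PO_vec] clinear_scale[OF clinear_PO_vec]
          clinear_add[OF lin] clinear_scale[OF lin])
  qed
  show tr: "\<forall>v. \<forall>w\<in>TPz. \<exists>N. \<forall>n<N. YPz v n w = 0"
    unfolding T using regular_PO_trunc by (simp add: Y fun_eq_iff)
  show "\<forall>n. \<forall>w\<in>TPz. YPz (vac V) n w = (if n = 0 then w else 0)"
  proof (intro allI ballI)
    fix n \<phi> assume "\<phi> \<in> TPz"
    then have J: "regular \<phi>" unfolding T by simp
    show "YPz (vac V) n \<phi> = (if n = 0 then \<phi> else 0)"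
      by (simp add: Y[OF J] PO_vac fun_eq_iff clinear_zero[OF regular_clinear[OF J]])
  qed
  show "\<forall>u v. \<forall>w\<in>TPz. jacobi_identity V (YPz) u v w"
    unfolding jacobi_iff_borcherds borcherds_def
  proof (intro allI ballI)
    fix u v \<phi> m n k assume \<phi>: "\<phi> \<in> TPz"
    then have J: "regular \<phi>" unfolding T by simp
    have md1: "md (YPz) v K \<phi> = (\<lambda>a. \<phi> (PO v (- K - 1) 0 a))" for v K
      by (simp add: md_def Y[OF J])
    \<comment> \<open>Precomposition reverses the order: the operator applied last to \<phi> acts
      first on \<open>a\<close>.\<close>
    have md2: "md (YPz) u M (md (YPz) v K \<phi>) = (\<lambda>a. \<phi> (PO v (- K - 1) 0 (PO u (- M - 1) 0 a)))" for u v M K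
      unfolding md1 by (simp add: md_def Y[OF regular_PO[OF J]])
    obtain N where N: "\<And>v K. md (YPz) v K \<phi> = 0 \<or> K < N v"
    proof -
      have "\<exists>N. \<forall>K\<ge>N. md (YPz) v K \<phi> = 0" for v
      proof -
        obtain N where "\<forall>n<N. YPz v n \<phi> = 0" using tr \<phi> by blast
        then show ?thesis by (intro exI[of _ "- N"]) (simp add: md_def)
      qed
      then obtain N where "\<And>v K. K \<ge> N v \<Longrightarrow> md (YPz) v K \<phi> = 0" by metis
      then show ?thesis using that[of N] not_less by blast
    qed
    have z: "md (YPz) u M 0 = 0" for u M
      by (simp add: md_def Y[OF regular_zero] fun_eq_iff)
    \<comment> \<open>The summands are functionals, so finiteness has to be uniform in the vector at
      which they are evaluated; the truncation \<open>N\<close> of the action on \<phi> gives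
      this.\<close>
    have e1: "ev0 (\<lambda>i. md (YPz) u (M i) (md (YPz) v (K + int i) \<phi>))" for u v M K
      unfolding ev0_def using N[of v] z by (intro exI[of _ "nat (N v - K)"] allI impI) (smt (verit) nat_le_iff)
    have f1: "fin1 (\<lambda>M K. md (YPz) u M (md (YPz) v K \<phi>))" and f2: "fin2 (\<lambda>M K. md (YPz) v K (md (YPz) u M \<phi>))"
      unfolding fin1_def fin2_def by (intro allI, rule e1)+
    have e3: "ev0 (\<lambda>i. md (YPz) (md (vop V) u (n + int i) v) (m + k - int i) \<phi>)"
      by (rule ev0_mono[OF VV.ev0_md[of u n v]]) (simp add: md1 PO_vec_zero clinear_zero[OF regular_clinear[OF J]] fun_eq_iff)
    have ap: "clinear (\<lambda>f. f a)" for a :: 'a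
      by (rule clinearI) (simp_all add: scaleC_fun_def)
    show "E1 (\<lambda>M K. md (YPz) u M (md (YPz) v K \<phi>)) m n k - E2 (\<lambda>M K. md (YPz) v K (md (YPz) u M \<phi>)) m n k =
        bsum m (\<lambda>i. md (YPz) (md (vop V) u (n + int i) v) (m + k - int i) \<phi>)" (is "?E1 - ?E2 = ?B")
    proof
      fix a
      have "?E1 a = E1 (\<lambda>M K. \<phi> (PO v (- K - 1) 0 (PO u (- M - 1) 0 a))) m n k"
        by (subst E1_linear[OF ap f1]) (simp only: md2)
      moreover have "?E2 a = E2 (\<lambda>M K. \<phi> (PO u (- M - 1) 0 (PO v (- K - 1) 0 a))) m n k"
        by (subst E2_linear[OF ap f2]) (simp only: md2)
      moreover have "?B a = bsum m (\<lambda>i. \<phi> (PO (md (vop V) u (n + int i) v) (- (m + k - int i) - 1) 0 a))"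
        by (subst bsum_linear[OF ap e3]) (simp only: md1)
      ultimately show "(?E1 - ?E2) a = ?B a"
        using left_borcherds[OF J, of v u a m n k] by (simp only: fun_diff_def)
    qed
  qed
qed

end

section \<open>Exponentials\<close>

definition locnil :: "('w::complex_vector \<Rightarrow> 'w) \<Rightarrow> bool" where
  "locnil T \<longleftrightarrow> clinear T \<and> (\<forall>w. ev0 (\<lambda>k. dp T k w))"

lemma locnil_clinear: "locnil T \<Longrightarrow> clinear T"
  and locnil_ev0: "locnil T \<Longrightarrow> ev0 (\<lambda>k. dp T k w)"
  by (simp_all add: locnil_def)

lemma finite_exp_locnil: "locnil T \<Longrightarrow> finite {k. c ^ k *\<^sub>C dp T k w \<noteq> 0}"
  unfolding ev0_finite[symmetric] by (rule ev0_scale[OF locnil_ev0])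

lemma clinear_exp_locnil: "locnil T \<Longrightarrow> clinear (exp_locnil c T)"
  unfolding exp_locnil_dp
  by (rule clinear_Sum_any_fun[OF _ finite_exp_locnil])
    (auto intro: clinear_compose[OF clinear_scaleC] clinear_dp locnil_clinear)

lemma exp_locnil_commute:
  assumes "locnil T" "clinear S" "\<And>w. T (S w) = S (T w)"
  shows "exp_locnil c T (S w) = S (exp_locnil c T w)"
proof -
  have "(T ^^ k) (S w) = S ((T ^^ k) w)" for k
    by (induction k) (simp_all add: assms(3))
  then have "dp T k (S w) = S (dp T k w)" for k
    by (simp add: dp_def clinear_scale[OF assms(2)])
  then show ?thesis
    unfolding exp_locnil_dp by (simp add: clinear_Sum_any[OF assms(2) finite_exp_locnil[OF assms(1)]] clinear_scale[OF assms(2)])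
qed

text \<open>Grouping the double sum by total degree gives (c - c)^K, which leaves only K =
  0.\<close>

lemma exp_locnil_inverse:
  assumes T: "locnil T"
  shows "exp_locnil c T (exp_locnil (- c) T w) = w"
proof -
  note lin = locnil_clinear[OF T]
  obtain N where N: "\<And>k. k \<ge> N \<Longrightarrow> dp T k w = 0" using locnil_ev0[OF T, of w] unfolding ev0_def by blast
  define f where "f j k = (c ^ j * (- c) ^ k * of_nat ((j + k) choose j)) *\<^sub>C dp T (j + k) w" for j k
  have f0: "f j k = 0" if "j + k \<ge> N" for j k using N[OF that] by (simp add: f_def)
  have fin: "finite {k. f j k \<noteq> 0}" for j
    by (rule finite_subset[of _ "{..<N}"]) (use f0 in \<open>force simp: not_less\<close>)+
  have f0': "f j k = 0" if "j \<notin> {..<N}" for j k using f0 that by simp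
  have "exp_locnil c T (exp_locnil (- c) T w) = Sum_any (\<lambda>j. Sum_any (f j))"
    unfolding exp_locnil_dp[of c]
  proof (rule Sum_any.cong)
    fix j
    have "c ^ j *\<^sub>C dp T j (exp_locnil (- c) T w) = c ^ j *\<^sub>C Sum_any (\<lambda>k. dp T j ((- c) ^ k *\<^sub>C dp T k w))"
      unfolding exp_locnil_dp by (subst clinear_Sum_any[OF clinear_dp[OF lin] finite_exp_locnil[OF T]]) (rule refl)
    also have "\<dots> = Sum_any (\<lambda>k. c ^ j *\<^sub>C dp T j ((- c) ^ k *\<^sub>C dp T k w))"
      by (rule clinear_Sum_any[OF clinear_scaleC]) (rule finite_Sum_any_clinear[OF clinear_dp[OF lin] finite_exp_locnil[OF T]])
    finally show "c ^ j *\<^sub>C dp T j (exp_locnil (- c) T w) = Sum_any (f j)"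
      by (simp add: f_def clinear_scale[OF clinear_dp[OF lin]] dp_dp[OF lin] scaleC_scaleC mult.assoc)
  qed
  also have "\<dots> = Sum_any (\<lambda>(j, k). f j k)"
    by (rule Sum_any_iterated(1)[of "{..<N}"]) (use f0' fin in auto)
  also have "\<dots> = Sum_any (\<lambda>K. \<Sum>i\<le>K. f i (K - i))"
    using Sum_any_diagonal[OF Sum_any_iterated(2)[of "{..<N}" f]] f0' fin by simp
  also have "\<dots> = Sum_any (\<lambda>K. (c + - c) ^ K *\<^sub>C dp T K w)"
  proof (rule Sum_any.cong)
    fix K
    have "(\<Sum>i\<le>K. f i (K - i)) = (\<Sum>i\<le>K. of_nat (K choose i) * c ^ i * (- c) ^ (K - i)) *\<^sub>C dp T K w"
      unfolding complex_vector.scale_sum_left by (intro sum.cong) (auto simp: f_def mult_ac)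
    then show "(\<Sum>i\<le>K. f i (K - i)) = (c + - c) ^ K *\<^sub>C dp T K w" unfolding binomial_ring .
  qed
  also have "\<dots> = w"
    by (subst Sum_any_single[of 0]) (auto simp: scaleC_one power_0_left)
  finally show ?thesis .
qed

lemma exp_semisimple_eigen:
  assumes d: "direct_sum UNIV (eigenspace UNIV T)" and w: "w \<in> eigenspace UNIV T h"
  shows "exp_semisimple c T w = exp (c * h) *\<^sub>C w"
  unfolding exp_semisimple_def
  by (subst Sum_any_single[of h]) (auto simp: component_hom[OF d w])

lemma clinear_exp_semisimple:
  assumes d: "direct_sum UNIV (eigenspace UNIV T)"
  shows "clinear (exp_semisimple c T)"
proof -
  have "clinear (\<lambda>w. Sum_any (\<lambda>h. exp (c * h) *\<^sub>C component (eigenspace UNIV T) h w))"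
  proof (rule clinear_Sum_any_fun)
    show "clinear (\<lambda>w. exp (c * h) *\<^sub>C component (eigenspace UNIV T) h w)" for h
      by (rule clinear_compose[OF clinear_scaleC clinear_component[OF d]])
    show "finite {h. exp (c * h) *\<^sub>C component (eigenspace UNIV T) h w \<noteq> 0}" for w
      by (rule finite_subset[OF _ component_finite[OF d, of w]]) auto
  qed
  then show ?thesis by (simp add: exp_semisimple_def[abs_def])
qed

lemma exp_semisimple_inverse:
  assumes d: "direct_sum UNIV (eigenspace UNIV T)"
  shows "exp_semisimple c T (exp_semisimple (- c) T w) = w"
proof (induction w rule: hom_induct[OF d])
  case (1 h w)
  then show ?case
    by (simp add: exp_semisimple_eigen[OF d] clinear_scale[OF clinear_exp_semisimple[OF d]] scaleC_scaleC
        exp_add[symmetric] scaleC_one)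
next
  case (2 x y)
  then show ?case by (simp add: clinear_add[OF clinear_exp_semisimple[OF d]])
qed

lemma exp_semisimple_shift:
  assumes d: "direct_sum UNIV (eigenspace UNIV T)" and S: "clinear S"
    and shift: "\<And>w. T (S w) = S (T w) + k *\<^sub>C S w"
  shows "exp_semisimple c T (S w) = exp (c * k) *\<^sub>C S (exp_semisimple c T w)"
proof (induction w rule: hom_induct[OF d])
  case (1 h w)
  then have "S w \<in> eigenspace UNIV T (h + k)"
    by (simp add: eigenspace_def shift clinear_scale[OF S] scaleC_add_left)
  then show ?case
    using 1 by (simp add: exp_semisimple_eigen[OF d] clinear_scale[OF S] scaleC_scaleC exp_add distrib_left mult.commute)
next
  case (2 x y)
  then show ?case by (simp add: clinear_add[OF clinear_exp_semisimple[OF d]] clinear_add[OF S] scaleC_add_right)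
qed

lemma exp_log2pi: "w \<noteq> 0 \<Longrightarrow> exp (log2pi w) = w"
  unfolding log2pi_def using Arg2pi_eq[of w] by (simp add: exp_add exp_of_real)

text \<open>The semisimple exponential in psi is moved past modes that shift eigenvalues by
  integers, so the logarithm enters there through integral powers.\<close>

lemma exp_log2pi_int: "w \<noteq> 0 \<Longrightarrow> exp (log2pi w * of_int k) = w powi k"
  by (metis exp_log2pi exp_power_int mult.commute)

text \<open>The commutator with \<open>T\<close> acts on the family \<open>X n\<close> as the
  derivative acts on x^n, so conjugation by e^(c T) is a translation of x; this is the coefficient
  of c^K.\<close>

lemma dp_conjugate:
  assumes T: "clinear T" and X: "\<And>n. clinear (X n)"
    and comm: "\<And>n w. T (X n w) = X n (T w) + of_int n *\<^sub>C X (n - 1) w"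
  shows "X n (dp T K w) = (\<Sum>i\<le>K. ((- 1) ^ i * (of_int n gchoose i)) *\<^sub>C dp T (K - i) (X (n - int i) w))"
proof (induction K arbitrary: n)
  case 0
  then show ?case by (simp add: scaleC_one)
next
  case (Suc K)
  define G where "G i = dp T (Suc K - i) (X (n - int i) w)" for i
  have "of_nat (Suc K) *\<^sub>C X n (dp T (Suc K) w) = X n (T (dp T K w))"
    by (simp only: dp_Suc[OF T] clinear_scale[OF X])
  also have "\<dots> = T (X n (dp T K w)) - of_int n *\<^sub>C X (n - 1) (dp T K w)"
    by (simp add: comm)
  also have "T (X n (dp T K w)) = (\<Sum>i\<le>K. (of_nat (Suc K - i) * ((- 1) ^ i * (of_int n gchoose i))) *\<^sub>C G i)"
    unfolding Suc clinear_sum[OF T] clinear_scale[OF T] dp_Suc[OF T] G_def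
    by (intro sum.cong) (auto simp: scaleC_scaleC Suc_diff_le mult.commute)
  also have "\<dots> = (\<Sum>i\<le>Suc K. (of_nat (Suc K - i) * ((- 1) ^ i * (of_int n gchoose i))) *\<^sub>C G i)"
    by simp
  also have "of_int n *\<^sub>C X (n - 1) (dp T K w) = - (\<Sum>i\<le>K. (of_nat (Suc i) * ((- 1) ^ (Suc i) * (of_int n gchoose Suc i))) *\<^sub>C G (Suc i))"
  proof -
    have "of_int n * ((- 1) ^ i * (of_int (n - 1) gchoose i)) = - (of_nat (Suc i) * ((- 1) ^ (Suc i) * (of_int n gchoose Suc i) :: complex))" for i
      using gbinomial_absorption[of i "of_int n :: complex"] by (simp add: mult.left_commute)
    then show ?thesis
      unfolding Suc complex_vector.scale_sum_right scaleC_scaleC sum_negf[symmetric] G_def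
      by (intro sum.cong) (simp_all add: algebra_simps complex_vector.scale_minus_left)
  qed
  also have "(\<Sum>i\<le>K. (of_nat (Suc i) * ((- 1) ^ (Suc i) * (of_int n gchoose Suc i))) *\<^sub>C G (Suc i)) =
      (\<Sum>i\<le>Suc K. (of_nat i * ((- 1) ^ i * (of_int n gchoose i))) *\<^sub>C G i)"
    by (simp only: sum.atMost_Suc_shift) simp
  also have "(\<Sum>i\<le>Suc K. (of_nat (Suc K - i) * ((- 1) ^ i * (of_int n gchoose i))) *\<^sub>C G i) -
      - (\<Sum>i\<le>Suc K. (of_nat i * ((- 1) ^ i * (of_int n gchoose i))) *\<^sub>C G i) =
      of_nat (Suc K) *\<^sub>C (\<Sum>i\<le>Suc K. ((- 1) ^ i * (of_int n gchoose i)) *\<^sub>C G i)"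
    unfolding diff_minus_eq_add sum.distrib[symmetric] scaleC_add_left[symmetric] complex_vector.scale_sum_right scaleC_scaleC
    by (intro sum.cong refl) (simp add: distrib_right[symmetric] of_nat_add[symmetric] del: of_nat_add of_nat_Suc)
  finally show ?case
    unfolding G_def by (simp only: complex_vector.scale_cancel_left of_nat_eq_0_iff) simp
qed

lemma exp_locnil_conjugate:
  assumes T: "locnil T" and X: "\<And>n. clinear (X n)"
    and comm: "\<And>n w. T (X n w) = X n (T w) + of_int n *\<^sub>C X (n - 1) w"
    and trunc: "ev0 (\<lambda>i. X (n - int i) w)"
  shows "X n (exp_locnil c T w) = exp_locnil c T (bsum n (\<lambda>i. (- c) ^ i *\<^sub>C X (n - int i) w))"
proof -
  note lin = locnil_clinear[OF T]
  define f where "f i l = ((- c) ^ i * (of_int n gchoose i)) *\<^sub>C c ^ l *\<^sub>C dp T l (X (n - int i) w)" for i l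
  obtain N where N: "\<And>i. i \<ge> N \<Longrightarrow> X (n - int i) w = 0" using trunc unfolding ev0_def by blast
  have f0: "f i l = 0" if "i \<notin> {..<N}" for i l
    using N[of i] that by (simp add: f_def clinear_zero[OF clinear_dp[OF lin]])
  have fin: "finite {l. f i l \<noteq> 0}" for i
    unfolding f_def ev0_finite[symmetric] by (intro ev0_scale locnil_ev0[OF T])
  have "X n (exp_locnil c T w) = Sum_any (\<lambda>K. c ^ K *\<^sub>C X n (dp T K w))"
    unfolding exp_locnil_dp by (simp add: clinear_Sum_any[OF X finite_exp_locnil[OF T]] clinear_scale[OF X])
  also have "\<dots> = Sum_any (\<lambda>K. \<Sum>i\<le>K. f i (K - i))"
  proof (rule Sum_any.cong)
    fix K
    have "c ^ K * ((- 1) ^ i * (of_int n gchoose i)) = (- c) ^ i * (of_int n gchoose i) * c ^ (K - i)" if "i \<le> K" for i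
    proof -
      have "(- c) ^ i * c ^ (K - i) = (- 1) ^ i * (c ^ i * c ^ (K - i))" by (simp add: power_minus[of c] mult.assoc)
      also have "c ^ i * c ^ (K - i) = c ^ K" using that by (simp add: power_add[symmetric])
      finally show ?thesis by (simp add: mult_ac)
    qed
    then show "c ^ K *\<^sub>C X n (dp T K w) = (\<Sum>i\<le>K. f i (K - i))"
      unfolding dp_conjugate[of T X, OF lin X comm] complex_vector.scale_sum_right scaleC_scaleC f_def
      by (intro sum.cong) auto
  qed
  also have "\<dots> = Sum_any (\<lambda>(i, l). f i l)"
    using Sum_any_diagonal[OF Sum_any_iterated(2)[of "{..<N}" f]] f0 fin by simp
  also have "\<dots> = Sum_any (\<lambda>i. Sum_any (f i))"
    using Sum_any_iterated(1)[of "{..<N}" f] f0 fin by simp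
  also have "\<dots> = bsum n (\<lambda>i. exp_locnil c T ((- c) ^ i *\<^sub>C X (n - int i) w))"
    unfolding bsum_def
  proof (rule Sum_any.cong)
    fix i
    have "((of_int n gchoose i) * (- c) ^ i) *\<^sub>C Sum_any (\<lambda>k. c ^ k *\<^sub>C dp T k (X (n - int i) w)) =
        Sum_any (\<lambda>k. ((of_int n gchoose i) * (- c) ^ i) *\<^sub>C c ^ k *\<^sub>C dp T k (X (n - int i) w))"
      by (rule clinear_Sum_any[OF clinear_scaleC finite_exp_locnil[OF T]])
    then show "Sum_any (f i) = (of_int n gchoose i) *\<^sub>C exp_locnil c T ((- c) ^ i *\<^sub>C X (n - int i) w)"
      unfolding f_def clinear_scale[OF clinear_exp_locnil[OF T]] exp_locnil_dp[of c T "X (n - int i) w"]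
      by (simp add: scaleC_scaleC mult_ac)
  qed
  also have "\<dots> = exp_locnil c T (bsum n (\<lambda>i. (- c) ^ i *\<^sub>C X (n - int i) w))"
    by (rule bsum_linear[OF clinear_exp_locnil[OF T], symmetric]) (rule ev0_scale[OF trunc])
  finally show ?thesis .
qed

text \<open>The identity (1 + t)^X (1 - t/(1 + t))^M = (1 + t)^(X - M) of
  \<open>binomial_convolution\<close>, applied to a linear form.\<close>

lemma bsum_bsum:
  assumes g: "ev0 g"
  shows "bsum M (\<lambda>i. (- 1) ^ i *\<^sub>C bsum (X - int i) (\<lambda>j. g (i + j))) = bsum (X - M) g"
proof -
  obtain N where N: "\<And>i. i \<ge> N \<Longrightarrow> g i = 0" using g unfolding ev0_def by blast
  define f where "f i j = ((of_int M gchoose i) * (- 1) ^ i * (of_int (X - int i) gchoose j)) *\<^sub>C g (i + j)" for i j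
  have f0: "f i j = 0" if "i \<notin> {..<N}" for i j using N[of "i + j"] that by (simp add: f_def)
  have fin: "finite {j. f i j \<noteq> 0}" for i
  proof -
    have "f i j = 0" if "j \<ge> N" for j using N[of "i + j"] that by (simp add: f_def)
    then have "{j. f i j \<noteq> 0} \<subseteq> {..<N}"
      by (metis (mono_tags, lifting) lessThan_iff mem_Collect_eq not_le subsetI)
    then show ?thesis by (rule finite_subset) simp
  qed
  have "bsum M (\<lambda>i. (- 1) ^ i *\<^sub>C bsum (X - int i) (\<lambda>j. g (i + j))) = Sum_any (\<lambda>i. Sum_any (f i))"
    unfolding bsum_def[of M]
  proof (rule Sum_any.cong)
    fix i
    have "ev0 (\<lambda>j. (of_int (X - int i) gchoose j) *\<^sub>C g (i + j))"
      unfolding ev0_def by (rule exI[of _ N]) (simp add: N)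
    then show "(of_int M gchoose i) *\<^sub>C (- 1) ^ i *\<^sub>C bsum (X - int i) (\<lambda>j. g (i + j)) = Sum_any (f i)"
      unfolding bsum_def scaleC_scaleC ev0_finite
      by (subst clinear_Sum_any[OF clinear_scaleC]) (simp_all add: f_def scaleC_scaleC)
  qed
  also have "\<dots> = Sum_any (\<lambda>(i, l). f i l)"
    using Sum_any_iterated(1)[of "{..<N}" f] f0 fin by simp
  also have "\<dots> = Sum_any (\<lambda>K. \<Sum>i\<le>K. f i (K - i))"
    using Sum_any_diagonal[OF Sum_any_iterated(2)[of "{..<N}" f]] f0 fin by simp
  also have "\<dots> = bsum (X - M) g"
    unfolding bsum_def
  proof (rule Sum_any.cong)
    fix K
    have "(\<Sum>i\<le>K. f i (K - i)) = (\<Sum>i\<le>K. (- 1) ^ i * (of_int M gchoose i) * (of_int X - of_nat i gchoose (K - i))) *\<^sub>C g K"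
      unfolding complex_vector.scale_sum_left f_def by (intro sum.cong) (auto simp: mult_ac)
    then show "(\<Sum>i\<le>K. f i (K - i)) = (of_int (X - M) gchoose K) *\<^sub>C g K"
      unfolding binomial_convolution by simp
  qed
  finally show ?thesis .
qed

context voa_mod begin

text \<open>Sum of \<open>dL_md\<close> over all \<open>K\<close>. The three indices have bounded
  range, by truncation on V, on the module and of the modes, which permits summing over
  \<open>l\<close> on its own and so rebuilding the exponential on \<open>w\<close>.\<close>

lemma exp_locnil_md:
  assumes nil: "locnil (Lop V Y 1)" and v: "v \<in> wt h"
  shows "exp_locnil c (Lop V Y 1) (md Y v n w) = Sum_any (\<lambda>k. c ^ k *\<^sub>C
     bsum (2 * h - int k - n - 2) (\<lambda>i. c ^ i *\<^sub>C md Y (Ld k v) (n + int i) (exp_locnil c (Lop V Y 1) w)))"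
proof -
  obtain N where N: "\<And>k. k \<ge> N \<Longrightarrow> Ld k v = 0" using Ld_trunc by blast
  obtain N' where N': "\<And>k. k \<ge> N' \<Longrightarrow> dL k w = 0" using locnil_ev0[OF nil, of w] unfolding ev0_def by blast
  obtain R where R: "\<And>j l i. j < N \<Longrightarrow> l < N' \<Longrightarrow> i \<ge> R \<Longrightarrow> md Y (Ld j v) i (dL l w) = 0"
  proof -
    have "\<exists>R. \<forall>i\<ge>R. \<forall>l<N'. md Y (Ld j v) i (dL l w) = 0" for j
    proof -
      obtain R where "\<forall>l<N'. \<forall>i\<ge>R. md Y (Ld j v) i (dL l w) = 0"
        using uniform_bound_nat[of "\<lambda>l i. md Y (Ld j v) i (dL l w) = 0" N'] md_trunc by blast
      then show ?thesis by blast
    qed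
    then obtain R where "\<forall>j<N. \<forall>i\<ge>R. \<forall>l<N'. md Y (Ld j v) i (dL l w) = 0"
      using uniform_bound_nat[of "\<lambda>j i. \<forall>l<N'. md Y (Ld j v) i (dL l w) = 0" N] by blast
    then show ?thesis using that by blast
  qed
  define I where "I = nat (R - n)"
  have md0: "md Y (Ld j v) (n + int i) (dL l w) = 0" if "\<not> (j < N \<and> l < N' \<and> i < I)" for j l i
  proof (cases "j < N \<and> l < N'")
    case True
    then have "n + int i \<ge> R" using that by (simp add: I_def)
    then show ?thesis using R True by blast
  next
    case False
    then have "Ld j v = 0 \<or> dL l w = 0" using N N' not_less by blast
    then show ?thesis using clinear_zero[OF clinear_md] clinear_zero[OF clinear_md_vec] by auto
  qed
  define f where "f = (\<lambda>(j, l, i). (c ^ (j + l + i) * (of_int (2 * h - int j - n - 2) gchoose i)) *\<^sub>C md Y (Ld j v) (n + int i) (dL l w))"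
  have f0: "f (j, l, i) = 0" if "\<not> (j < N \<and> l < N' \<and> i < I)" for j l i
    unfolding f_def by (simp add: md0[OF that])
  have box: "{t. f t \<noteq> 0} \<subseteq> {..<N} \<times> {..<N'} \<times> {..<I}"
    using f0 by auto
  have finf: "finite {t. f t \<noteq> 0}" by (rule finite_subset[OF box]) simp
  have "exp_locnil c (Lop V Y 1) (md Y v n w) = Sum_any (\<lambda>K. sum f (tri K))"
    unfolding exp_locnil_dp
  proof (rule Sum_any.cong)
    fix K
    show "c ^ K *\<^sub>C dL K (md Y v n w) = sum f (tri K)"
      unfolding dL_md[OF v] complex_vector.scale_sum_right f_def
      by (intro sum.cong) (auto simp: tri_def scaleC_scaleC)
  qed
  also have "\<dots> = Sum_any f" by (rule Sum_any_tri[OF finf, symmetric])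
  also have "\<dots> = (\<Sum>j<N. \<Sum>l<N'. \<Sum>i<I. f (j, l, i))"
    unfolding sum.cartesian_product using Sum_any.expand_superset[OF _ box] by (simp add: split_def)
  also have "\<dots> = (\<Sum>j<N. \<Sum>i<I. \<Sum>l<N'. f (j, l, i))"
    by (subst sum.swap) (rule refl)
  also have "\<dots> = (\<Sum>j<N. c ^ j *\<^sub>C (\<Sum>i<I. (of_int (2 * h - int j - n - 2) gchoose i) *\<^sub>C c ^ i *\<^sub>C
      md Y (Ld j v) (n + int i) (\<Sum>l<N'. c ^ l *\<^sub>C dL l w)))"
    unfolding clinear_sum[OF clinear_md] clinear_scale[OF clinear_md] complex_vector.scale_sum_right f_def
    by (simp add: scaleC_scaleC power_add mult_ac)
  also have "(\<Sum>l<N'. c ^ l *\<^sub>C dL l w) = exp_locnil c (Lop V Y 1) w"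
    unfolding exp_locnil_dp by (rule ev0_Sum_any[symmetric]) (simp add: N')
  finally have e: "exp_locnil c (Lop V Y 1) (md Y v n w) = (\<Sum>j<N. c ^ j *\<^sub>C (\<Sum>i<I. (of_int (2 * h - int j - n - 2) gchoose i) *\<^sub>C c ^ i *\<^sub>C
      md Y (Ld j v) (n + int i) (exp_locnil c (Lop V Y 1) w)))" .
  have exp_sum: "exp_locnil c (Lop V Y 1) w = (\<Sum>l<N'. c ^ l *\<^sub>C dL l w)"
    unfolding exp_locnil_dp by (rule ev0_Sum_any) (simp add: N')
  have z: "md Y (Ld j v) (n + int i) (exp_locnil c (Lop V Y 1) w) = 0" if "j \<ge> N \<or> i \<ge> I" for j i
    unfolding exp_sum clinear_sum[OF clinear_md] clinear_scale[OF clinear_md]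
    by (intro sum.neutral ballI) (use that md0 in auto)
  have "bsum (2 * h - int j - n - 2) (\<lambda>i. c ^ i *\<^sub>C md Y (Ld j v) (n + int i) (exp_locnil c (Lop V Y 1) w)) =
      (\<Sum>i<I. (of_int (2 * h - int j - n - 2) gchoose i) *\<^sub>C c ^ i *\<^sub>C md Y (Ld j v) (n + int i) (exp_locnil c (Lop V Y 1) w))" for j
    by (rule bsum_finite) (simp add: z)
  then show ?thesis
    unfolding e by (subst ev0_Sum_any[of N]) (auto simp: z bsum_zero)
qed

end

section \<open>Coefficients of the delta functions on the Q side\<close>

lemma coeff_Q1:
  "(mscale (minv X0) (fdelta X1 (mneg (Const z)) X0) \<odot> in_X1 g) (p, q, r) =
     (if r = 0 then bsum (- p - 1) (\<lambda>l. (- z) ^ l *\<^sub>C g (q + p + 1 + int l)) else 0)" (is "(?F \<odot> ?G) ?d = _")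
proof -
  have "(?F \<odot> ?G) ?d = Sum_any (\<lambda>l. ?F (p, - p - 1 - int l, 0) *\<^sub>C ?G (?d - (p, - p - 1 - int l, 0)))"
    by (rule fmult_line[where t = "\<lambda>i j k. nat (- i - 1 - j)"])
      (auto simp: inj_def mscale_simps fdelta_Q1 in_X1_def split: if_splits)
  also have "\<dots> = Sum_any (\<lambda>l. if r = 0 then (of_int (- p - 1) gchoose l) *\<^sub>C (- z) ^ l *\<^sub>C g (q + p + 1 + int l) else 0)"
    by (rule Sum_any.cong)
      (simp add: mscale_simps fdelta_Q1 in_X1_def scaleC_scaleC scaleC_complex_def algebra_simps, metis minus_diff_commute)
  finally show ?thesis by (cases "r = 0") (simp_all add: bsum_def)
qed

lemma coeff_Q2:
  "(mscale (minv X0) (fdelta (Const z) (mneg X1) (mneg X0)) \<odot> in_X1 g) (p, q, r) =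
     (if r = 0 then bsum (- p - 1) (\<lambda>l. (- z) powi (- p - 1 - int l) *\<^sub>C g (q - int l)) else 0)" (is "(?F \<odot> ?G) ?d = _")
proof -
  have s: "(- z) powi (- p - 1 - int l) = z powi (- (p + 1) - int l) * (- 1) ^ l * (- 1) powi (p + 1)" for l
    by (rule powi_sign) simp
  have "(?F \<odot> ?G) ?d = Sum_any (\<lambda>l. ?F (p, int l, 0) *\<^sub>C ?G (?d - (p, int l, 0)))"
    by (rule fmult_line[where t = "\<lambda>i j k. nat (j)"])
      (auto simp: inj_def mscale_simps fdelta_Q2 in_X1_def split: if_splits)
  also have "\<dots> = Sum_any (\<lambda>l. if r = 0 then (of_int (- p - 1) gchoose l) *\<^sub>C (- z) powi (- p - 1 - int l) *\<^sub>C g (q - int l) else 0)"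
    unfolding s by (rule Sum_any.cong)
      (simp add: mscale_simps fdelta_Q2 in_X1_def scaleC_scaleC scaleC_complex_def)
  finally show ?thesis by (cases "r = 0") (simp_all add: bsum_def)
qed

lemma coeff_Q3:
  assumes "z \<noteq> 0"
  shows "(mscale (Const (inverse z)) (fdelta X1 (mneg X0) (Const z)) \<odot> in_X0 g) (p, q, r) =
     (if r = 0 then bsum (- q - 1) (\<lambda>l. z powi (- q - 1 - int l) *\<^sub>C g (p - int l)) else 0)" (is "(?F \<odot> ?G) ?d = _")
proof -
  have "(?F \<odot> ?G) ?d = Sum_any (\<lambda>l. ?F (int l, q, 0) *\<^sub>C ?G (?d - (int l, q, 0)))"
    by (rule fmult_line[where t = "\<lambda>i j k. nat i"])
      (auto simp: inj_def mscale_simps fdelta_Q3 in_X0_def split: if_splits)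
  also have "\<dots> = Sum_any (\<lambda>l. if r = 0 then (of_int (- q - 1) gchoose l) *\<^sub>C z powi (- q - 1 - int l) *\<^sub>C g (p - int l) else 0)"
  proof (rule Sum_any.cong)
    fix l
    have "z powi (- q - 1 - int l) = z powi (- 1 + (- int l - q))"
      by (rule arg_cong[where f = "\<lambda>n. z powi n"]) simp
    also have "\<dots> = inverse z * z powi (- int l - q)"
      using assms by (subst power_int_add) (simp_all add: power_int_minus)
    finally have e: "z powi (- q - 1 - int l) = inverse z * z powi (- int l - q)" .
    show "?F (int l, q, 0) *\<^sub>C ?G (?d - (int l, q, 0)) =
        (if r = 0 then (of_int (- q - 1) gchoose l) *\<^sub>C z powi (- q - 1 - int l) *\<^sub>C g (p - int l) else 0)"
      unfolding e using gbinomial_negate_int[of l q]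
      by (simp add: mscale_simps fdelta_Q3 in_X0_def scaleC_scaleC mult_ac)
  qed
  finally show ?thesis by (cases "r = 0") (simp_all add: bsum_def)
qed

section \<open>Local nilpotency, bijectivity of exponentials, transport of module structures\<close>

lemma eigenspace_funpow:
  assumes "clinear T" "\<And>w. H (T w) = T (H w) - T w" "w \<in> eigenspace UNIV H h"
  shows "(T ^^ k) w \<in> eigenspace UNIV H (h - of_nat k)"
proof (induction k)
  case 0
  then show ?case using assms(3) by simp
next
  case (Suc k)
  then show ?case
    by (simp add: eigenspace_def assms(2) clinear_scale[OF assms(1)] clinear_diff[OF assms(1)] scale_simps)
qed

text \<open>\<open>T\<close> lowers eigenvalues of \<open>H\<close> by one, and their real parts are
  bounded below.\<close>

lemma locnil_lowering:
  fixes N :: real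
  assumes d: "direct_sum UNIV (eigenspace UNIV H)" and N: "\<And>h. Re h < N \<Longrightarrow> eigenspace UNIV H h = {0}"
    and T: "clinear T" and low: "\<And>w. H (T w) = T (H w) - T w"
  shows "locnil T"
  unfolding locnil_def
proof (intro conjI T allI)
  fix w
  show "ev0 (\<lambda>k. dp T k w)"
  proof (induction w rule: hom_induct[OF d])
    case (1 h w)
    have "(T ^^ k) w = 0" if k: "k \<ge> nat \<lceil>Re h - N + 1\<rceil>" for k
    proof -
      have "Re (h - of_nat k) < N" using k by simp linarith
      then show ?thesis using eigenspace_funpow[OF T low 1] N by blast
    qed
    then show ?case unfolding ev0_def dp_def by (intro exI[of _ "nat \<lceil>Re h - N + 1\<rceil>"]) simp
  next
    case (2 x y)
    then show ?case using ev0_add[OF 2] by (simp add: clinear_add[OF clinear_dp[OF T]])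
  qed
qed

lemma bij_of_inverse: "(\<And>w. f (g w) = w) \<Longrightarrow> (\<And>w. g (f w) = w) \<Longrightarrow> bij f"
  by (rule o_bij[of g]) (simp_all add: fun_eq_iff)

lemma bij_exp_locnil: "locnil T \<Longrightarrow> bij (exp_locnil c T)"
  using exp_locnil_inverse[of T c] exp_locnil_inverse[of T "- c"] by (intro bij_of_inverse[of _ "exp_locnil (- c) T"]) simp_all

lemma bij_exp_semisimple:
  assumes d: "direct_sum UNIV (eigenspace UNIV T)"
  shows "bij (exp_semisimple c T)"
  using exp_semisimple_inverse[OF d, of c] exp_semisimple_inverse[OF d, of "- c"]
  by (intro bij_of_inverse[of _ "exp_semisimple (- c) T"]) simp_all

context voa begin

text \<open>\<omega> = L(-2) 1, and L(-2) raises the weight by 2.\<close>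

lemma conf_wt: "conf V \<in> wt 2"
proof -
  obtain c where c: "\<And>m n v. Lop V (vop V) m (Lop V (vop V) n v) - Lop V (vop V) n (Lop V (vop V) m v) =
        of_int (m - n) *\<^sub>C Lop V (vop V) (m + n) v +
        (if m + n = 0 then (of_int (m ^ 3 - m) / 12 * c) *\<^sub>C v else 0)"
    using voa unfolding vertex_operator_algebra_def by (elim conjE) blast
  have "Lop V (vop V) (- 2) (vac V) = conf V" by (simp add: Lop_def vop_vac_0)
  then show ?thesis
    using c[of 0 "- 2" "vac V"] by (simp add: wt_iff L0_vac clinear_zero[OF VV.clinear_Lop])
qed

text \<open>Yields the weak module structure of T'_Q from that of T'_P along the dual of psi, in
  place of a second proof of the Jacobi identity.\<close>

lemma weak_module_transport:
  assumes W: "weak_module V W Y" and f: "clinear f" and im: "f ` W = W'"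
    and Y': "\<And>v n w. w \<in> W \<Longrightarrow> Y' v n (f w) = f (Y v n w)"
  shows "weak_module V W' Y'"
proof -
  have sub: "complex_vector.subspace W" and cl: "\<And>v n w. w \<in> W \<Longrightarrow> Y v n w \<in> W"
    and linw: "\<And>v n. clinear_on W (Y v n)" and linv: "\<And>n w. w \<in> W \<Longrightarrow> clinear (\<lambda>v. Y v n w)"
    and tr: "\<And>v w. w \<in> W \<Longrightarrow> \<exists>N. \<forall>n<N. Y v n w = 0"
    and vac: "\<And>n w. w \<in> W \<Longrightarrow> Y (vac V) n w = (if n = 0 then w else 0)"
    and bor: "\<And>u v w. w \<in> W \<Longrightarrow> borcherds V Y u v w"
    using W unfolding weak_module_def jacobi_iff_borcherds by (elim conjE; blast)+
  have W0: "0 \<in> W" by (rule complex_vector.subspace_0[OF sub])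
  have Y0: "Y v n 0 = 0" for v n
  proof -
    have "Y v n (0 *\<^sub>C 0) = 0 *\<^sub>C Y v n 0" using linw W0 unfolding clinear_on_def by blast
    then show ?thesis by simp
  qed
  have Yv0: "Y 0 n w = 0" if "w \<in> W" for n w by (rule clinear_zero[OF linv[OF that]])
  have add: "x + y \<in> W" and scale: "c *\<^sub>C x \<in> W" if "x \<in> W" "y \<in> W" for x y c
    using complex_vector.subspace_add[OF sub] complex_vector.subspace_scale[OF sub] that by blast+
  have "borcherds V Y' u v (f w)" if w: "w \<in> W" for u v w
    unfolding borcherds_def
  proof (intro allI)
    fix m n k
    have md: "md Y' v K (f w) = f (md Y v K w)" if "w \<in> W" for v K w using Y'[OF that] by (simp add: md_def)
    have mdW: "md Y v K w \<in> W" if "w \<in> W" for v K w using cl[OF that] by (simp add: md_def)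
    have e: "ev0 (\<lambda>i. md Y u (M i) (md Y v (K + int i) w))" for u v M K
    proof -
      obtain N where N: "\<And>n. n < N \<Longrightarrow> Y v n w = 0" using tr[OF w] by blast
      show ?thesis
        unfolding ev0_def md_def by (rule exI[of _ "nat (- N - K)"]) (auto simp: Y0 N)
    qed
    have f1: "fin1 (\<lambda>M K. md Y u M (md Y v K w))" and f2: "fin2 (\<lambda>M K. md Y v K (md Y u M w))"
      unfolding fin1_def fin2_def by (intro allI, rule e)+
    have e3: "ev0 (\<lambda>i. md Y (md (vop V) u (n + int i) v) (m + k - int i) w)"
      by (rule ev0_mono[OF VV.ev0_md[of u n v]]) (simp add: md_def Yv0[OF w])
    have "E1 (\<lambda>M K. md Y' u M (md Y' v K (f w))) m n k - E2 (\<lambda>M K. md Y' v K (md Y' u M (f w))) m n k =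
        f (E1 (\<lambda>M K. md Y u M (md Y v K w)) m n k - E2 (\<lambda>M K. md Y v K (md Y u M w)) m n k)"
      unfolding clinear_diff[OF f] E1_linear[OF f f1] E2_linear[OF f f2] by (simp add: md w mdW)
    also have "\<dots> = f (bsum m (\<lambda>i. md Y (md (vop V) u (n + int i) v) (m + k - int i) w))"
      using bor[OF w, of u v] unfolding borcherds_def by simp
    also have "\<dots> = bsum m (\<lambda>i. md Y' (md (vop V) u (n + int i) v) (m + k - int i) (f w))"
      unfolding bsum_linear[OF f e3] by (simp add: md w)
    finally show "E1 (\<lambda>M K. md Y' u M (md Y' v K (f w))) m n k - E2 (\<lambda>M K. md Y' v K (md Y' u M (f w))) m n k =
        bsum m (\<lambda>i. md Y' (md (vop V) u (n + int i) v) (m + k - int i) (f w))" .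
  qed
  moreover have "complex_vector.subspace (f ` W)"
    unfolding complex_vector.subspace_def
    using W0 add scale clinear_zero[OF f] clinear_add[OF f, symmetric] clinear_scale[OF f, symmetric]
    by (auto intro!: image_eqI[where x = 0])
  moreover have "clinear_on (f ` W) (Y' v n)" for v n
  proof -
    have "Y v n (x + y) = Y v n x + Y v n y" "Y v n (c *\<^sub>C x) = c *\<^sub>C Y v n x" if "x \<in> W" "y \<in> W" for x y c
      using linw[of v n] that unfolding clinear_on_def by blast+
    then show ?thesis
      unfolding clinear_on_def
      by (auto simp: clinear_add[OF f, symmetric] clinear_scale[OF f, symmetric] Y' add scale)
  qed
  moreover have "clinear (\<lambda>v. Y' v n (f w))" if "w \<in> W" for n w
    unfolding Y'[OF that] by (rule clinear_compose[OF f linv[OF that]])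
  moreover have "\<exists>N. \<forall>n<N. Y' v n (f w) = 0" if "w \<in> W" for v w
    using tr[OF that, of v] clinear_zero[OF f] unfolding Y'[OF that] by metis
  moreover have "Y' (vac V) n (f w) = (if n = 0 then f w else 0)" if "w \<in> W" for n w
    unfolding Y'[OF that] vac[OF that] by (simp add: clinear_zero[OF f])
  moreover have "Y' v n (f w) \<in> f ` W" if "w \<in> W" for v n w
    unfolding Y'[OF that] using cl[OF that] by blast
  ultimately show ?thesis
    unfolding weak_module_def jacobi_iff_borcherds im[symmetric] by blast
qed

end


section \<open>The \<open>Q(-z\<^sup>-\<^sup>1)\<close> construction\<close>

context tensor_mod begin

lemma slot1_theta: "slot1 V (theta YA) = slot2 V YA"
  and slot2_theta: "slot2 V (theta YA) = slot1 V YA"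
proof -
  have "tensor_lift (\<lambda>u v. v \<otimes> u) (u \<otimes> v) = v \<otimes> u" for u v :: 'v
    by (rule tensor_lift_tprod; rule clinear_tprod1 clinear_tprod2)
  then show "slot1 V (theta YA) = slot2 V YA" "slot2 V (theta YA) = slot1 V YA"
    by (simp_all add: fun_eq_iff slot1_def slot2_def theta_def)
qed

end

context tensor_mod_z begin

abbreviation om :: "'v \<Rightarrow> int \<Rightarrow> 'a \<Rightarrow> 'a" where "om \<equiv> md (opposite V (slot2 V YA))"
abbreviation m1 :: "'v \<Rightarrow> int \<Rightarrow> 'a \<Rightarrow> 'a" where "m1 \<equiv> md (slot1 V YA)"
abbreviation m2 :: "'v \<Rightarrow> int \<Rightarrow> 'a \<Rightarrow> 'a" where "m2 \<equiv> md (slot2 V YA)"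

lemma om_Sum_any: "om v n w = Sum_any (\<lambda>j. m2 (conj_vec V v j) (- n - 2 - j) w)"
  unfolding md_def opposite_def by (rule Sum_any.cong) (simp add: algebra_simps)

lemma om_sum: "om v n w = (\<Sum>j\<in>Jv v. m2 (conj_vec V v j) (- n - 2 - j) w)"
  unfolding om_Sum_any by (rule Sum_any_Jv) (rule clinear_zero[OF s2.clinear_md_vec])

lemma clinear_om: "clinear (om v n)"
  by (rule clinearI) (simp_all add: om_sum clinear_add[OF s2.clinear_md] clinear_scale[OF s2.clinear_md]
      sum.distrib complex_vector.scale_sum_right)

lemma clinear_om_vec: "clinear (\<lambda>v. om v n w)"
  unfolding om_Sum_any
proof (rule clinear_Sum_any_fun)
  show "clinear (\<lambda>v. m2 (conj_vec V v j) (- n - 2 - j) w)" for j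
    by (rule clinear_compose[OF s2.clinear_md_vec clinear_conj_vec])
  show "finite {j. m2 (conj_vec V v j) (- n - 2 - j) w \<noteq> 0}" for v
    by (rule finite_conj_op) (rule clinear_zero[OF s2.clinear_md_vec])
qed

lemma om_hom:
  assumes v: "v \<in> wt h" and N: "\<forall>k\<ge>N. Ld k v = 0"
  shows "om v n w = (- 1) powi h *\<^sub>C (\<Sum>k<N. m2 (Ld k v) (2 * h - int k - n - 2) w)"
proof -
  have "om v n w = (- 1) powi h *\<^sub>C Sum_any (\<lambda>k. m2 (Ld k v) (- n - 2 - (int k - 2 * h)) w)"
    unfolding om_Sum_any by (rule Sum_any_conj_hom[OF v s2.clinear_md_vec])
  also have "Sum_any (\<lambda>k. m2 (Ld k v) (- n - 2 - (int k - 2 * h)) w) = (\<Sum>k<N. m2 (Ld k v) (- n - 2 - (int k - 2 * h)) w)"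
    by (rule ev0_Sum_any) (simp add: N clinear_zero[OF s2.clinear_md_vec])
  finally show ?thesis by (simp add: algebra_simps)
qed

text \<open>Passing to 1/x reverses the direction in which modes are truncated; only finitely many
  \<open>Ld k v\<close> are involved, so one bound serves all.\<close>

lemma om_trunc: "\<exists>N. \<forall>n\<le>N. om v n w = 0"
proof (induction v rule: wt_induct)
  case (hom h v)
  obtain N where N: "\<forall>k\<ge>N. Ld k v = 0" using Ld_trunc by blast
  obtain R where R: "\<forall>k<N. \<forall>r\<ge>R. m2 (Ld k v) r w = 0"
    using uniform_bound_nat[of "\<lambda>k r. m2 (Ld k v) r w = 0" N] s2.md_trunc by blast
  have "om v n w = 0" if "n \<le> 2 * h - int N - 2 - R" for n
    unfolding om_hom[OF hom N] using R that by (simp add: sum.neutral)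
  then show ?case by blast
next
  case (add x y)
  then obtain N N' where "\<forall>n\<le>N. om x n w = 0" "\<forall>n\<le>N'. om y n w = 0" by blast
  then show ?case by (intro exI[of _ "min N N'"]) (simp add: clinear_add[OF clinear_om_vec])
qed

lemma ev0_om: "ev0 (\<lambda>i. om v (n - int i) w)"
proof -
  obtain N where "\<forall>n\<le>N. om v n w = 0" using om_trunc by blast
  then show ?thesis by (intro ev0_int_down[where f = "\<lambda>n. om v n w" and N = N]) simp
qed

text \<open>On the opposite operator L(1) acts as a translation: the terms with L(1) applied to v
  cancel between neighbouring k, leaving a derivative in x.\<close>

lemma L1_om:
  assumes v: "v \<in> wt h"
  shows "Lop V (slot2 V YA) 1 (om v n w) = om v n (Lop V (slot2 V YA) 1 w) + of_int n *\<^sub>C om v (n - 1) w"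
proof -
  obtain N where N: "\<forall>k\<ge>N. Ld k v = 0" using Ld_trunc by blast
  define H where "H k = of_nat k *\<^sub>C m2 (Ld k v) (2 * h - int k - (n - 1) - 2) w" for k
  have H: "(\<Sum>k<N. H (Suc k)) = (\<Sum>k<N. H k)"
  proof -
    have "(\<Sum>k<Suc N. H k) = H 0 + (\<Sum>k<N. H (Suc k))" by (rule sum.lessThan_Suc_shift)
    moreover have "H 0 = 0" "H N = 0" by (simp_all add: H_def N clinear_zero[OF s2.clinear_md_vec])
    ultimately show ?thesis by simp
  qed
  have t: "Lop V (slot2 V YA) 1 (m2 (Ld k v) (2 * h - int k - n - 2) w) =
      m2 (Ld k v) (2 * h - int k - n - 2) (Lop V (slot2 V YA) 1 w) +
      (of_int n *\<^sub>C m2 (Ld k v) (2 * h - int k - (n - 1) - 2) w - H k + H (Suc k))" for k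
    unfolding s2.commutator_L1[OF wt_Ld[OF v]] dp_Suc[OF VV.clinear_Lop] clinear_scale[OF s2.clinear_md_vec] H_def
    by (simp add: algebra_simps scale_simps)
  show ?thesis
    unfolding om_hom[OF v N] clinear_scale[OF s2.clinear_Lop] clinear_sum[OF s2.clinear_Lop] t sum.distrib sum_subtractf H
    by (simp add: complex_vector.scale_sum_right scale_simps mult.commute)
qed

text \<open>With \<open>\<zeta> = -z\<^sup>-\<^sup>1\<close>, the test function \<open>x\<^bsup>-q - 1\<^esup> (x - \<zeta>)\<^sup>N\<close> is expanded at \<open>\<infinity>\<close> against \<open>Y\<^sub>1\<^sup>o(v, x)\<close>
  and at \<open>0\<close> against \<open>Y\<^sub>2(v, x)\<close> of \<open>A\<^sup>\<theta>\<close>, whose slots are those of \<open>A\<close> interchanged.\<close>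

definition QO :: "'v \<Rightarrow> int \<Rightarrow> int \<Rightarrow> 'a \<Rightarrow> 'a" where
  "QO v q N b = bsum N (\<lambda>l. inverse z ^ l *\<^sub>C om v (N - q - 1 - int l) b) -
     bsum N (\<lambda>l. inverse z powi (N - int l) *\<^sub>C m1 v (- q - 1 + int l) b)"

lemma clinear_QO: "clinear (QO v q N)"
proof (rule clinearI)
  fix x y c
  show "QO v q N (x + y) = QO v q N x + QO v q N y"
    unfolding QO_def clinear_add[OF clinear_om] clinear_add[OF s1.clinear_md] scaleC_add_right
    by (simp add: bsum_add[OF ev0_scale[OF ev0_om] ev0_scale[OF ev0_om]] bsum_add[OF ev0_scale[OF s1.ev0_md] ev0_scale[OF s1.ev0_md]])
  show "QO v q N (c *\<^sub>C x) = c *\<^sub>C QO v q N x"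
    unfolding QO_def complex_vector.scale_right_diff_distrib bsum_scale[OF ev0_scale[OF ev0_om], symmetric]
      bsum_scale[OF ev0_scale[OF s1.ev0_md], symmetric]
    by (simp add: clinear_scale[OF clinear_om] clinear_scale[OF s1.clinear_md] scaleC_scaleC mult.commute)
qed

lemma QO_add_vec: "QO (v + v') q N b = QO v q N b + QO v' q N b"
  unfolding QO_def clinear_add[OF clinear_om_vec] clinear_add[OF s1.clinear_md_vec] scaleC_add_right
  by (simp add: bsum_add[OF ev0_scale[OF ev0_om] ev0_scale[OF ev0_om]] bsum_add[OF ev0_scale[OF s1.ev0_md] ev0_scale[OF s1.ev0_md]])

lemma QO_functional:
  assumes lin: "clinear \<phi>"
  shows "\<phi> (QO v q N b) = bsum N (\<lambda>l. inverse z ^ l *\<^sub>C \<phi> (om v (N - q - 1 - int l) b)) -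
     bsum N (\<lambda>l. inverse z powi (N - int l) *\<^sub>C \<phi> (m1 v (- q - 1 + int l) b))"
  unfolding QO_def clinear_diff[OF lin] bsum_linear[OF lin ev0_scale[OF ev0_om]]
    bsum_linear[OF lin ev0_scale[OF s1.ev0_md]] clinear_scale[OF lin] ..

text \<open>The coefficient at (p, q, 0) belongs to the test function x^(-q-1) (x - \<zeta>)^(-p-1).
  The residue q = -1 keeps only the power of x - \<zeta>, which gives \<open>YQ_QO\<close>.\<close>

lemma Q_terms_coeff:
  assumes lin: "clinear \<phi>"
  shows "Q_term1 V (- inverse z) (theta YA) v \<phi> b (p, q, r) - Q_term2 V (- inverse z) (theta YA) v \<phi> b (p, q, r) =
    (if r = 0 then \<phi> (QO v q (- p - 1) b) else 0)"
proof (cases "r = 0")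
  case True
  have a: "opposite V (slot2 V YA) v (q + p + 1 + int l) b = om v (- p - 1 - q - 1 - int l) b" for l
    by (simp add: md_def algebra_simps)
  have b: "slot1 V YA v (q - int l) b = m1 v (- q - 1 + int l) b" for l
    by (simp add: md_def algebra_simps)
  show ?thesis
    unfolding Q_term1_def Q_term2_def slot1_theta slot2_theta coeff_Q1 coeff_Q2 QO_functional[OF lin] a b
    using True by simp
qed (simp add: Q_term1_def Q_term2_def coeff_Q1 coeff_Q2)

lemma YQ_QO:
  assumes lin: "clinear \<phi>"
  shows "YQz v n \<phi> = (\<lambda>b. \<phi> (QO v (- 1) (- n - 1) b))"
proof
  fix b
  have "YQz v n \<phi> b =
      Q_term1 V (- inverse z) (theta YA) v \<phi> b (n, - 1, 0) - Q_term2 V (- inverse z) (theta YA) v \<phi> b (n, - 1, 0)"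
    by (simp add: YQ_def Res_X1_def)
  then show "YQz v n \<phi> b = \<phi> (QO v (- 1) (- n - 1) b)"
    unfolding Q_terms_coeff[OF lin] by simp
qed

text \<open>The identity amounts to x^M = (\<zeta> + (x - \<zeta>))^M: values on x^M (x - \<zeta>)^N
  are determined by those with M = 0.\<close>

lemma TQ_iff:
  "\<phi> \<in> TQz \<longleftrightarrow> clinear \<phi> \<and> (\<forall>v. \<exists>N. \<forall>n<N. \<forall>b. \<phi> (QO v (- 1) (- n - 1) b) = 0) \<and>
     (\<forall>v b M N. bsum M (\<lambda>i. (- inverse z) powi (M - int i) *\<^sub>C \<phi> (QO v (- 1) (N + int i) b)) = \<phi> (QO v (- M - 1) N b))"
proof (cases "clinear \<phi>")
  case True
  note lin = True
  have b: "(mscale (Const (inverse (- inverse z))) (fdelta X1 (mneg X0) (Const (- inverse z))) \<odot> in_X0 (\<lambda>n. YQz v n \<phi> b)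
      = Q_term1 V (- inverse z) (theta YA) v \<phi> b - Q_term2 V (- inverse z) (theta YA) v \<phi> b) \<longleftrightarrow>
      (\<forall>M N. bsum M (\<lambda>i. (- inverse z) powi (M - int i) *\<^sub>C \<phi> (QO v (- 1) (N + int i) b)) = \<phi> (QO v (- M - 1) N b))" (is "?L \<longleftrightarrow> ?R") for v b
  proof -
    have nz: "- inverse z \<noteq> 0" using z_nonzero by simp
    have "?L \<longleftrightarrow> (\<forall>p q. \<forall>r::int. (if r = 0 then bsum (- q - 1) (\<lambda>l. (- inverse z) powi (- q - 1 - int l) *\<^sub>C \<phi> (QO v (- 1) (- (p - int l) - 1) b)) else 0) =
        (if r = 0 then \<phi> (QO v q (- p - 1) b) else 0))"
      unfolding fun_eq_iff split_paired_All fun_diff_def coeff_Q3[OF nz] Q_terms_coeff[OF lin] YQ_QO[OF lin] by (rule refl)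
    also have "\<dots> \<longleftrightarrow> (\<forall>p q. bsum (- q - 1) (\<lambda>l. (- inverse z) powi (- q - 1 - int l) *\<^sub>C \<phi> (QO v (- 1) (- p - 1 + int l) b)) = \<phi> (QO v q (- p - 1) b))"
      by (auto simp: algebra_simps)
    also have "\<dots> \<longleftrightarrow> ?R"
    proof (intro iffI allI)
      fix M N
      assume "\<forall>p q. bsum (- q - 1) (\<lambda>l. (- inverse z) powi (- q - 1 - int l) *\<^sub>C \<phi> (QO v (- 1) (- p - 1 + int l) b)) = \<phi> (QO v q (- p - 1) b)"
      from this[rule_format, of "- M - 1" "- N - 1"]
      show "bsum M (\<lambda>i. (- inverse z) powi (M - int i) *\<^sub>C \<phi> (QO v (- 1) (N + int i) b)) = \<phi> (QO v (- M - 1) N b)" by simp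
    next
      fix p q
      assume "\<forall>M N. bsum M (\<lambda>i. (- inverse z) powi (M - int i) *\<^sub>C \<phi> (QO v (- 1) (N + int i) b)) = \<phi> (QO v (- M - 1) N b)"
      from this[rule_format, of "- q - 1" "- p - 1"]
      show "bsum (- q - 1) (\<lambda>l. (- inverse z) powi (- q - 1 - int l) *\<^sub>C \<phi> (QO v (- 1) (- p - 1 + int l) b)) = \<phi> (QO v q (- p - 1) b)" by simp
    qed
    finally show ?thesis .
  qed
  have d: "(\<lambda>b. \<phi> (QO v (- 1) (- n - 1) b)) \<in> dual" for v n
    unfolding dual_def using clinear_compose[OF lin clinear_QO] by blast
  show ?thesis
    unfolding TQ_def mem_Collect_eq b unfolding YQ_QO[OF lin] using lin d
    by (simp add: dual_def fun_eq_iff)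
qed (simp add: TQ_def dual_def)

end

section \<open>The change of coordinate implemented by psi\<close>

locale co_mod = tensor_mod_z V YA z for V :: "'v::complex_vector voa_data"
    and YA :: "(('v, 'v) tensor, 'a::complex_vector) vertex_map" and z +
  assumes co: "category_Co V UNIV YA"
begin

abbreviation L1 where "L1 \<equiv> Lop V (slot1 V YA)"
abbreviation L2 where "L2 \<equiv> Lop V (slot2 V YA)"

lemma semisimple_L1: "direct_sum UNIV (eigenspace UNIV (L1 0))"
  using co unfolding category_Co_def acts_semisimply_def by blast

lemma L0_tensor: "Lop (tensor_voa V) YA 0 w = L1 0 w + L2 0 w"
  unfolding Lop_def tensor_voa_def slot1_def slot2_def by (simp add: clinear_add[OF clinear_YA(1)])

text \<open>The bound on weights concerns the total L(0), the sum of those of the two slots. Because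
  the slots commute, L(1) of either slot lowers the total weight by one.\<close>

lemma locnil_L1: "locnil (L1 1)" and locnil_L2: "locnil (L2 1)"
proof -
  have mod: "voa_module (tensor_voa V) UNIV YA" using co unfolding category_Co_def by blast
  then have d: "direct_sum UNIV (eigenspace UNIV (Lop (tensor_voa V) YA 0))"
    unfolding voa_module_def by blast
  obtain N :: real where N: "\<And>h. Re h < N \<Longrightarrow> eigenspace UNIV (Lop (tensor_voa V) YA 0) h = {0}"
    using mod unfolding voa_module_def by blast
  show "locnil (L1 1)"
  proof (rule locnil_lowering[OF d N s1.clinear_Lop])
    fix w
    have "L1 0 (L1 1 w) = L1 1 (L1 0 w) - L1 1 w"
      using s1.commutator_L0[OF conf_wt, of 2 w] unfolding s1.Lop_md by (simp add: minus1_scaleC)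
    moreover have "L2 0 (L1 1 w) = L1 1 (L2 0 w)"
      unfolding s1.Lop_md s2.Lop_md by (rule slots_commute[symmetric])
    ultimately show "Lop (tensor_voa V) YA 0 (L1 1 w) = L1 1 (Lop (tensor_voa V) YA 0 w) - L1 1 w"
      unfolding L0_tensor clinear_add[OF s1.clinear_Lop] by simp
  qed
  show "locnil (L2 1)"
  proof (rule locnil_lowering[OF d N s2.clinear_Lop])
    fix w
    have "L2 0 (L2 1 w) = L2 1 (L2 0 w) - L2 1 w"
      using s2.commutator_L0[OF conf_wt, of 2 w] unfolding s2.Lop_md by (simp add: minus1_scaleC)
    moreover have "L1 0 (L2 1 w) = L2 1 (L1 0 w)"
      unfolding s1.Lop_md s2.Lop_md by (rule slots_commute)
    ultimately show "Lop (tensor_voa V) YA 0 (L2 1 w) = L2 1 (Lop (tensor_voa V) YA 0 w) - L2 1 w"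
      unfolding L0_tensor clinear_add[OF s2.clinear_Lop] by simp
  qed
qed

definition e0 :: "'a \<Rightarrow> 'a" where "e0 = exp_semisimple (log2pi (- (z ^ 2))) (L1 0)"
definition e1 :: "'a \<Rightarrow> 'a" where "e1 = exp_locnil (- z) (L1 1)"
definition e2 :: "'a \<Rightarrow> 'a" where "e2 = exp_locnil (- inverse z) (L2 1)"
definition ps :: "'a \<Rightarrow> 'a" where "ps a = e0 (e1 (e2 a))"

lemma psi_ps: "psi V (- z) YA = ps"
  by (simp add: fun_eq_iff psi_def ps_def e0_def e1_def e2_def)

lemma clinear_e0: "clinear e0" and clinear_e1: "clinear e1" and clinear_e2: "clinear e2"
  unfolding e0_def e1_def e2_def
  by (rule clinear_exp_semisimple[OF semisimple_L1] clinear_exp_locnil[OF locnil_L1] clinear_exp_locnil[OF locnil_L2])+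

lemma clinear_ps: "clinear ps"
  unfolding ps_def by (rule clinear_compose[OF clinear_e0 clinear_compose[OF clinear_e1 clinear_e2]])

lemma bij_ps: "bij ps"
proof -
  have "bij (e0 \<circ> (e1 \<circ> e2))"
    unfolding e0_def e1_def e2_def
    by (intro bij_comp bij_exp_semisimple semisimple_L1 bij_exp_locnil locnil_L1 locnil_L2)
  then show ?thesis by (simp add: ps_def[abs_def] comp_def)
qed

lemma L1_om_commute: "L1 k (om v n w) = om v n (L1 k w)"
  unfolding om_sum clinear_sum[OF s1.clinear_Lop] by (simp add: s1.Lop_md slots_commute)

lemma e1_om: "e1 (om v n w) = om v n (e1 w)"
  unfolding e1_def using exp_locnil_commute[of "L1 1" "om v n"] locnil_L1 clinear_om L1_om_commute by blast

lemma e0_om: "e0 (om v n w) = om v n (e0 w)"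
  unfolding e0_def
  using exp_semisimple_shift[of "L1 0" "om v n" 0] semisimple_L1 clinear_om by (simp add: L1_om_commute scaleC_one)

lemma e2_m1: "e2 (m1 v n w) = m1 v n (e2 w)"
  unfolding e2_def
  by (rule exp_locnil_commute[OF locnil_L2 s1.clinear_md]) (simp add: s2.Lop_md slots_commute)

text \<open>\<open>e0\<close> and \<open>e1\<close> belong to the other slot and commute with
  \<open>om\<close>; \<open>e2\<close> translates, turning x^n into (x + 1/z)^n.\<close>

lemma om_ps:
  assumes v: "v \<in> wt h"
  shows "om v n (ps w) = ps (bsum n (\<lambda>i. inverse z ^ i *\<^sub>C om v (n - int i) w))"
  unfolding ps_def e0_om[symmetric] e1_om[symmetric]
  using exp_locnil_conjugate[of "L2 1" "om v" n w "- inverse z"] locnil_L2 clinear_om L1_om[OF v] ev0_om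
  by (simp add: e2_def)

text \<open>Translation by 1/z sends x^N (x - 1/z)^M to (x + 1/z)^N x^M. Expanded at infinity, the
  translated function is a double binomial sum, which \<open>bsum_bsum\<close> contracts.\<close>

lemma slot2_intertwining:
  assumes v: "v \<in> wt h"
  shows "(- inverse z) powi M *\<^sub>C (\<Sum>j\<in>Jv v. F0 (conj_vec V v j) (- N - M - 1 - 1 - j) M (ps a)) =
    ps (bsum N (\<lambda>l. inverse z ^ l *\<^sub>C om v (N + M - int l) a))"
proof -
  define g where "g I = inverse z ^ I *\<^sub>C om v (N + M - int I) a" for I
  have evg: "ev0 g" unfolding g_def by (rule ev0_scale[OF ev0_om])
  have evg': "ev0 (\<lambda>i. g (l + i))" for l
    using ev0_shift[OF evg, of l] by (simp add: add.commute)
  have sc: "(- inverse z) powi M * (- z) powi (M - int l) = (- inverse z) ^ l" for l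
  proof -
    have "(- inverse z) powi M = inverse ((- z) powi M)" by (metis inverse_minus_eq power_int_inverse)
    moreover have "(- z) powi (M - int l) = (- z) powi M * inverse ((- z) ^ l)"
      using z_nonzero by (simp add: power_int_diff divide_inverse)
    moreover have "inverse ((- z) ^ l) = (- inverse z) ^ l" by (metis inverse_minus_eq power_inverse)
    ultimately show ?thesis using z_nonzero by simp
  qed
  have "(\<Sum>j\<in>Jv v. F0 (conj_vec V v j) (- N - M - 1 - 1 - j) M (ps a)) =
      bsum M (\<lambda>l. (- z) powi (M - int l) *\<^sub>C om v (N + M - int l) (ps a))"
    using P_right_F0[OF clinear_id, of M v "- N - M - 1" "ps a"] by (simp add: md_def algebra_simps)
  also have "(- inverse z) powi M *\<^sub>C \<dots> = bsum M (\<lambda>l. (- inverse z) ^ l *\<^sub>C om v (N + M - int l) (ps a))"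
    by (subst bsum_scale[symmetric]) (auto intro: ev0_scale ev0_om simp: scaleC_scaleC sc)
  also have "\<dots> = bsum M (\<lambda>l. ps ((- 1) ^ l *\<^sub>C bsum (N + M - int l) (\<lambda>i. g (l + i))))"
  proof (rule bsum_cong)
    fix l
    have "(- inverse z) ^ l *\<^sub>C bsum (N + M - int l) (\<lambda>i. inverse z ^ i *\<^sub>C om v (N + M - int l - int i) a) =
        bsum (N + M - int l) (\<lambda>i. (- inverse z) ^ l *\<^sub>C inverse z ^ i *\<^sub>C om v (N + M - int l - int i) a)"
      by (rule bsum_scale[symmetric]) (rule ev0_scale[OF ev0_om])
    also have "\<dots> = bsum (N + M - int l) (\<lambda>i. (- 1) ^ l *\<^sub>C g (l + i))"
      by (rule bsum_cong) (simp add: g_def scaleC_scaleC power_add power_minus[of "inverse z" l] algebra_simps)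
    also have "\<dots> = (- 1) ^ l *\<^sub>C bsum (N + M - int l) (\<lambda>i. g (l + i))"
      by (rule bsum_scale[OF evg'])
    finally show "(- inverse z) ^ l *\<^sub>C om v (N + M - int l) (ps a) = ps ((- 1) ^ l *\<^sub>C bsum (N + M - int l) (\<lambda>i. g (l + i)))"
      unfolding om_ps[OF v] clinear_scale[OF clinear_ps, symmetric] by simp
  qed
  also have "\<dots> = ps (bsum M (\<lambda>l. (- 1) ^ l *\<^sub>C bsum (N + M - int l) (\<lambda>i. g (l + i))))"
  proof (rule bsum_linear[OF clinear_ps, symmetric])
    obtain N' where N': "\<And>i. i \<ge> N' \<Longrightarrow> g i = 0" using evg unfolding ev0_def by blast
    show "ev0 (\<lambda>l. (- 1) ^ l *\<^sub>C bsum (N + M - int l) (\<lambda>i. g (l + i)))"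
      unfolding ev0_def by (intro exI[of _ N'] allI impI) (simp add: N' bsum_zero)
  qed
  also have "\<dots> = ps (bsum N g)" unfolding bsum_bsum[OF evg] by simp
  finally show ?thesis unfolding g_def .
qed

text \<open>The scalars come from \<open>e1\<close> and from the weight shift under
  \<open>e0\<close>. Their signs combine to one independent of k and i, which can leave both
  sums.\<close>

lemma scalar_e0:
  "(- z) ^ k * ((- z) ^ i * (- (z ^ 2)) powi (h - int k - (n + int i) - 1)) =
     (- 1) powi (h - n - 1) * z powi (2 * h - int k - 2 * n - 2 - int i)"
proof -
  define m where "m = h - int k - (n + int i) - 1"
  have "(- (z ^ 2)) powi m = (- 1) powi m * z powi (2 * m)"
    unfolding powi_minus_base[of "z ^ 2"] by (simp add: power_int_mult)
  moreover have "(- z) ^ k = (- 1) powi int k * z powi int k" "(- z) ^ i = (- 1) powi int i * z powi int i"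
    by (simp_all add: power_minus[of z])
  ultimately have "(- z) ^ k * ((- z) ^ i * (- (z ^ 2)) powi m) =
      ((- 1) powi int k * (- 1) powi int i * (- 1) powi m) * (z powi int k * z powi int i * z powi (2 * m))"
    by (simp only: mult_ac)
  also have "(- 1) powi int k * (- 1) powi int i * (- 1) powi m = (- 1 :: complex) powi (int k + int i + m)"
    by (simp add: power_int_add)
  also have "z powi int k * z powi int i * z powi (2 * m) = z powi (int k + int i + 2 * m)"
    using z_nonzero by (simp add: power_int_add)
  finally show ?thesis unfolding m_def by (simp add: algebra_simps)
qed

lemma e0_m1:
  assumes v: "v \<in> wt h"
  shows "e0 (m1 v n w) = (- (z ^ 2)) powi (h - n - 1) *\<^sub>C m1 v n (e0 w)"
  unfolding e0_def
  using exp_semisimple_shift[of "L1 0" "m1 v n" "of_int (h - n - 1)"] semisimple_L1 s1.clinear_md s1.commutator_L0[OF v] z_nonzero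
  by (simp add: exp_log2pi_int del: of_int_diff)

lemma ps_m1:
  assumes v: "v \<in> wt h" and N: "\<forall>k\<ge>N. Ld k v = 0"
  shows "ps (m1 v n a) = (- 1) powi (h - n - 1) *\<^sub>C (\<Sum>k<N. bsum (2 * h - int k - n - 2)
     (\<lambda>i. z powi (2 * h - int k - 2 * n - 2 - int i) *\<^sub>C m1 (Ld k v) (n + int i) (ps a)))"
proof -
  let ?B = "\<lambda>k. bsum (2 * h - int k - n - 2) (\<lambda>i. (- z) ^ i *\<^sub>C m1 (Ld k v) (n + int i) (e1 (e2 a)))"
  have "e1 (m1 v n (e2 a)) = Sum_any (\<lambda>k. (- z) ^ k *\<^sub>C ?B k)"
    unfolding e1_def by (rule s1.exp_locnil_md[OF locnil_L1 v])
  also have "\<dots> = (\<Sum>k<N. (- z) ^ k *\<^sub>C ?B k)"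
    by (rule ev0_Sum_any) (simp add: N clinear_zero[OF s1.clinear_md_vec] bsum_zero)
  finally have "ps (m1 v n a) = (\<Sum>k<N. (- z) ^ k *\<^sub>C e0 (?B k))"
    unfolding ps_def e2_m1 by (simp add: clinear_sum[OF clinear_e0] clinear_scale[OF clinear_e0])
  also have "\<dots> = (\<Sum>k<N. (- 1) powi (h - n - 1) *\<^sub>C bsum (2 * h - int k - n - 2)
     (\<lambda>i. z powi (2 * h - int k - 2 * n - 2 - int i) *\<^sub>C m1 (Ld k v) (n + int i) (ps a)))"
  proof (rule sum.cong[OF refl], goal_cases)
    case (1 k)
    have "(- z) ^ k *\<^sub>C e0 (?B k) = bsum (2 * h - int k - n - 2) (\<lambda>i. (- z) ^ k *\<^sub>C e0 ((- z) ^ i *\<^sub>C m1 (Ld k v) (n + int i) (e1 (e2 a))))"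
      by (subst bsum_linear[OF clinear_e0 ev0_scale[OF s1.ev0_md]], rule bsum_scale[symmetric],
          rule ev0_linear[OF ev0_scale[OF s1.ev0_md] clinear_e0])
    also have "\<dots> = bsum (2 * h - int k - n - 2) (\<lambda>i. (- 1) powi (h - n - 1) *\<^sub>C z powi (2 * h - int k - 2 * n - 2 - int i) *\<^sub>C m1 (Ld k v) (n + int i) (ps a))"
      unfolding clinear_scale[OF clinear_e0] e0_m1[OF wt_Ld[OF v]] scaleC_scaleC scalar_e0 ps_def ..
    also have "\<dots> = (- 1) powi (h - n - 1) *\<^sub>C bsum (2 * h - int k - n - 2)
     (\<lambda>i. z powi (2 * h - int k - 2 * n - 2 - int i) *\<^sub>C m1 (Ld k v) (n + int i) (ps a))"
      by (rule bsum_scale[OF ev0_scale[OF s1.ev0_md]])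
    finally show ?case .
  qed
  finally show ?thesis unfolding complex_vector.scale_sum_right .
qed

text \<open>At y = z the coordinate change is y - z = -z^2 t / (1 + z t): \<open>e1\<close> gives
  the Moebius map and \<open>e0\<close> the factor -z^2. Both sides reduce to a signed sum over k of
  \<open>bsum (X k - N) (g k)\<close>.\<close>

lemma slot1_intertwining:
  assumes v: "v \<in> wt h"
  shows "(- inverse z) powi M *\<^sub>C (\<Sum>j\<in>Jv v. Fz (conj_vec V v j) (- N - M - 1 - 1 - j) M (ps a)) =
    - ps (bsum N (\<lambda>l. inverse z powi (N - int l) *\<^sub>C m1 v (M + int l) a))"
proof -
  obtain B where B: "\<forall>k\<ge>B. Ld k v = 0" using Ld_trunc by blast
  define X where "X k = 2 * h - int k - M - 2" for k
  define g where "g k I = z powi (X k - M - N - int I) *\<^sub>C m1 (Ld k v) (M + int I) (ps a)" for k I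
  have evg: "ev0 (g k)" for k unfolding g_def by (rule ev0_scale[OF s1.ev0_md])
  have evg': "ev0 (\<lambda>i. g k (l + i))" for k l
    using ev0_shift[OF evg, of k l] by (simp add: add.commute)
  \<comment> \<open>The -1 in this exponent yields the minus sign before the second sum of
    \<open>QO\<close>.\<close>
  have sign: "(- 1 :: complex) powi (h - (M + int l) - 1) = - ((- 1) powi (h - M) * (- 1) ^ l)" for l
  proof -
    have "(- 1 :: complex) powi (h - (M + int l) - 1) = (- 1) powi ((h - M) + - (int l + 1))"
      by (rule arg_cong[where f = "\<lambda>n. (- 1) powi n"]) simp
    also have "\<dots> = (- 1) powi (h - M) * (- 1) powi (int l + 1)"
      by (subst power_int_add) (simp_all only: powi_m1_minus, simp)
    also have "(- 1 :: complex) powi (int l + 1) = - ((- 1) ^ l)"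
      by (simp add: power_int_add)
    finally show ?thesis by simp
  qed
  \<comment> \<open>The power of z depends on l and i through l + i only, as
    \<open>bsum_bsum\<close> requires.\<close>
  have pw: "inverse z powi (N - int l) * z powi (2 * h - int k - 2 * (M + int l) - 2 - int i) = z powi (X k - M - N - int (l + i))" for l k i
  proof -
    have "inverse z powi (N - int l) = z powi (- (N - int l))"
      by (simp only: power_int_inverse power_int_minus)
    then have "inverse z powi (N - int l) * z powi (2 * h - int k - 2 * (M + int l) - 2 - int i) =
        z powi (- (N - int l)) * z powi (2 * h - int k - 2 * (M + int l) - 2 - int i)" by simp
    also have "\<dots> = z powi (- (N - int l) + (2 * h - int k - 2 * (M + int l) - 2 - int i))"
      by (rule power_int_add[symmetric]) (simp add: z_nonzero)
    also have "\<dots> = z powi (X k - M - N - int (l + i))"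
      by (rule arg_cong[where f = "\<lambda>n. z powi n"]) (simp add: X_def)
    finally show ?thesis .
  qed
  have "inverse z powi (N - int l) *\<^sub>C ps (m1 v (M + int l) a) =
      (\<Sum>k<B. - ((- 1) powi (h - M)) *\<^sub>C (- 1) ^ l *\<^sub>C bsum (X k - int l) (g k \<circ> (+) l))" for l
  proof -
    have "inverse z powi (N - int l) *\<^sub>C ps (m1 v (M + int l) a) =
        (\<Sum>k<B. - ((- 1) powi (h - M)) *\<^sub>C (- 1) ^ l *\<^sub>C inverse z powi (N - int l) *\<^sub>C
          bsum (2 * h - int k - (M + int l) - 2) (\<lambda>i. z powi (2 * h - int k - 2 * (M + int l) - 2 - int i) *\<^sub>C m1 (Ld k v) (M + int l + int i) (ps a)))"
      unfolding ps_m1[OF v B] sign complex_vector.scale_sum_right scaleC_scaleC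
      by (simp only: mult_minus_left mult_minus_right mult_ac)
    also have "\<dots> = (\<Sum>k<B. - ((- 1) powi (h - M)) *\<^sub>C (- 1) ^ l *\<^sub>C bsum (X k - int l) (g k \<circ> (+) l))"
    proof (intro sum.cong refl arg_cong[where f = "scaleC _"], goal_cases)
      case (1 k)
      have "inverse z powi (N - int l) *\<^sub>C bsum (2 * h - int k - (M + int l) - 2) (\<lambda>i. z powi (2 * h - int k - 2 * (M + int l) - 2 - int i) *\<^sub>C m1 (Ld k v) (M + int l + int i) (ps a)) =
         bsum (2 * h - int k - (M + int l) - 2) (\<lambda>i. inverse z powi (N - int l) *\<^sub>C z powi (2 * h - int k - 2 * (M + int l) - 2 - int i) *\<^sub>C m1 (Ld k v) (M + int l + int i) (ps a))"
        by (rule bsum_scale[symmetric]) (rule ev0_scale[OF s1.ev0_md])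
      also have "\<dots> = bsum (X k - int l) (g k \<circ> (+) l)"
        unfolding scaleC_scaleC pw by (simp add: g_def X_def comp_def algebra_simps)
      finally show ?case .
    qed
    finally show ?thesis .
  qed
  note inner = this
  have evo: "ev0 (\<lambda>l. (- 1) ^ l *\<^sub>C bsum (X k - int l) (\<lambda>i. g k (l + i)))" for k
  proof -
    obtain N' where N': "\<And>i. i \<ge> N' \<Longrightarrow> g k i = 0" using evg[of k] unfolding ev0_def by blast
    then show ?thesis
      unfolding ev0_def by (intro exI[of _ N'] allI impI) (simp add: N' bsum_zero)
  qed
  have "ps (bsum N (\<lambda>l. inverse z powi (N - int l) *\<^sub>C m1 v (M + int l) a)) =
      bsum N (\<lambda>l. inverse z powi (N - int l) *\<^sub>C ps (m1 v (M + int l) a))"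
    unfolding bsum_linear[OF clinear_ps ev0_scale[OF s1.ev0_md]] clinear_scale[OF clinear_ps] ..
  also have "\<dots> = (\<Sum>k<B. bsum N (\<lambda>l. - ((- 1) powi (h - M)) *\<^sub>C (- 1) ^ l *\<^sub>C bsum (X k - int l) (\<lambda>i. g k (l + i))))"
    unfolding inner comp_def by (rule bsum_sum[symmetric]; (rule finite_lessThan | rule ev0_scale[OF evo]))
  also have "\<dots> = (\<Sum>k<B. - ((- 1) powi (h - M)) *\<^sub>C bsum (X k - N) (g k))"
    unfolding bsum_scale[OF evo] bsum_bsum[OF evg] ..
  finally have R: "- ps (bsum N (\<lambda>l. inverse z powi (N - int l) *\<^sub>C m1 v (M + int l) a)) =
      (\<Sum>k<B. (- 1) powi (h - M) *\<^sub>C bsum (X k - N) (g k))"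
    by (simp add: sum_negf)
  have "(\<Sum>j\<in>Jv v. Fz (conj_vec V v j) (- N - M - 1 - 1 - j) M (ps a)) =
      Sum_any (\<lambda>j. Fz (conj_vec V v j) (- N - M - 1 - 1 - j) M (ps a))"
    by (rule Sum_any_Jv[symmetric]) (rule Fz_vec_zero)
  also have "\<dots> = (- 1) powi h *\<^sub>C Sum_any (\<lambda>k. Fz (Ld k v) (- N - M - 1 - 1 - (int k - 2 * h)) M (ps a))"
    by (rule Sum_any_conj_hom[OF v clinear_Fz_vec])
  also have "Sum_any (\<lambda>k. Fz (Ld k v) (- N - M - 1 - 1 - (int k - 2 * h)) M (ps a)) =
      (\<Sum>k<B. Fz (Ld k v) (- N - M - 1 - 1 - (int k - 2 * h)) M (ps a))"
    by (rule ev0_Sum_any) (simp add: B Fz_vec_zero)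
  also have "\<dots> = (\<Sum>k<B. bsum (X k - N) (\<lambda>i. z powi (X k - N - int i) *\<^sub>C m1 (Ld k v) (M + int i) (ps a)))"
    unfolding Fz_def s1.xp_def by (simp add: X_def algebra_simps)
  also have "(- inverse z) powi M *\<^sub>C (- 1) powi h *\<^sub>C \<dots> = (\<Sum>k<B. (- 1) powi (h - M) *\<^sub>C bsum (X k - N) (g k))"
    unfolding complex_vector.scale_sum_right
  proof (rule sum.cong[OF refl], goal_cases)
    case (1 k)
    have s: "(- inverse z) powi M * (- 1) powi h * z powi (X k - N - int i) = (- 1) powi (h - M) * z powi (X k - M - N - int i)" for i
    proof -
      have "(- inverse z) powi M = (- 1) powi M * z powi (- M)"
        unfolding powi_minus_base[of "inverse z"] by (simp only: power_int_inverse power_int_minus)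
      moreover have "z powi (- M) * z powi (X k - N - int i) = z powi (X k - M - N - int i)"
      proof -
        have "z powi (- M) * z powi (X k - N - int i) = z powi (- M + (X k - N - int i))"
          by (rule power_int_add[symmetric]) (simp add: z_nonzero)
        also have "\<dots> = z powi (X k - M - N - int i)"
          by (rule arg_cong[where f = "\<lambda>n. z powi n"]) simp
        finally show ?thesis .
      qed
      moreover have "(- 1 :: complex) powi M * (- 1) powi h = (- 1) powi (h - M)"
      proof -
        have "(- 1 :: complex) powi (h + - M) = (- 1) powi h * (- 1) powi (- M)" by (rule power_int_add) simp
        then show ?thesis unfolding powi_m1_minus by (simp add: mult.commute)
      qed
      ultimately show ?thesis by (metis mult.assoc mult.commute)
    qed
    have "(- inverse z) powi M *\<^sub>C (- 1) powi h *\<^sub>C bsum (X k - N) (\<lambda>i. z powi (X k - N - int i) *\<^sub>C m1 (Ld k v) (M + int i) (ps a)) =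
        bsum (X k - N) (\<lambda>i. ((- inverse z) powi M * (- 1) powi h) *\<^sub>C z powi (X k - N - int i) *\<^sub>C m1 (Ld k v) (M + int i) (ps a))"
      unfolding scaleC_scaleC[of _ "(- 1) powi h"] by (rule bsum_scale[symmetric]) (rule ev0_scale[OF s1.ev0_md])
    also have "\<dots> = bsum (X k - N) (\<lambda>i. (- 1) powi (h - M) *\<^sub>C g k i)"
      unfolding g_def scaleC_scaleC s ..
    also have "\<dots> = (- 1) powi (h - M) *\<^sub>C bsum (X k - N) (g k)"
      by (rule bsum_scale[OF evg])
    finally show ?case .
  qed
  finally show ?thesis unfolding R .
qed

text \<open>With 1/y = x = t + 1/z, the function (-1/z)^M y^(-N-M) (y - z)^M becomes t^M (t +
  1/z)^N; the further y^(-2) in \<open>PO\<close> is the Jacobian of x = 1/y.\<close>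

proposition PO_ps: "(- inverse z) powi M *\<^sub>C PO v (- N - M - 1) M (ps a) = ps (QO v (- M - 1) N a)"
proof (induction v rule: wt_induct)
  case (hom h v)
  have "(- inverse z) powi M *\<^sub>C PO v (- N - M - 1) M (ps a) =
      (- inverse z) powi M *\<^sub>C (\<Sum>j\<in>Jv v. F0 (conj_vec V v j) (- N - M - 1 - 1 - j) M (ps a)) +
      (- inverse z) powi M *\<^sub>C (\<Sum>j\<in>Jv v. Fz (conj_vec V v j) (- N - M - 1 - 1 - j) M (ps a))"
    unfolding PO_sum F_def sum.distrib scaleC_add_right ..
  also have "\<dots> = ps (QO v (- M - 1) N a)"
    unfolding slot1_intertwining[OF hom] slot2_intertwining[OF hom] QO_def clinear_diff[OF clinear_ps]
    by (simp add: algebra_simps)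
  finally show ?case .
next
  case (add x y)
  then show ?case
    by (simp add: clinear_add[OF clinear_PO_vec] QO_add_vec clinear_add[OF clinear_ps] scaleC_add_right)
qed

lemma PO_ps_0: "PO v n 0 (ps a) = ps (QO v (- 1) (- n - 1) a)"
  using PO_ps[of 0 v "- n - 1" a] by (simp add: scaleC_one)

text \<open>By \<open>PO_ps\<close> the conditions for \<phi> at \<open>ps b\<close> are those for
  \<open>\<phi> \<circ> ps\<close> at \<open>b\<close>, up to the nonzero scalar (-1/z)^M; since
  \<open>ps\<close> is onto, nothing is lost by testing on its values.\<close>

lemma TP_TQ:
  assumes lin: "clinear \<phi>"
  shows "\<phi> \<in> TPz \<longleftrightarrow> \<phi> \<circ> ps \<in> TQz"
proof -
  have surj: "(\<forall>a. P a) \<longleftrightarrow> (\<forall>a. P (ps a))" for P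
    using bij_ps by (metis bij_pointE)
  have lin': "clinear (\<phi> \<circ> ps)" unfolding comp_def by (rule clinear_compose[OF lin clinear_ps])
  have tr: "(\<forall>a. \<phi> (PO v n 0 a) = 0) \<longleftrightarrow> (\<forall>b. (\<phi> \<circ> ps) (QO v (- 1) (- n - 1) b) = 0)" for v n
    by (subst surj) (simp add: PO_ps_0)
  have s: "(- inverse z) powi M * (- z) ^ l = (- inverse z) powi (M - int l)" for M l
  proof -
    have "(- inverse z) powi (M - int l) = (- inverse z) powi M / (- inverse z) ^ l"
      using z_nonzero by (simp add: power_int_diff)
    also have "\<dots> = (- inverse z) powi M * (- z) ^ l"
      by (metis divide_inverse inverse_inverse_eq inverse_minus_eq power_inverse)
    finally show ?thesis ..
  qed
  \<comment> \<open>Pulling the scalar through the binomial sum requires that sum to be finite,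
    hence the truncation condition as a premise.\<close>
  have eq: "(bsum M (\<lambda>l. (- z) ^ l *\<^sub>C \<phi> (PO v ((- N - M - 1) + M - int l) 0 (ps b))) = \<phi> (PO v (- N - M - 1) M (ps b))) \<longleftrightarrow>
      (bsum M (\<lambda>i. (- inverse z) powi (M - int i) *\<^sub>C (\<phi> \<circ> ps) (QO v (- 1) (N + int i) b)) = (\<phi> \<circ> ps) (QO v (- M - 1) N b))"
    if ev: "\<exists>N. \<forall>n<N. \<forall>a. \<phi> (PO v n 0 a) = 0" for v M N b
  proof -
    obtain n0 where n0: "\<And>n a. n < n0 \<Longrightarrow> \<phi> (PO v n 0 a) = 0" using ev by blast
    have e: "ev0 (\<lambda>l. (- z) ^ l *\<^sub>C \<phi> (PO v ((- N - M - 1) + M - int l) 0 (ps b)))"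
      by (rule ev0_scale, rule ev0_int_down[where f = "\<lambda>n. \<phi> (PO v n 0 (ps b))" and N = n0]) (simp add: n0)
    have c1: "(- inverse z) powi M *\<^sub>C bsum M (\<lambda>l. (- z) ^ l *\<^sub>C \<phi> (PO v ((- N - M - 1) + M - int l) 0 (ps b))) =
        bsum M (\<lambda>i. (- inverse z) powi (M - int i) *\<^sub>C (\<phi> \<circ> ps) (QO v (- 1) (N + int i) b))"
      unfolding bsum_scale[OF e, symmetric] unfolding scaleC_scaleC s PO_ps_0 by (simp add: algebra_simps)
    have c2: "(- inverse z) powi M *\<^sub>C \<phi> (PO v (- N - M - 1) M (ps b)) = (\<phi> \<circ> ps) (QO v (- M - 1) N b)"
      unfolding clinear_scale[OF lin, symmetric] PO_ps by simp
    show ?thesis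
      unfolding c1[symmetric] c2[symmetric] using z_nonzero by (simp add: scaleC_complex_def)
  qed
  have q: "(\<forall>a M q. P a M q) \<longleftrightarrow> (\<forall>b M N. P (ps b) M (- N - M - 1))" for P :: "'a \<Rightarrow> int \<Rightarrow> int \<Rightarrow> bool"
  proof
    assume r: "\<forall>b M N. P (ps b) M (- N - M - 1)"
    show "\<forall>a M q. P a M q"
    proof (intro allI)
      fix a M q
      obtain b where b: "a = ps b" using bij_ps by (metis bij_pointE)
      show "P a M q" using r[rule_format, of b M "- q - M - 1"] by (simp add: b)
    qed
  qed blast
  show ?thesis
    unfolding TP_iff TQ_iff tr[symmetric] using lin lin' eq
    by (subst q) blast
qed

theorem dual_psi_isomorphism:
  "weak_module_isomorphism V (TPz) (YPz) (TQz) (YQz) (dual_map ps)"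
proof -
  let ?f = "dual_map ps"
  have f: "clinear ?f"
    by (rule clinearI) (simp_all add: dual_map_def fun_eq_iff scaleC_fun_def)
  have lin: "clinear \<phi>" if "\<phi> \<in> TPz" for \<phi> using that unfolding TP_iff by blast
  have im: "?f ` TPz = TQz"
  proof
    show "?f ` TPz \<subseteq> TQz"
      using TP_TQ lin unfolding dual_map_def by blast
    show "TQz \<subseteq> ?f ` TPz"
    proof
      fix lam assume l: "lam \<in> TQz"
      define g where "g = inv ps"
      have g1: "ps (g a) = a" and g2: "g (ps a) = a" for a
        using bij_ps unfolding g_def by (simp_all add: bij_is_inj bij_is_surj surj_f_inv_f)
      have ling: "clinear g"
      proof (rule clinearI)
        show "g (x + y) = g x + g y" for x y by (metis g1 g2 clinear_add[OF clinear_ps])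
        show "g (c *\<^sub>C x) = c *\<^sub>C g x" for c x by (metis g1 g2 clinear_scale[OF clinear_ps])
      qed
      have "clinear lam" using l unfolding TQ_iff by blast
      then have "clinear (lam \<circ> g)" unfolding comp_def by (rule clinear_compose[OF _ ling])
      moreover have e: "(lam \<circ> g) \<circ> ps = lam" by (simp add: fun_eq_iff g2)
      ultimately have "lam \<circ> g \<in> TPz" using TP_TQ l by metis
      then show "lam \<in> ?f ` TPz" using e unfolding dual_map_def by (metis imageI)
    qed
  qed
  have Y: "YQz v n (?f \<phi>) = ?f (YPz v n \<phi>)" if "\<phi> \<in> TPz" for v n \<phi>
  proof -
    have "clinear (?f \<phi>)" unfolding dual_map_def comp_def by (rule clinear_compose[OF lin[OF that] clinear_ps])
    then show ?thesis
      unfolding YQ_QO YP_PO[OF lin[OF that]] by (simp add: YQ_QO dual_map_def fun_eq_iff PO_ps_0)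
  qed
  have inj: "inj ?f"
  proof (rule injI)
    fix \<phi> \<phi>' assume e: "?f \<phi> = ?f \<phi>'"
    show "\<phi> = \<phi>'"
    proof
      fix a
      obtain b where "a = ps b" using bij_ps by (metis bij_pointE)
      then show "\<phi> a = \<phi>' a" using e unfolding dual_map_def by (metis comp_apply)
    qed
  qed
  show ?thesis
    unfolding weak_module_isomorphism_def
  proof (intro conjI)
    show "weak_module V (TPz) (YPz)" by (rule weak_module_TP)
    show "weak_module V (TQz) (YQz)"
      by (rule weak_module_transport[where f = ?f and W = "TPz" and Y = "YPz"])
        (use weak_module_TP f im Y in blast)+
    show "clinear_on (TPz) ?f"
      unfolding clinear_on_def by (simp add: clinear_add[OF f] clinear_scale[OF f])
    show "bij_betw ?f (TPz) (TQz)"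
      unfolding bij_betw_def using inj im by (metis inj_on_subset top_greatest)
    show "\<forall>v n. \<forall>w\<in>TPz. ?f (YPz v n w) = YQz v n (?f w)"
      using Y by simp
  qed
qed

end

theorem theorem6p8:
  fixes V :: "'v::complex_vector voa_data"
    and YA :: "(('v, 'v) tensor, 'a::complex_vector) vertex_map"
    and z :: complex
  assumes "vertex_operator_algebra V"
    and "z \<noteq> 0"
    and "weak_module (tensor_voa V) UNIV YA"
  shows "weak_module V (TP V z YA) (YP V z YA) \<and>
    (category_Co V UNIV YA \<longrightarrow>
       clinear (psi V (- z) YA) \<and> bij (psi V (- z) YA) \<and>
       weak_module_isomorphism V
         (TP V z YA) (YP V z YA)
         (TQ V (- inverse z) (theta YA)) (YQ V (- inverse z) (theta YA))
         (dual_map (psi V (- z) YA)))"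
proof (intro conjI impI)
  interpret tensor_mod_z V YA z
    using assms by unfold_locales
  show "weak_module V (TP V z YA) (YP V z YA)" by (rule weak_module_TP)
  assume "category_Co V UNIV YA"
  then interpret co_mod V YA z by unfold_locales
  show "clinear (psi V (- z) YA)" unfolding psi_ps by (rule clinear_ps)
  show "bij (psi V (- z) YA)" unfolding psi_ps by (rule bij_ps)
  show "weak_module_isomorphism V (TP V z YA) (YP V z YA)
      (TQ V (- inverse z) (theta YA)) (YQ V (- inverse z) (theta YA)) (dual_map (psi V (- z) YA))"
    unfolding psi_ps by (rule dual_psi_isomorphism)
qed

end
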